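(* For every $\lambda=(\lambda_1,\lambda_2)\in P^+$, the local Weyl module $W(\lambda)$ is spanned by the elements $$y_2(a_1)\cdots y_2(a_j)\,x_1(b_1)\cdots x_1(b_k)\,y_3(c_1)\cdots y_3(c_\ell)\,w_\lambda$$ with $j,k,\ell\ge0$, $0\le c_1<\dots<c_\ell\le\lambda_2-1$, $0\le b_1<\dots<b_k\le\lambda_2-\ell-1$ and $0\le a_1\le\dots\le a_j\le\lambda_2-\ell-k-j$. In particular, $\dim W(\lambda)\le 4^{\lambda_2}$.
   Context: All vector spaces are over $\mathbb C$. $\mathfrak g=\mathfrak{sl}(1|2)$ is the Lie superalgebra of $3\times 3$ complex matrices $A=(a_{ij})$ with $a_{11}-a_{22}-a_{33}=0$; the even part consists of block-diagonal matrices (blocks of size $1$ and $2$), the odd part of block-off-diagonal matrices, and $[A,B]=AB-(-1)^{\bar i\bar j}BA$ for $A,B$ of parity $\bar i,\bar j$. Let $E_{i,j}$ be the matrix units, $x_1=E_{1,2}$, $x_2=E_{2,3}$, $x_3=E_{1,3}$, $y_i=x_i^t$, $h_1=E_{1,1}+E_{2,2}$, $h_2=E_{2,2}-E_{3,3}$, $\mathfrak h=\mathrm{span}\{h_1,h_2\}$, $\mathfrak n^+=\mathrm{span}\{y_1,x_2,x_3\}$. A weight $\lambda\in\mathfrak h^*$ is identified with $(\lambda_1,\lambda_2)=(\lambda(h_1),\lambda(h_2))$, and $P^+=\{\lambda\in\mathfrak h^*\mid\lambda_2\in\mathbb Z_{\ge1}\}\cup\{0\}$. For a Lie superalgebra $\mathfrak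 s$, $\mathfrak s[t]=\mathfrak s\otimes\mathbb C[t]$ with bracket $[x(m),y(n)]=[x,y](m+n)$, where $x(m):=x\otimes t^m$; $x\in\mathfrak s$ is identified with $x(0)$. For $\lambda\in P^+$ the graded local Weyl module $W(\lambda)$ is the $\mathfrak g[t]$-module given as the quotient of $\mathbf U(\mathfrak g[t])$ by the left ideal generated by $\mathfrak n^+[t]$, $h(r)-\delta_{r,0}\lambda(h)$ ($h\in\mathfrak h$, $r\ge0$) and $y_2^{\lambda_2+1}$; $w_\lambda$ denotes the image of $1$. (When $j$, $k$ or $\ell$ is $0$ the corresponding product is empty and imposes no condition.) *)

theory Defs
  imports
    "HOL-Analysis.Cartesian_Space"
    "HOL-Library.Poly_Mapping"
    "HOL-Library.Z2"
    "Jordan_Normal_Form.Missing_VectorSpace"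
begin

section \<open>Complex Lie superalgebras\<close>

definition koszul_sign :: "bit \<Rightarrow> bit \<Rightarrow> complex" where
  "koszul_sign p q = (if p = 1 \<and> q = 1 then - 1 else 1)"

text \<open>\<open>homog 0\<close> and \<open>homog 1\<close> are the even and the odd part.\<close>

class lie_superalgebra = ab_group_add +
  fixes cscale :: "complex \<Rightarrow> 'a \<Rightarrow> 'a"
    and homog :: "bit \<Rightarrow> 'a set"
    and sbracket :: "'a \<Rightarrow> 'a \<Rightarrow> 'a"
  assumes cscale_add_right: "cscale c (x + y) = cscale c x + cscale c y"
    and cscale_add_left: "cscale (c + d) x = cscale c x + cscale d x"
    and cscale_cscale: "cscale c (cscale d x) = cscale (c * d) x"
    and cscale_one: "cscale 1 x = x"
    and homog_zero: "0 \<in> homog p"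
    and homog_add: "x \<in> homog p \<Longrightarrow> y \<in> homog p \<Longrightarrow> x + y \<in> homog p"
    and homog_cscale: "x \<in> homog p \<Longrightarrow> cscale c x \<in> homog p"
    and homog_inter: "homog 0 \<inter> homog 1 = {0}"
    and homog_decomp: "\<exists>u\<in>homog 0. \<exists>v\<in>homog 1. x = u + v"
    and sbracket_add_left: "sbracket (x + y) z = sbracket x z + sbracket y z"
    and sbracket_add_right: "sbracket x (y + z) = sbracket x y + sbracket x z"
    and sbracket_cscale_left: "sbracket (cscale c x) y = cscale c (sbracket x y)"
    and sbracket_cscale_right: "sbracket x (cscale c y) = cscale c (sbracket x y)"
    and sbracket_homog: "x \<in> homog p \<Longrightarrow> y \<in> homog q \<Longrightarrow> sbracket x y \<in> homog (p + q)"
    and sbracket_skew: "x \<in> homog p \<Longrightarrow> y \<in> homog q \<Longrightarrow>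
      sbracket x y = - cscale (koszul_sign p q) (sbracket y x)"
    and sbracket_jacobi: "x \<in> homog p \<Longrightarrow> y \<in> homog q \<Longrightarrow> z \<in> homog r \<Longrightarrow>
      sbracket x (sbracket y z) =
        sbracket (sbracket x y) z + cscale (koszul_sign p q) (sbracket y (sbracket x z))"

global_interpretation lie: vector_space "cscale :: complex \<Rightarrow> 'a \<Rightarrow> 'a::lie_superalgebra"
  defines cspan = lie.span
  by unfold_locales (simp_all add: cscale_add_right cscale_add_left cscale_cscale cscale_one)

lemma sbracket_zero_left [simp]: "sbracket 0 (x :: 'a::lie_superalgebra) = 0"
  using sbracket_add_left[of 0 0 x] by simp

lemma sbracket_zero_right [simp]: "sbracket (x :: 'a::lie_superalgebra) 0 = 0"
  using sbracket_add_right[of x 0 0] by simp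


section \<open>The Lie superalgebra \<open>\<s>\<l>(1|2)\<close>\<close>

definition index_parity :: "3 \<Rightarrow> bit" where
  "index_parity i = (if i = 1 then 0 else 1)"

definition parity_part :: "bit \<Rightarrow> complex^3^3 \<Rightarrow> complex^3^3" where
  "parity_part p A = (\<chi> i j. if index_parity i + index_parity j = p then A $ i $ j else 0)"

definition mat_scale :: "complex \<Rightarrow> complex^3^3 \<Rightarrow> complex^3^3" where
  "mat_scale c A = (\<chi> i j. c * A $ i $ j)"

text \<open>The bilinear extension of \<open>AB - (-1)\<^sup>p\<^sup>q BA\<close> from homogeneous matrices of parities
  \<open>p\<close>, \<open>q\<close> to all matrices.\<close>

definition supercommutator :: "complex^3^3 \<Rightarrow> complex^3^3 \<Rightarrow> complex^3^3" where
  "supercommutator A B = (\<Sum>p\<in>{0, 1}. \<Sum>q\<in>{0, 1}.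
     parity_part p A ** parity_part q B
     - mat_scale (koszul_sign p q) (parity_part q B ** parity_part p A))"

typedef sl12 = "{A :: complex^3^3. A $ 1 $ 1 - A $ 2 $ 2 - A $ 3 $ 3 = 0}"
  by (rule exI[of _ 0]) simp

setup_lifting type_definition_sl12

lemma bit_UNIV_cases: "(p :: bit) = 0 \<or> p = 1"
  by (cases p) auto

lemmas mat3_simps = vec_eq_iff forall_3 sum_3 matrix_matrix_mult_def mat_scale_def
  parity_part_def index_parity_def supercommutator_def koszul_sign_def

lemma parity_part_other:
  assumes "parity_part p A = A" and "q \<noteq> p"
  shows "parity_part q A = 0"
proof -
  have "parity_part q (parity_part p A) = 0"
    using assms(2) by (simp add: parity_part_def vec_eq_iff)
  with assms(1) show ?thesis by simp
qed

lemma supercommutator_homog: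
  assumes "parity_part p A = A" and "parity_part q B = B"
  shows "supercommutator A B = A ** B - mat_scale (koszul_sign p q) (B ** A)"
proof -
  have 0: "M ** 0 = 0" "0 ** M = 0" "mat_scale c 0 = 0" for M :: "complex^3^3" and c
    by (simp_all add: matrix_matrix_mult_def mat_scale_def vec_eq_iff)
  show ?thesis
    using bit_UNIV_cases[of p] bit_UNIV_cases[of q] assms
      parity_part_other[OF assms(1), of 0] parity_part_other[OF assms(1), of 1]
      parity_part_other[OF assms(2), of 0] parity_part_other[OF assms(2), of 1]
    by (elim disjE) (simp_all add: supercommutator_def 0)
qed

lemma parity_part_supercommutator:
  assumes "parity_part p A = A" and "parity_part q B = B"
  shows "parity_part (p + q) (supercommutator A B) = supercommutator A B"
proof -
  have mult: "parity_part (r + s) (M ** N) = M ** N"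
    if "parity_part r M = M" "parity_part s N = N" for r s M N
  proof -
    have "M $ i $ k * N $ k $ j = 0" if "index_parity i + index_parity j \<noteq> r + s" for i j k
    proof (rule ccontr)
      assume "M $ i $ k * N $ k $ j \<noteq> 0"
      then have "parity_part r M $ i $ k \<noteq> 0" "parity_part s N $ k $ j \<noteq> 0"
        using \<open>parity_part r M = M\<close> \<open>parity_part s N = N\<close> by auto
      then have "index_parity i + index_parity k = r" "index_parity k + index_parity j = s"
        by (auto simp: parity_part_def split: if_splits)
      with that show False
        by (auto simp: index_parity_def split: if_splits)
    qed
    then show ?thesis
      by (auto simp: parity_part_def matrix_matrix_mult_def vec_eq_iff intro!: sum.neutral)
  qed
  have lin: "parity_part r (M - mat_scale c N) = parity_part r M - mat_scale c (parity_part r N)"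
    for r M N c
    by (simp add: parity_part_def mat_scale_def vec_eq_iff)
  show ?thesis
    by (simp only: supercommutator_homog[OF assms] lin mult[OF assms]
        mult[OF assms(2,1), unfolded add.commute[of q p]])
qed

lemma supercommutator_jacobi:
  assumes "parity_part p A = A" and "parity_part q B = B" and "parity_part r C = C"
  shows "supercommutator A (supercommutator B C) =
    supercommutator (supercommutator A B) C
      + mat_scale (koszul_sign p q) (supercommutator B (supercommutator A C))"
proof -
  note sc = supercommutator_homog and pp = parity_part_supercommutator
  have lin: "M ** (N - mat_scale c P) = M ** N - mat_scale c (M ** P)"
    "(N - mat_scale c P) ** M = N ** M - mat_scale c (P ** M)"
    "M ** (N + P) = M ** N + M ** P" "(N + P) ** M = N ** M + P ** M"
    "M ** (N - P) = M ** N - M ** P" "(N - P) ** M = N ** M - P ** M"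
    for M N P :: "complex^3^3" and c
    by (simp_all add: matrix_matrix_mult_def mat_scale_def vec_eq_iff sum_subtractf sum.distrib
        sum_distrib_left algebra_simps)
  have ms: "mat_scale c (M - N) = mat_scale c M - mat_scale c N"
    "mat_scale c (mat_scale d M) = mat_scale (c * d) M" "mat_scale 1 M = M"
    "mat_scale (- 1) M = - M" for M N c d
    by (simp_all add: mat_scale_def vec_eq_iff algebra_simps)
  have l: "supercommutator A (supercommutator B C) =
      A ** (B ** C - mat_scale (koszul_sign q r) (C ** B))
      - mat_scale (koszul_sign p (q + r)) ((B ** C - mat_scale (koszul_sign q r) (C ** B)) ** A)"
    using sc[OF assms(1) pp[OF assms(2,3)]] by (simp only: sc[OF assms(2,3)])
  have m: "supercommutator (supercommutator A B) C =
      (A ** B - mat_scale (koszul_sign p q) (B ** A)) ** C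
      - mat_scale (koszul_sign (p + q) r) (C ** (A ** B - mat_scale (koszul_sign p q) (B ** A)))"
    using sc[OF pp[OF assms(1,2)] assms(3)] by (simp only: sc[OF assms(1,2)])
  have n: "supercommutator B (supercommutator A C) =
      B ** (A ** C - mat_scale (koszul_sign p r) (C ** A))
      - mat_scale (koszul_sign q (p + r)) ((A ** C - mat_scale (koszul_sign p r) (C ** A)) ** B)"
    using sc[OF assms(2) pp[OF assms(1,3)]] by (simp only: sc[OF assms(1,3)])
  show ?thesis
    unfolding l m n
    using bit_UNIV_cases[of p] bit_UNIV_cases[of q] bit_UNIV_cases[of r]
    by (elim disjE) (simp_all add: lin ms koszul_sign_def matrix_mul_assoc algebra_simps)
qed

lemma supercommutator_bilinear:
  "supercommutator (A + B) C = supercommutator A C + supercommutator B C"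
  "supercommutator A (B + C) = supercommutator A B + supercommutator A C"
  "supercommutator (mat_scale c A) B = mat_scale c (supercommutator A B)"
  "supercommutator A (mat_scale c B) = mat_scale c (supercommutator A B)"
proof -
  have pp: "parity_part p (M + N) = parity_part p M + parity_part p N"
    "parity_part p (mat_scale c M) = mat_scale c (parity_part p M)" for p M N c
    by (simp_all add: parity_part_def mat_scale_def vec_eq_iff)
  have mm: "(M + N) ** P = M ** P + N ** P" "P ** (M + N) = P ** M + P ** N"
    "mat_scale c M ** P = mat_scale c (M ** P)" "P ** mat_scale c M = mat_scale c (P ** M)"
    for M N P :: "complex^3^3" and c
    by (simp_all add: matrix_matrix_mult_def mat_scale_def vec_eq_iff sum.distrib
        sum_distrib_left algebra_simps)
  have ms: "mat_scale c (M + N) = mat_scale c M + mat_scale c N"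
    "mat_scale c (M - N) = mat_scale c M - mat_scale c N"
    "mat_scale c (mat_scale d M) = mat_scale d (mat_scale c M)" for M N c d
    by (simp_all add: mat_scale_def vec_eq_iff algebra_simps)
  have "mat_scale 1 M = M" "mat_scale (- 1) M = - M"  for M
    by (simp_all add: mat_scale_def vec_eq_iff)
  note ks = koszul_sign_def this
  have neg: "mat_scale c (- M) = - mat_scale c M" for c M
    by (simp add: mat_scale_def vec_eq_iff)
  show "supercommutator (A + B) C = supercommutator A C + supercommutator B C"
    "supercommutator A (B + C) = supercommutator A B + supercommutator A C"
    "supercommutator (mat_scale c A) B = mat_scale c (supercommutator A B)"
    "supercommutator A (mat_scale c B) = mat_scale c (supercommutator A B)"
    by (simp_all add: supercommutator_def pp mm ks) (simp_all add: ms neg algebra_simps)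
qed

lift_definition sl12_part :: "bit \<Rightarrow> sl12 \<Rightarrow> sl12" is parity_part
  using bit_UNIV_cases by (auto simp: mat3_simps)

instantiation sl12 :: lie_superalgebra
begin

lift_definition zero_sl12 :: sl12 is 0 by simp
lift_definition plus_sl12 :: "sl12 \<Rightarrow> sl12 \<Rightarrow> sl12" is "(+)" by (simp add: algebra_simps)
lift_definition minus_sl12 :: "sl12 \<Rightarrow> sl12 \<Rightarrow> sl12" is "(-)" by (simp add: algebra_simps)
lift_definition uminus_sl12 :: "sl12 \<Rightarrow> sl12" is uminus by (simp add: algebra_simps)
lift_definition cscale_sl12 :: "complex \<Rightarrow> sl12 \<Rightarrow> sl12" is mat_scale
  by (simp add: mat_scale_def flip: right_diff_distrib)
definition homog_sl12 :: "bit \<Rightarrow> sl12 set" where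
  "homog p = {x. sl12_part p x = x}"
lift_definition sbracket_sl12 :: "sl12 \<Rightarrow> sl12 \<Rightarrow> sl12" is supercommutator
  by (simp add: mat3_simps algebra_simps)

instance
proof
  fix x y z :: sl12 and c d :: complex and p q r :: bit
  show "x + y + z = x + (y + z)" "x + y = y + x" "0 + x = x" "- x + x = 0" "x - y = x + - y"
    by (transfer; simp add: algebra_simps)+
  show "cscale c (x + y) = cscale c x + cscale c y"
    "cscale (c + d) x = cscale c x + cscale d x"
    "cscale c (cscale d x) = cscale (c * d) x" "cscale 1 x = x"
    by (transfer; simp add: mat3_simps algebra_simps)+
  show zero_homog: "(0::sl12) \<in> homog p" for p
    unfolding homog_sl12_def mem_Collect_eq by transfer (simp add: mat3_simps)
  show "x + y \<in> homog p" if "x \<in> homog p" "y \<in> homog p"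
    using that unfolding homog_sl12_def mem_Collect_eq by transfer (auto simp: mat3_simps algebra_simps)
  show "cscale c x \<in> homog p" if "x \<in> homog p"
    using that unfolding homog_sl12_def mem_Collect_eq by transfer (auto simp: mat3_simps simp flip: right_diff_distrib)
  have "u = 0" if "u \<in> homog 0" "u \<in> homog 1" for u :: sl12
    using that unfolding homog_sl12_def mem_Collect_eq by transfer (auto simp: mat3_simps)
  then show "homog 0 \<inter> homog 1 = {0 :: sl12}"
    using zero_homog by auto
  show "\<exists>u\<in>homog 0. \<exists>v\<in>homog 1. x = u + v"
    unfolding homog_sl12_def Bex_def mem_Collect_eq
    by (intro exI[of _ "sl12_part 0 x"] exI[of _ "sl12_part 1 x"] conjI; transfer)
      (auto simp: mat3_simps)
  show "sbracket (x + y) z = sbracket x z + sbracket y z"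
    "sbracket x (y + z) = sbracket x y + sbracket x z"
    "sbracket (cscale c x) y = cscale c (sbracket x y)"
    "sbracket x (cscale c y) = cscale c (sbracket x y)"
    by (transfer; simp add: supercommutator_bilinear)+
  show "sbracket x y \<in> homog (p + q)" if "x \<in> homog p" "y \<in> homog q"
    using that unfolding homog_sl12_def mem_Collect_eq
    by transfer (rule parity_part_supercommutator)
  show "sbracket x y = - cscale (koszul_sign p q) (sbracket y x)"
    if "x \<in> homog p" "y \<in> homog q"
    using that unfolding homog_sl12_def mem_Collect_eq
    by transfer (auto simp: supercommutator_homog koszul_sign_def mat_scale_def vec_eq_iff)
  show "sbracket x (sbracket y z) =
        sbracket (sbracket x y) z + cscale (koszul_sign p q) (sbracket y (sbracket x z))"
    if "x \<in> homog p" "y \<in> homog q" "z \<in> homog r"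
    using that unfolding homog_sl12_def mem_Collect_eq
    by transfer (rule supercommutator_jacobi)
qed

end


section \<open>Current algebras\<close>

text \<open>\<open>\<s> \<otimes> \<complex>[t]\<close> consists of the finitely supported functions \<open>nat \<Rightarrow> \<s>\<close>; the element \<open>x \<otimes> t\<^sup>m\<close> is
  \<open>Poly_Mapping.single m x\<close>. The bracket below is the bilinear one with
  \<open>[x \<otimes> t\<^sup>i, y \<otimes> t\<^sup>j] = [x, y] \<otimes> t\<^sup>i\<^sup>+\<^sup>j\<close>. (The instance covers any
  commutative monoid of exponents.)\<close>

type_synonym 'a current = "nat \<Rightarrow>\<^sub>0 'a"

lemma poly_mapping_add_single_induct:
  fixes f :: "'k \<Rightarrow>\<^sub>0 'b::ab_group_add"
  assumes "P 0"
    and step: "\<And>f k v. k \<notin> Poly_Mapping.keys f \<Longrightarrow> P f \<Longrightarrow> P (f + Poly_Mapping.single k v)"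
  shows "P f"
proof (induction f rule: update_induct)
  case (update f a b)
  have "Poly_Mapping.update a b f = f + Poly_Mapping.single a b"
    using update(1)
    by (intro poly_mapping_eqI) (auto simp: lookup_update lookup_add lookup_single when_def in_keys_iff)
  with step[OF update(1,3), of b] show ?case by simp
qed (simp add: \<open>P 0\<close>)

instantiation poly_mapping :: (comm_monoid_add, lie_superalgebra) lie_superalgebra
begin

definition cscale_poly_mapping :: "complex \<Rightarrow> ('a \<Rightarrow>\<^sub>0 'b) \<Rightarrow> ('a \<Rightarrow>\<^sub>0 'b)" where
  "cscale c f = Poly_Mapping.map (cscale c) f"

definition homog_poly_mapping :: "bit \<Rightarrow> ('a \<Rightarrow>\<^sub>0 'b) set" where
  "homog p = {f. \<forall>k. Poly_Mapping.lookup f k \<in> homog p}"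

definition sbracket_poly_mapping :: "('a \<Rightarrow>\<^sub>0 'b) \<Rightarrow> ('a \<Rightarrow>\<^sub>0 'b) \<Rightarrow> ('a \<Rightarrow>\<^sub>0 'b)" where
  "sbracket f g = (\<Sum>i\<in>Poly_Mapping.keys f. \<Sum>j\<in>Poly_Mapping.keys g.
     Poly_Mapping.single (i + j)
       (sbracket (Poly_Mapping.lookup f i) (Poly_Mapping.lookup g j)))"

lemma lookup_cscale: "Poly_Mapping.lookup (cscale c (f :: 'a \<Rightarrow>\<^sub>0 'b)) k = cscale c (Poly_Mapping.lookup f k)"
  by (auto simp: cscale_poly_mapping_def map.rep_eq when_def)

lemma cscale_single: "cscale c (Poly_Mapping.single k (v::'b)) = Poly_Mapping.single (k::'a) (cscale c v)"
  by (intro poly_mapping_eqI) (simp add: lookup_cscale lookup_single when_def)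

lemma sbracket_superset:
  fixes f g :: "'a \<Rightarrow>\<^sub>0 'b"
  assumes "finite S" "Poly_Mapping.keys f \<subseteq> S" "finite T" "Poly_Mapping.keys g \<subseteq> T"
  shows "sbracket f g = (\<Sum>i\<in>S. \<Sum>j\<in>T. Poly_Mapping.single (i + j)
     (sbracket (Poly_Mapping.lookup f i) (Poly_Mapping.lookup g j)))"
proof -
  have "sbracket f g = (\<Sum>i\<in>Poly_Mapping.keys f. \<Sum>j\<in>T. Poly_Mapping.single (i + j)
     (sbracket (Poly_Mapping.lookup f i) (Poly_Mapping.lookup g j)))"
    unfolding sbracket_poly_mapping_def using assms(3,4)
    by (intro sum.cong refl sum.mono_neutral_left) (auto simp: in_keys_iff)
  also have "\<dots> = (\<Sum>i\<in>S. \<Sum>j\<in>T. Poly_Mapping.single (i + j)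
     (sbracket (Poly_Mapping.lookup f i) (Poly_Mapping.lookup g j)))"
    using assms(1,2) by (intro sum.mono_neutral_left) (auto simp: in_keys_iff)
  finally show ?thesis .
qed

lemma sbracket_single:
  "sbracket (Poly_Mapping.single i x) (Poly_Mapping.single j y) =
    Poly_Mapping.single (i + j) (sbracket x y)" for i j :: 'a and x y :: 'b
  by (subst sbracket_superset[of "{i}" _ "{j}"]) (auto simp: in_keys_iff lookup_single)

lemma pm_sbracket_add_left: "sbracket (f + g) h = sbracket f h + sbracket g h" for f g h :: "'a \<Rightarrow>\<^sub>0 'b"
  using sbracket_superset[of "Poly_Mapping.keys f \<union> Poly_Mapping.keys g" f "Poly_Mapping.keys h" h]
    sbracket_superset[of "Poly_Mapping.keys f \<union> Poly_Mapping.keys g" g "Poly_Mapping.keys h" h]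
    sbracket_superset[of "Poly_Mapping.keys f \<union> Poly_Mapping.keys g" "f + g" "Poly_Mapping.keys h" h]
  by (simp add: Poly_Mapping.keys_add lookup_add sbracket_add_left single_add sum.distrib)

lemma pm_sbracket_add_right: "sbracket h (f + g) = sbracket h f + sbracket h g" for f g h :: "'a \<Rightarrow>\<^sub>0 'b"
  using sbracket_superset[of "Poly_Mapping.keys h" h "Poly_Mapping.keys f \<union> Poly_Mapping.keys g" f]
    sbracket_superset[of "Poly_Mapping.keys h" h "Poly_Mapping.keys f \<union> Poly_Mapping.keys g" g]
    sbracket_superset[of "Poly_Mapping.keys h" h "Poly_Mapping.keys f \<union> Poly_Mapping.keys g" "f + g"]
  by (simp add: Poly_Mapping.keys_add lookup_add sbracket_add_right single_add sum.distrib)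

lemma pm_cscale_add: "cscale c (f + g) = cscale c f + cscale c g" for f g :: "'a \<Rightarrow>\<^sub>0 'b"
  by (intro poly_mapping_eqI) (simp add: lookup_cscale lookup_add cscale_add_right)

lemma pm_zero: "cscale c (0 :: 'a \<Rightarrow>\<^sub>0 'b) = 0" "sbracket 0 f = 0" "sbracket f 0 = 0" for f :: "'a \<Rightarrow>\<^sub>0 'b"
  using pm_cscale_add[of c "0 :: 'a \<Rightarrow>\<^sub>0 'b" 0] pm_sbracket_add_left[of 0 0 f] pm_sbracket_add_right[of f 0 0]
  by simp_all

lemma homog_induct [consumes 1, case_names zero single add]:
  fixes f :: "'a \<Rightarrow>\<^sub>0 'b"
  assumes "f \<in> homog p" and "P 0"
    and "\<And>k v. v \<in> homog p \<Longrightarrow> P (Poly_Mapping.single k v)"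
    and "\<And>f g. P f \<Longrightarrow> P g \<Longrightarrow> P (f + g)"
  shows "P f"
  using assms(1)
proof (induction f rule: poly_mapping_add_single_induct)
  case (2 f k v)
  have "Poly_Mapping.lookup f l \<in> homog p" for l
    using 2(1,3) homog_zero[where 'a = 'b, of p]
    by (cases "l = k") (auto simp: homog_poly_mapping_def lookup_add lookup_single when_def in_keys_iff
        dest: spec[of _ l])
  moreover have "v \<in> homog p"
    using 2(1,3) by (auto simp: homog_poly_mapping_def lookup_add lookup_single when_def in_keys_iff
        dest: spec[of _ k])
  ultimately show ?case
    using 2(2) assms(3,4) by (simp add: homog_poly_mapping_def)
qed (rule assms(2))

instance
proof
  fix f g h :: "'a \<Rightarrow>\<^sub>0 'b" and c d :: complex and p q r :: bit
  show "cscale c (f + g) = cscale c f + cscale c g" by (rule pm_cscale_add)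
  show "cscale (c + d) f = cscale c f + cscale d f"
    "cscale c (cscale d f) = cscale (c * d) f" "cscale 1 f = f"
    by (intro poly_mapping_eqI;
        simp add: lookup_cscale lookup_add cscale_add_left cscale_cscale cscale_one)+
  show pm_homog_zero: "(0 :: 'a \<Rightarrow>\<^sub>0 'b) \<in> homog p" for p
    by (simp add: homog_poly_mapping_def homog_zero)
  show pm_homog_add: "f + g \<in> homog p" if "f \<in> homog p" "g \<in> homog p" for f g :: "'a \<Rightarrow>\<^sub>0 'b" and p
    using that by (simp add: homog_poly_mapping_def homog_add lookup_add)
  show "cscale c f \<in> homog p" if "f \<in> homog p"
    using that by (simp add: homog_poly_mapping_def homog_cscale lookup_cscale)
  have homog_single: "Poly_Mapping.single k v \<in> homog p" if "v \<in> homog p" for k :: 'a and v :: 'b and p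
    using that by (simp add: homog_poly_mapping_def lookup_single when_def homog_zero)
  show "homog 0 \<inter> homog 1 = {0 :: 'a \<Rightarrow>\<^sub>0 'b}"
  proof -
    have "u = 0" if "u \<in> homog 0" "u \<in> homog 1" for u :: "'a \<Rightarrow>\<^sub>0 'b"
      using that homog_inter[where 'a = 'b]
      by (intro poly_mapping_eqI) (auto simp: homog_poly_mapping_def)
    then show ?thesis using pm_homog_zero by auto
  qed
  show "\<exists>u\<in>homog 0. \<exists>v\<in>homog 1. f = u + v"
  proof (induction f rule: poly_mapping_add_single_induct)
    case 1
    show ?case using pm_homog_zero by (intro bexI[of _ 0]) auto
  next
    case (2 f k v)
    then obtain u0 u1 where u: "u0 \<in> homog 0" "u1 \<in> homog 1" "f = u0 + u1" by blast
    obtain v0 v1 where v: "v0 \<in> homog 0" "v1 \<in> homog 1" "v = v0 + v1"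
      using homog_decomp[of v] by blast
    have "f + Poly_Mapping.single k v =
        (u0 + Poly_Mapping.single k v0) + (u1 + Poly_Mapping.single k v1)"
      by (simp add: u v single_add algebra_simps)
    with u v show ?case by (blast intro: pm_homog_add homog_single)
  qed
  show "sbracket (f + g) h = sbracket f h + sbracket g h" by (rule pm_sbracket_add_left)
  show "sbracket f (g + h) = sbracket f g + sbracket f h" by (rule pm_sbracket_add_right)
  show "sbracket (cscale c f) g = cscale c (sbracket f g)"
  proof (induction f rule: poly_mapping_add_single_induct)
    case (2 f k v)
    have "sbracket (cscale c (Poly_Mapping.single k v)) g = cscale c (sbracket (Poly_Mapping.single k v) g)"
      by (induction g rule: poly_mapping_add_single_induct)
        (simp_all add: pm_zero pm_sbracket_add_right pm_cscale_add cscale_single sbracket_single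
          sbracket_cscale_left)
    with 2 show ?case by (simp add: pm_sbracket_add_left pm_cscale_add)
  qed (simp add: pm_zero)
  show "sbracket f (cscale c g) = cscale c (sbracket f g)"
  proof (induction f rule: poly_mapping_add_single_induct)
    case (2 f k v)
    have "sbracket (Poly_Mapping.single k v) (cscale c g) = cscale c (sbracket (Poly_Mapping.single k v) g)"
      by (induction g rule: poly_mapping_add_single_induct)
        (simp_all add: pm_zero pm_sbracket_add_right pm_cscale_add cscale_single sbracket_single
          sbracket_cscale_right)
    with 2 show ?case by (simp add: pm_sbracket_add_left pm_cscale_add)
  qed (simp add: pm_zero)
  show "sbracket f g \<in> homog (p + q)" if "f \<in> homog p" "g \<in> homog q"
    using that(1)
  proof (induction f rule: homog_induct)
    case (single k v)
    show ?case using that(2)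
    proof (induction g rule: homog_induct)
      case g: (single l w)
      show ?case
        unfolding sbracket_single by (intro homog_single sbracket_homog single g)
    next
      case (add g g')
      then show ?case unfolding pm_sbracket_add_right by (rule pm_homog_add)
    qed (simp only: pm_zero pm_homog_zero)
  next
    case (add f f')
    then show ?case unfolding pm_sbracket_add_left by (rule pm_homog_add)
  qed (simp only: pm_zero pm_homog_zero)
  show "sbracket f g = - cscale (koszul_sign p q) (sbracket g f)" if "f \<in> homog p" "g \<in> homog q"
    using that(1)
  proof (induction f rule: homog_induct)
    case (single k v)
    show ?case using that(2) single
    proof (induction g rule: homog_induct)
      case (single l w)
      show ?case
        using sbracket_skew[OF single(2,1)]
        by (simp add: sbracket_single cscale_single single_uminus add.commute)
    qed (simp_all add: pm_zero pm_sbracket_add_right pm_sbracket_add_left pm_cscale_add)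
  qed (simp_all add: pm_zero pm_sbracket_add_right pm_sbracket_add_left pm_cscale_add)
  show "sbracket f (sbracket g h) =
        sbracket (sbracket f g) h + cscale (koszul_sign p q) (sbracket g (sbracket f h))"
    if "f \<in> homog p" "g \<in> homog q" "h \<in> homog r"
    using that(1)
  proof (induction f rule: homog_induct)
    case f: (single k v)
    show ?case using that(2)
    proof (induction g rule: homog_induct)
      case g: (single l w)
      show ?case using that(3)
      proof (induction h rule: homog_induct)
        case (single m x)
        show ?case
          using sbracket_jacobi[OF f g single]
          by (simp add: sbracket_single cscale_single single_add [symmetric] add.assoc add.left_commute)
      qed (simp_all add: pm_zero pm_sbracket_add_right pm_sbracket_add_left pm_cscale_add algebra_simps)
    qed (simp_all add: pm_zero pm_sbracket_add_right pm_sbracket_add_left pm_cscale_add algebra_simps)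
  qed (simp_all add: pm_zero pm_sbracket_add_right pm_sbracket_add_left pm_cscale_add algebra_simps)
qed

end


section \<open>Universal enveloping algebras\<close>

text \<open>With words as a monoid, \<open>'a list \<Rightarrow>\<^sub>0 complex\<close> is the free associative unital algebra on the
  symbols \<open>'a\<close>.\<close>

instantiation list :: (type) monoid_add
begin

definition zero_list :: "'a list" where "zero_list = []"

definition plus_list :: "'a list \<Rightarrow> 'a list \<Rightarrow> 'a list" where "plus_list = (@)"

instance by standard (simp_all add: zero_list_def plus_list_def)

end

type_synonym 'a free_alg = "'a list \<Rightarrow>\<^sub>0 complex"

definition free_gen :: "'a \<Rightarrow> 'a free_alg" where
  "free_gen x = Poly_Mapping.single [x] 1"

definition free_const :: "complex \<Rightarrow> 'a free_alg" where
  "free_const c = Poly_Mapping.single [] c"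

definition is_left_ideal :: "'r::ring_1 set \<Rightarrow> bool" where
  "is_left_ideal I \<longleftrightarrow> 0 \<in> I \<and> (\<forall>x\<in>I. \<forall>y\<in>I. x + y \<in> I) \<and> (\<forall>r. \<forall>x\<in>I. r * x \<in> I)"

definition is_two_sided_ideal :: "'r::ring_1 set \<Rightarrow> bool" where
  "is_two_sided_ideal I \<longleftrightarrow> is_left_ideal I \<and> (\<forall>r. \<forall>x\<in>I. x * r \<in> I)"

text \<open>The first two families of relations turn the free algebra on the set underlying \<open>\<s>\<close> into the
  tensor algebra of the vector space \<open>\<s>\<close>.\<close>

definition env_relations :: "'a::lie_superalgebra free_alg set" where
  "env_relations =
    {free_gen (x + y) - (free_gen x + free_gen y) | x y. True} \<union>
    {free_gen (cscale c x) - free_const c * free_gen x | c x. True} \<union>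
    {free_gen x * free_gen y - free_const (koszul_sign p q) * (free_gen y * free_gen x)
       - free_gen (sbracket x y) | x y p q. x \<in> homog p \<and> y \<in> homog q}"

definition env_ideal :: "'a::lie_superalgebra free_alg set" where
  "env_ideal = is_two_sided_ideal hull env_relations"

lemma is_left_idealD:
  assumes "is_left_ideal I"
  shows "0 \<in> I" "x \<in> I \<Longrightarrow> y \<in> I \<Longrightarrow> x + y \<in> I" "x \<in> I \<Longrightarrow> r * x \<in> I"
    "x \<in> I \<Longrightarrow> - x \<in> I" "x \<in> I \<Longrightarrow> y \<in> I \<Longrightarrow> x - y \<in> I"
proof -
  show neg: "- x \<in> I" if "x \<in> I" for x
    using assms that unfolding is_left_ideal_def by (metis mult_minus1)
  show "x - y \<in> I" if "x \<in> I" "y \<in> I"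
    using assms that neg unfolding is_left_ideal_def by (metis add_uminus_conv_diff)
qed (use assms in \<open>auto simp: is_left_ideal_def\<close>)

lemma is_left_ideal_hull: "is_left_ideal (is_left_ideal hull S)"
  by (rule hull_in) (auto simp: is_left_ideal_def)

lemma is_two_sided_ideal_env_ideal: "is_two_sided_ideal env_ideal"
  unfolding env_ideal_def
  by (rule hull_in) (auto simp: is_two_sided_ideal_def is_left_ideal_def)

lemmas env_idealD =
  is_left_idealD[OF is_two_sided_ideal_env_ideal[unfolded is_two_sided_ideal_def, THEN conjunct1]]

lemma env_ideal_mult_right: "x \<in> env_ideal \<Longrightarrow> x * r \<in> env_ideal"
  using is_two_sided_ideal_env_ideal by (auto simp: is_two_sided_ideal_def)

lemma env_relations_subset: "env_relations \<subseteq> env_ideal"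
  unfolding env_ideal_def by (rule hull_subset)

lemma free_const_mult: "free_const c * free_const d = free_const (c * d)"
  by (simp add: free_const_def mult_single plus_list_def)

lemma free_const_one: "free_const 1 = 1"
  by (simp add: free_const_def zero_list_def flip: single_one)

lemma lookup_free_mult_Nil:
  fixes f g :: "'a free_alg"
  shows "Poly_Mapping.lookup (f * g) [] = Poly_Mapping.lookup f [] * Poly_Mapping.lookup g []"
proof (induction f rule: poly_mapping_add_single_induct)
  case (2 f u c)
  have "Poly_Mapping.lookup (Poly_Mapping.single u c * g) [] =
      Poly_Mapping.lookup (Poly_Mapping.single u c) [] * Poly_Mapping.lookup g []"
    by (induction g rule: poly_mapping_add_single_induct)
      (simp_all add: distrib_left lookup_add mult_single lookup_single when_def plus_list_def)
  with 2 show ?case by (simp add: distrib_right lookup_add)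
qed simp

lemma one_notin_env_ideal: "(1 :: 'a::lie_superalgebra free_alg) \<notin> env_ideal"
proof -
  let ?I = "{f :: 'a free_alg. Poly_Mapping.lookup f [] = 0}"
  have "is_two_sided_ideal ?I"
    by (auto simp: is_two_sided_ideal_def is_left_ideal_def lookup_add lookup_free_mult_Nil)
  moreover have "env_relations \<subseteq> ?I"
    by (auto simp: env_relations_def lookup_minus lookup_add lookup_free_mult_Nil free_gen_def
        lookup_single)
  ultimately have "env_ideal \<subseteq> ?I"
    unfolding env_ideal_def by (intro hull_minimal)
  moreover have "Poly_Mapping.lookup (1 :: 'a free_alg) [] = 1"
    by (simp add: lookup_one zero_list_def)
  ultimately show ?thesis by auto
qed

quotient_type (overloaded) 'a env = "'a::lie_superalgebra free_alg" / "\<lambda>f g. f - g \<in> env_ideal"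
proof (rule equivpI)
  show "reflp (\<lambda>f g. f - g \<in> (env_ideal :: 'a free_alg set))"
    by (rule reflpI) (simp add: env_idealD(1))
  show "symp (\<lambda>f g. f - g \<in> (env_ideal :: 'a free_alg set))"
  proof (rule sympI)
    fix f g :: "'a free_alg"
    assume "f - g \<in> env_ideal"
    from env_idealD(4)[OF this] show "g - f \<in> env_ideal" by simp
  qed
  show "transp (\<lambda>f g. f - g \<in> (env_ideal :: 'a free_alg set))"
  proof (rule transpI)
    fix f g h :: "'a free_alg"
    assume "f - g \<in> env_ideal" "g - h \<in> env_ideal"
    from env_idealD(2)[OF this] show "f - h \<in> env_ideal" by simp
  qed
qed

instantiation env :: (lie_superalgebra) ring_1
begin

lift_definition zero_env :: "'a env" is 0 .
lift_definition one_env :: "'a env" is 1 .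
lift_definition plus_env :: "'a env \<Rightarrow> 'a env \<Rightarrow> 'a env" is "(+)"
proof -
  fix f f' g g' :: "'a free_alg"
  assume "f - f' \<in> env_ideal" "g - g' \<in> env_ideal"
  from env_idealD(2)[OF this] show "f + g - (f' + g') \<in> env_ideal"
    by (simp add: algebra_simps)
qed
lift_definition minus_env :: "'a env \<Rightarrow> 'a env \<Rightarrow> 'a env" is "(-)"
proof -
  fix f f' g g' :: "'a free_alg"
  assume "f - f' \<in> env_ideal" "g - g' \<in> env_ideal"
  from env_idealD(5)[OF this] show "f - g - (f' - g') \<in> env_ideal"
    by (simp add: algebra_simps)
qed
lift_definition uminus_env :: "'a env \<Rightarrow> 'a env" is uminus
proof -
  fix f f' :: "'a free_alg"
  assume "f - f' \<in> env_ideal"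
  from env_idealD(4)[OF this] show "- f - - f' \<in> env_ideal" by simp
qed
lift_definition times_env :: "'a env \<Rightarrow> 'a env \<Rightarrow> 'a env" is "(*)"
proof -
  fix f f' g g' :: "'a free_alg"
  assume "f - f' \<in> env_ideal" "g - g' \<in> env_ideal"
  then have "f * (g - g') + (f - f') * g' \<in> env_ideal"
    by (intro env_idealD(2) env_idealD(3) env_ideal_mult_right)
  then show "f * g - f' * g' \<in> env_ideal"
    by (simp add: algebra_simps)
qed

instance
proof
  fix a b c :: "'a env"
  have eq: "f - g \<in> env_ideal" if "f = g" for f g :: "'a free_alg"
    using that env_idealD(1) by simp
  show "a + b + c = a + (b + c)" by transfer (rule eq, rule add.assoc)
  show "a + b = b + a" by transfer (rule eq, rule add.commute)
  show "0 + a = a" by transfer (rule eq, simp)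
  show "- a + a = 0" by transfer (rule eq, simp)
  show "a - b = a + - b" by transfer (rule eq, simp)
  show "a * b * c = a * (b * c)" by transfer (rule eq, rule mult.assoc)
  show "(a + b) * c = a * c + b * c" by transfer (rule eq, rule distrib_right)
  show "a * (b + c) = a * b + a * c" by transfer (rule eq, rule distrib_left)
  show "1 * a = a" by transfer (rule eq, simp)
  show "a * 1 = a" by transfer (rule eq, simp)
  show "(0 :: 'a env) \<noteq> 1"
  proof (transfer, rule notI)
    assume "0 - 1 \<in> (env_ideal :: 'a free_alg set)"
    from env_idealD(4)[OF this] one_notin_env_ideal[where 'a = 'a] show False by simp
  qed
qed

end

lift_definition env_gen :: "'a::lie_superalgebra \<Rightarrow> 'a env" is free_gen .

lift_definition env_const :: "complex \<Rightarrow> 'a::lie_superalgebra env" is free_const .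

lemma env_gen_add: "env_gen (x + y) = env_gen x + env_gen y"
  by transfer (rule subsetD[OF env_relations_subset], unfold env_relations_def, blast)

lemma env_gen_cscale: "env_gen (cscale c x) = env_const c * env_gen x"
  by transfer (rule subsetD[OF env_relations_subset], unfold env_relations_def, blast)

lemma env_gen_sbracket:
  assumes "x \<in> homog p" and "y \<in> homog q"
  shows "env_gen x * env_gen y - env_const (koszul_sign p q) * (env_gen y * env_gen x) =
    env_gen (sbracket x y)"
  using assms
  by transfer (rule subsetD[OF env_relations_subset], unfold env_relations_def, blast)

lemma env_const_add: "env_const (c + d) = env_const c + env_const d"
  by transfer (simp add: free_const_def single_add env_idealD(1))

lemma env_const_mult: "env_const (c * d) = env_const c * env_const d"
  by transfer (simp add: free_const_mult env_idealD(1))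

lemma env_const_one: "env_const 1 = 1"
  by transfer (simp add: free_const_one env_idealD(1))

lemma env_const_zero: "env_const 0 = 0"
  using env_const_add[of 0 0] by simp


section \<open>Local Weyl modules for \<open>\<s>\<l>(1|2)[t]\<close>\<close>

definition matrix_unit :: "3 \<Rightarrow> 3 \<Rightarrow> complex^3^3" where
  "matrix_unit i j = (\<chi> k l. if k = i \<and> l = j then 1 else 0)"

lift_definition sl_x1 :: sl12 is "matrix_unit 1 2" by (simp add: matrix_unit_def)
lift_definition sl_x2 :: sl12 is "matrix_unit 2 3" by (simp add: matrix_unit_def)
lift_definition sl_x3 :: sl12 is "matrix_unit 1 3" by (simp add: matrix_unit_def)
lift_definition sl_y1 :: sl12 is "transpose (matrix_unit 1 2)"
  by (simp add: matrix_unit_def transpose_def)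
lift_definition sl_y2 :: sl12 is "transpose (matrix_unit 2 3)"
  by (simp add: matrix_unit_def transpose_def)
lift_definition sl_y3 :: sl12 is "transpose (matrix_unit 1 3)"
  by (simp add: matrix_unit_def transpose_def)
lift_definition sl_h1 :: sl12 is "matrix_unit 1 1 + matrix_unit 2 2" by (simp add: matrix_unit_def)
lift_definition sl_h2 :: sl12 is "matrix_unit 2 2 - matrix_unit 3 3" by (simp add: matrix_unit_def)

definition n_plus :: "sl12 set" where
  "n_plus = cspan {sl_y1, sl_x2, sl_x3}"

text \<open>A weight \<open>\<Lambda>\<close> is the pair \<open>(\<Lambda>\<^sub>1, \<Lambda>\<^sub>2) = (\<Lambda>(h\<^sub>1), \<Lambda>(h\<^sub>2))\<close>, so that
  \<open>\<Lambda>(a h\<^sub>1 + b h\<^sub>2) = a \<Lambda>\<^sub>1 + b \<Lambda>\<^sub>2\<close>. For \<open>\<Lambda>\<close> in \<open>P_plus\<close>, the second entry is a natural number,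
  recovered by \<open>weight2\<close>.\<close>

type_synonym weight = "complex \<times> complex"

definition P_plus :: "weight set" where
  "P_plus = {\<Lambda>. \<exists>n::nat. n \<ge> 1 \<and> snd \<Lambda> = of_nat n} \<union> {(0, 0)}"

definition weight2 :: "weight \<Rightarrow> nat" where
  "weight2 \<Lambda> = nat \<lfloor>Re (snd \<Lambda>)\<rfloor>"

lemma of_nat_weight2: "\<Lambda> \<in> P_plus \<Longrightarrow> of_nat (weight2 \<Lambda>) = snd \<Lambda>"
  by (auto simp: P_plus_def weight2_def)

text \<open>The element \<open>x(m) = x \<otimes> t\<^sup>m\<close> in the enveloping algebra of the current algebra.\<close>

definition at_t :: "sl12 \<Rightarrow> nat \<Rightarrow> sl12 current env" where
  "at_t x m = env_gen (Poly_Mapping.single m x)"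

definition weyl_relations :: "weight \<Rightarrow> sl12 current env set" where
  "weyl_relations \<Lambda> =
    {env_gen f | f. \<forall>m. Poly_Mapping.lookup f m \<in> n_plus} \<union>
    {at_t (cscale a sl_h1 + cscale b sl_h2) r
       - (if r = 0 then env_const (a * fst \<Lambda> + b * snd \<Lambda>) else 0) | a b r. True} \<union>
    {at_t sl_y2 0 ^ (weight2 \<Lambda> + 1)}"

definition weyl_ideal :: "weight \<Rightarrow> sl12 current env set" where
  "weyl_ideal \<Lambda> = is_left_ideal hull weyl_relations \<Lambda>"

definition weyl_coset :: "weight \<Rightarrow> sl12 current env \<Rightarrow> sl12 current env set" where
  "weyl_coset \<Lambda> u = {u + j | j. j \<in> weyl_ideal \<Lambda>}"

text \<open>The left action on cosets: \<open>u \<cdot> (v + J) = u v + J\<close>. Adding \<open>J\<close> is needed, since \<open>u J\<close> may be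
  smaller than \<open>J\<close>.\<close>

definition weyl_act ::
  "weight \<Rightarrow> sl12 current env \<Rightarrow> sl12 current env set \<Rightarrow> sl12 current env set" where
  "weyl_act \<Lambda> u X = {u * x + j | x j. x \<in> X \<and> j \<in> weyl_ideal \<Lambda>}"

definition complex_field :: "complex ring" where
  "complex_field = \<lparr>carrier = UNIV, mult = (*), one = 1, zero = 0, add = (+)\<rparr>"

text \<open>The complex vector space underlying \<open>W(\<Lambda>)\<close>. The record type has ring fields \<open>mult\<close> and \<open>one\<close>,
  which play no role for a vector space.\<close>

definition weyl_module :: "weight \<Rightarrow> (complex, sl12 current env set) module" where
  "weyl_module \<Lambda> = \<lparr>carrier = range (weyl_coset \<Lambda>), mult = undefined, one = undefined,
     zero = weyl_coset \<Lambda> 0, add = (\<lambda>X Y. {x + y | x y. x \<in> X \<and> y \<in> Y}),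
     smult = (\<lambda>c. weyl_act \<Lambda> (env_const c))\<rparr>"

definition weyl_gen :: "weight \<Rightarrow> sl12 current env set" where
  "weyl_gen \<Lambda> = weyl_coset \<Lambda> 1"

definition weyl_monomial ::
  "weight \<Rightarrow> nat list \<Rightarrow> nat list \<Rightarrow> nat list \<Rightarrow> sl12 current env set" where
  "weyl_monomial \<Lambda> as bs cs =
    foldr (weyl_act \<Lambda>) (map (at_t sl_y2) as @ map (at_t sl_x1) bs @ map (at_t sl_y3) cs)
      (weyl_gen \<Lambda>)"

lemma is_left_ideal_weyl_ideal: "is_left_ideal (weyl_ideal \<Lambda>)"
  unfolding weyl_ideal_def by (rule is_left_ideal_hull)

lemmas weyl_idealD = is_left_idealD[OF is_left_ideal_weyl_ideal]

lemma weyl_coset_eq_iff: "weyl_coset \<Lambda> u = weyl_coset \<Lambda> v \<longleftrightarrow> u - v \<in> weyl_ideal \<Lambda>"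
proof
  assume eq: "weyl_coset \<Lambda> u = weyl_coset \<Lambda> v"
  have "u \<in> weyl_coset \<Lambda> u"
    unfolding weyl_coset_def using weyl_idealD(1)[of \<Lambda>] by (intro CollectI exI[of _ 0]) simp
  then show "u - v \<in> weyl_ideal \<Lambda>"
    unfolding eq by (auto simp: weyl_coset_def)
next
  assume uv: "u - v \<in> weyl_ideal \<Lambda>"
  have "weyl_coset \<Lambda> u \<subseteq> weyl_coset \<Lambda> v" if "u - v \<in> weyl_ideal \<Lambda>" for u v
  proof
    fix x assume "x \<in> weyl_coset \<Lambda> u"
    then obtain j where j: "x = u + j" "j \<in> weyl_ideal \<Lambda>" by (auto simp: weyl_coset_def)
    then have "x = v + ((u - v) + j)" by simp
    with weyl_idealD(2)[OF that j(2)] show "x \<in> weyl_coset \<Lambda> v"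
      unfolding weyl_coset_def by blast
  qed
  from this[OF uv] this[of v u] weyl_idealD(4)[OF uv]
  show "weyl_coset \<Lambda> u = weyl_coset \<Lambda> v" by simp
qed

lemma weyl_act_coset: "weyl_act \<Lambda> u (weyl_coset \<Lambda> v) = weyl_coset \<Lambda> (u * v)"
proof (intro Set.set_eqI iffI)
  fix x assume "x \<in> weyl_act \<Lambda> u (weyl_coset \<Lambda> v)"
  then obtain i j where ij: "i \<in> weyl_ideal \<Lambda>" "j \<in> weyl_ideal \<Lambda>" "x = u * (v + i) + j"
    unfolding weyl_act_def weyl_coset_def by blast
  then have "x = u * v + (u * i + j)" by (simp add: algebra_simps)
  moreover have "u * i + j \<in> weyl_ideal \<Lambda>"
    using ij by (intro weyl_idealD(2) weyl_idealD(3))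
  ultimately show "x \<in> weyl_coset \<Lambda> (u * v)" unfolding weyl_coset_def by blast
next
  fix x assume "x \<in> weyl_coset \<Lambda> (u * v)"
  then obtain j where "j \<in> weyl_ideal \<Lambda>" "x = u * (v + 0) + j"
    unfolding weyl_coset_def by auto
  with weyl_idealD(1) show "x \<in> weyl_act \<Lambda> u (weyl_coset \<Lambda> v)"
    unfolding weyl_act_def weyl_coset_def by blast
qed

lemma weyl_add_coset:
  "weyl_coset \<Lambda> u \<oplus>\<^bsub>weyl_module \<Lambda>\<^esub> weyl_coset \<Lambda> v = weyl_coset \<Lambda> (u + v)"
proof (intro Set.set_eqI iffI)
  fix x assume "x \<in> weyl_coset \<Lambda> u \<oplus>\<^bsub>weyl_module \<Lambda>\<^esub> weyl_coset \<Lambda> v"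
  then obtain i j where ij: "i \<in> weyl_ideal \<Lambda>" "j \<in> weyl_ideal \<Lambda>" "x = (u + i) + (v + j)"
    unfolding weyl_module_def weyl_coset_def by auto
  then have "x = u + v + (i + j)" by (simp add: algebra_simps)
  with weyl_idealD(2)[OF ij(1,2)] show "x \<in> weyl_coset \<Lambda> (u + v)"
    unfolding weyl_coset_def by blast
next
  fix x assume "x \<in> weyl_coset \<Lambda> (u + v)"
  then obtain j where "j \<in> weyl_ideal \<Lambda>" "x = (u + j) + (v + 0)"
    unfolding weyl_coset_def by (auto simp: algebra_simps)
  with weyl_idealD(1) show "x \<in> weyl_coset \<Lambda> u \<oplus>\<^bsub>weyl_module \<Lambda>\<^esub> weyl_coset \<Lambda> v"
    unfolding weyl_module_def weyl_coset_def by fastforce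
qed

lemma weyl_smult_coset:
  "c \<odot>\<^bsub>weyl_module \<Lambda>\<^esub> weyl_coset \<Lambda> v = weyl_coset \<Lambda> (env_const c * v)"
  by (simp add: weyl_module_def weyl_act_coset)

lemma carrier_weyl_module: "carrier (weyl_module \<Lambda>) = range (weyl_coset \<Lambda>)"
  and zero_weyl_module: "\<zero>\<^bsub>weyl_module \<Lambda>\<^esub> = weyl_coset \<Lambda> 0"
  by (simp_all add: weyl_module_def)

lemma field_complex_field: "field complex_field"
proof (rule cring.cring_fieldI)
  have "abelian_group complex_field"
  proof (rule abelian_groupI)
    show "\<exists>y\<in>carrier complex_field. y \<oplus>\<^bsub>complex_field\<^esub> x = \<zero>\<^bsub>complex_field\<^esub>" for x
      by (rule bexI[of _ "- x"]) (simp_all add: complex_field_def)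
  qed (simp_all add: complex_field_def add_ac)
  moreover have "comm_monoid complex_field"
    by (rule comm_monoidI) (simp_all add: complex_field_def mult_ac)
  ultimately show "cring complex_field"
    by (rule cringI) (simp add: complex_field_def distrib_right)
  have "\<exists>y. y * x = 1 \<and> x * y = 1" if "x \<noteq> 0" for x :: complex
    using that by (intro exI[of _ "inverse x"]) simp
  then show "Units complex_field = carrier complex_field - {\<zero>\<^bsub>complex_field\<^esub>}"
    by (auto simp: complex_field_def Units_def)
qed

lemma vectorspace_weyl_module: "vectorspace complex_field (weyl_module \<Lambda>)"
proof -
  interpret field complex_field by (rule field_complex_field)
  note simps = carrier_weyl_module zero_weyl_module weyl_add_coset weyl_smult_coset
  have "abelian_group (weyl_module \<Lambda>)"
  proof (rule abelian_groupI)
    show "\<exists>Y\<in>carrier (weyl_module \<Lambda>). Y \<oplus>\<^bsub>weyl_module \<Lambda>\<^esub> X = \<zero>\<^bsub>weyl_module \<Lambda>\<^esub>"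
      if "X \<in> carrier (weyl_module \<Lambda>)" for X
    proof -
      from that obtain u where "X = weyl_coset \<Lambda> u" by (auto simp: simps)
      then have "weyl_coset \<Lambda> (- u) \<oplus>\<^bsub>weyl_module \<Lambda>\<^esub> X = \<zero>\<^bsub>weyl_module \<Lambda>\<^esub>"
        by (simp add: simps)
      then show ?thesis by (auto simp: simps)
    qed
  qed (auto simp: simps add_ac)
  moreover have "module_axioms complex_field (weyl_module \<Lambda>)"
    by unfold_locales
      (auto simp: simps complex_field_def env_const_add env_const_mult env_const_one
        distrib_left distrib_right mult.assoc)
  ultimately show ?thesis
    by (intro vectorspace.intro module.intro is_cring field_complex_field)
qed

end

theory Submission
  imports Defs "HOL-Computational_Algebra.Formal_Power_Series"
begin

text \<open>Write \<open>n\<close> for the second entry of the weight, \<open>w\<close> for the generator, and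
\<open>x\<^sub>1(a)\<close>, \<open>y\<^sub>2(a)\<close>, \<open>\<dots>\<close> for the elements of the current algebra. The lowering operators are the
\<open>y\<^sub>2(a)\<close>, \<open>x\<^sub>1(b)\<close> and \<open>y\<^sub>3(c)\<close>. The \<open>y\<^sub>2\<close> are central among them, the \<open>x\<^sub>1\<close> anticommute with each
other, so do the \<open>y\<^sub>3\<close>, and \<open>[x\<^sub>1(b), y\<^sub>3(c)] = y\<^sub>2(b + c)\<close>. Hence products
\<open>y\<^sub>2 \<cdots> y\<^sub>2 x\<^sub>1 \<cdots> x\<^sub>1 y\<^sub>3 \<cdots> y\<^sub>3 w\<close> without restriction on the exponents span the module
(\<open>Fil_exhaust\<close>), and the point is to bound the exponents.

Filter the module by the number of factors \<open>y\<^sub>3\<close>: let \<open>Fil l\<close> be spanned by the products with fewer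
than \<open>l\<close> of them, and \<open>Lam l\<close> by the products of exactly \<open>l\<close> factors \<open>y\<^sub>3\<close> alone, applied to \<open>w\<close>.
Since \<open>[x\<^sub>2, y\<^sub>3] = y\<^sub>1\<close>, and \<open>y\<^sub>1\<close> anticommutes with \<open>y\<^sub>3\<close> and kills \<open>w\<close>, the elements \<open>x\<^sub>2(r)\<close> kill
\<open>Lam l\<close>, which is stable under the Cartan elements and has weight \<open>n - l\<close> for \<open>h\<^sub>2\<close>; and \<open>x\<^sub>3(r)\<close> maps
\<open>Lam l\<close> to \<open>Lam (l - 1)\<close>. From this, \<open>Fil l\<close> is stable under all of the current algebra except
\<open>y\<^sub>1\<close> and \<open>y\<^sub>3\<close>, and modulo \<open>Fil l\<close> products of \<open>k\<close> factors \<open>x\<^sub>1\<close> applied to \<open>Lam l\<close> are again killed by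
\<open>x\<^sub>2(r)\<close>, with weight \<open>n - l - k\<close>. So everything reduces to one statement on \<open>\<s>\<l>\<^sub>2[t]\<close>, which is
\<open>ymon_box\<close>: if \<open>V\<close> consists of vectors of weight \<open>q\<close> killed by all \<open>x(r)\<close>, is stable under the \<open>h(r)\<close>,
and \<open>y(0)\<close> acts nilpotently on it, then among the products of \<open>j\<close> factors \<open>y(a)\<close> applied to \<open>V\<close> those
with all \<open>a \<le> q - j\<close> suffice. It bounds the exponents of the \<open>y\<^sub>2\<close> directly. For one factor it
expresses \<open>y\<^sub>2(s) v\<close> by the \<open>y\<^sub>2(a) v'\<close> with \<open>a < n - l\<close>, for \<open>v\<close> in \<open>Lam l\<close>; applying \<open>x\<^sub>3(0)\<close>, where
\<open>[x\<^sub>3(0), y\<^sub>2(s)] = x\<^sub>1(s)\<close>, bounds the exponents of the \<open>x\<^sub>1\<close> (\<open>X1_reduce\<close>). Finally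
\<open>y\<^sub>2(s) w = 0\<close> for \<open>s \<ge> n\<close>, hence \<open>y\<^sub>3(s) w = [y\<^sub>2(s), y\<^sub>1(0)] w = 0\<close>.

For \<open>ymon_box\<close>, read a product of \<open>j\<close> factors \<open>y(a)\<close> as a symmetrised monomial in \<open>z\<^sub>1, \<dots>, z\<^sub>j\<close>.
Let \<open>Y\<close> be the series of all \<open>y(a) u\<^sup>a\<close>. Moving \<open>x(1)\<close> past \<open>Y\<^sup>N\<close> produces the derivative of
\<open>Y\<^sup>N\<^sup>-\<^sup>1\<close>, so that \<open>y(0)\<^sup>q\<^sup>+\<^sup>1 v = 0\<close> yields: up to products of lower degree, the coefficient of \<open>u\<^sup>s\<close> in
\<open>Y\<^sup>j v\<close> vanishes for \<open>j + s > q\<close>. This coefficient is the complete homogeneous symmetric polynomial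
\<open>h\<^sub>s\<close>, and commutation with \<open>h(r)\<close> is multiplication by a power sum; so the ideal generated by the
\<open>h\<^sub>s\<close> with \<open>s > q - j\<close> acts by zero. The quotient by that ideal is the cohomology ring of a
Grassmannian, spanned by the monomial symmetric polynomials with exponents at most \<open>q - j\<close>. This is
\<open>symmetric_function_box\<close>, in dual form.

The index set has \<open>4\<^sup>n\<close> elements: weakly increasing lists of length \<open>j\<close> with entries at most
\<open>q - j\<close> correspond to subsets of \<open>{0, \<dots>, q - 1}\<close> of size \<open>j\<close>, and there are \<open>(1 + 1 + 2)\<^sup>n\<close> triples of
subsets of sets of sizes \<open>n\<close>, \<open>n - l\<close> and \<open>n - l - k\<close>.\<close>

section \<open>Symmetric functions determined on a box\<close>

text \<open>A function \<open>\<phi>\<close> on lists of length \<open>j\<close> stands for a linear functional on polynomials in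
\<open>z\<^sub>1, \<dots>, z\<^sub>j\<close>, given on monomials by their lists of exponents. Then \<open>raise_sum \<phi> as s\<close> is its value at
the monomial \<open>as\<close> times the complete homogeneous symmetric polynomial \<open>h\<^sub>s\<close>.\<close>

primrec raise_sum :: "(nat list \<Rightarrow> 'b::comm_monoid_add) \<Rightarrow> nat list \<Rightarrow> nat \<Rightarrow> 'b" where
  "raise_sum \<phi> [] s = (if s = 0 then \<phi> [] else 0)"
| "raise_sum \<phi> (a # as) s = (\<Sum>c\<le>s. raise_sum (\<lambda>b. \<phi> ((a + c) # b)) as (s - c))"

lemma raise_sum_cong:
  assumes "\<And>b. length b = length as \<Longrightarrow> sum_list b = sum_list as + s \<Longrightarrow>
    (\<And>i. i < length as \<Longrightarrow> as ! i \<le> b ! i) \<Longrightarrow> \<phi> b = \<psi> b"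
  shows "raise_sum \<phi> as s = raise_sum \<psi> as s"
  using assms
proof (induction as arbitrary: \<phi> \<psi> s)
  case (Cons a as)
  have "raise_sum (\<lambda>b. \<phi> ((a + c) # b)) as (s - c) = raise_sum (\<lambda>b. \<psi> ((a + c) # b)) as (s - c)"
    if "c \<le> s" for c
    by (rule Cons.IH, rule Cons.prems) (use that in \<open>auto simp: nth_Cons split: nat.split\<close>)
  then show ?case by simp
qed simp

lemma raise_sum_zero [simp]: "raise_sum (\<lambda>_. 0) as s = 0"
  by (induction as arbitrary: s) auto

lemma raise_sum_add: "raise_sum (\<lambda>b. \<phi> b + \<psi> b) as s = raise_sum \<phi> as s + raise_sum \<psi> as s"
  by (induction as arbitrary: \<phi> \<psi> s) (auto simp: sum.distrib)

lemma raise_sum_0: "raise_sum \<phi> as 0 = \<phi> as"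
  by (induction as arbitrary: \<phi>) auto

text \<open>The recursion \<open>h\<^sub>s(z\<^sub>1, \<dots>, z\<^sub>j) = h\<^sub>s(z\<^sub>2, \<dots>, z\<^sub>j) + z\<^sub>1 h\<^sub>s\<^sub>-\<^sub>1(z\<^sub>1, \<dots>, z\<^sub>j)\<close>.\<close>

lemma raise_sum_Cons_Suc:
  "raise_sum \<phi> (a # as) (Suc s) = raise_sum (\<lambda>b. \<phi> (a # b)) as (Suc s) + raise_sum \<phi> (Suc a # as) s"
  by (simp add: sum.atMost_Suc_shift del: sum.atMost_Suc)

lemma raise_sum_map_Suc: "raise_sum (\<lambda>b. \<phi> (map Suc b)) as s = raise_sum \<phi> (map Suc as) s"
proof (induction as arbitrary: \<phi> s)
  case (Cons a as)
  show ?case using Cons.IH[of "\<lambda>b. \<phi> (Suc (a + c) # b)" for c] by simp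
qed simp

lemma raise_sum_swap:
  assumes "\<And>c d b. \<phi> (c # d # b) = \<phi> (d # c # b)"
  shows "raise_sum \<phi> (a # b # as) s = raise_sum \<phi> (b # a # as) s"
proof -
  have eq: "raise_sum \<phi> (a # b # as) s =
      (\<Sum>(c, d)\<in>{(c, d). c + d \<le> s}. raise_sum (\<lambda>e. \<phi> ((a + c) # (b + d) # e)) as (s - (c + d)))"
    for \<phi> :: "nat list \<Rightarrow> 'a" and a b
  proof -
    have set: "{(c, d). c + d \<le> s} = Sigma {..s} (\<lambda>c. {..s - c})"
      by auto
    show ?thesis
      by (simp add: set sum.Sigma)
  qed
  show ?thesis
    unfolding eq
    by (rule sum.reindex_bij_witness[of _ prod.swap prod.swap]) (auto simp: assms add.commute)
qed

lemma raise_sum_move: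
  assumes "\<And>b c. mset b = mset c \<Longrightarrow> \<phi> b = \<phi> c"
  shows "raise_sum \<phi> (as @ a # bs) s = raise_sum \<phi> (a # as @ bs) s"
  using assms
proof (induction as arbitrary: \<phi> s)
  case (Cons x as)
  have "raise_sum (\<lambda>b. \<phi> ((x + c) # b)) (as @ a # bs) t =
      raise_sum (\<lambda>b. \<phi> ((x + c) # b)) (a # as @ bs) t" for c t
    by (rule Cons.IH, rule Cons.prems) simp
  then have "raise_sum \<phi> ((x # as) @ a # bs) s = raise_sum \<phi> (x # a # as @ bs) s"
    by simp
  also have "\<dots> = raise_sum \<phi> (a # x # as @ bs) s"
    by (rule raise_sum_swap, rule Cons.prems) simp
  finally show ?case by simp
qed simp

lemma raise_sum_mset:
  assumes "\<And>b c. mset b = mset c \<Longrightarrow> \<phi> b = \<phi> c" and "mset as = mset bs"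
  shows "raise_sum \<phi> as s = raise_sum \<phi> bs s"
  using assms
proof (induction as arbitrary: \<phi> bs s)
  case (Cons a as)
  then have "a \<in> set bs" by (metis list.set_intros(1) set_mset_mset)
  then obtain xs ys where bs: "bs = xs @ a # ys" by (meson split_list)
  have "raise_sum (\<lambda>b. \<phi> ((a + c) # b)) as t = raise_sum (\<lambda>b. \<phi> ((a + c) # b)) (xs @ ys) t" for c t
  proof (rule Cons.IH)
    show "\<phi> ((a + c) # b) = \<phi> ((a + c) # d)" if "mset b = mset d" for b d
      using that by (intro Cons.prems(1)) simp
    show "mset as = mset (xs @ ys)" using Cons.prems(2) by (simp add: bs)
  qed
  then have "raise_sum \<phi> (a # as) s = raise_sum \<phi> (a # xs @ ys) s" by simp
  also have "\<dots> = raise_sum \<phi> bs s"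
    unfolding bs by (rule raise_sum_move[symmetric], rule Cons.prems(1))
  finally show ?case .
qed simp

text \<open>By \<open>raise_sum_Cons_Suc\<close>, removing one variable from \<open>h\<^sub>s\<close> costs one degree: modulo the ideal
generated by the \<open>h\<^sub>t\<close> in all variables with \<open>t > n\<close>, the polynomial \<open>h\<^sub>s\<close> in fewer variables vanishes
as soon as \<open>s\<close> exceeds \<open>n\<close> by more than the number of variables removed. The list \<open>pre\<close> holds the
exponents of these.\<close>

lemma raise_sum_prefix_vanish:
  fixes \<phi> :: "nat list \<Rightarrow> 'b::ab_group_add"
  assumes "\<And>as s. length as = j \<Longrightarrow> s > n \<Longrightarrow> raise_sum \<phi> as s = 0"
    and "length pre + length as = j" and "s > n + length pre"
  shows "raise_sum (\<lambda>b. \<phi> (pre @ b)) as s = 0"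
  using assms(2,3)
proof (induction pre arbitrary: as s rule: rev_induct)
  case Nil
  then show ?case using assms(1) by simp
next
  case (snoc a pre)
  from snoc.prems obtain t where s: "s = Suc t" by (cases s) auto
  have "raise_sum (\<lambda>b. \<phi> (pre @ b)) (a # as) (Suc t) = 0"
    and "raise_sum (\<lambda>b. \<phi> (pre @ b)) (Suc a # as) t = 0"
    using snoc.prems by (intro snoc.IH; simp add: s)+
  then show ?case
    unfolding s raise_sum_Cons_Suc by simp
qed

text \<open>For empty \<open>pre\<close>: the product \<open>z\<^sub>1 \<cdots> z\<^sub>j h\<^sub>n\<close> lies in the ideal generated by the \<open>h\<^sub>s\<close> with
\<open>s > n\<close>. The proof puts the variables back one by one, starting from none, where \<open>h\<^sub>n\<^sub>+\<^sub>j = 0\<close>.\<close>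

lemma raise_sum_shifted_vanish:
  fixes \<phi> :: "nat list \<Rightarrow> 'b::ab_group_add"
  assumes "\<And>as s. length as = j \<Longrightarrow> s > n \<Longrightarrow> raise_sum \<phi> as s = 0"
    and "length pre + length as = j" and "j > 0"
  shows "raise_sum (\<lambda>b. \<phi> (pre @ b)) (map Suc as) (n + length pre) = 0"
  using assms(2)
proof (induction as arbitrary: pre)
  case Nil
  then show ?case using assms(3) by simp
next
  case (Cons a as)
  have "raise_sum (\<lambda>b. \<phi> (pre @ b)) (a # map Suc as) (Suc (n + length pre)) = 0"
    using Cons.prems by (intro raise_sum_prefix_vanish[OF assms(1)]) auto
  moreover have "raise_sum (\<lambda>b. \<phi> ((pre @ [a]) @ b)) (map Suc as) (n + length (pre @ [a])) = 0"
    using Cons.prems by (intro Cons.IH) auto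
  ultimately show ?case
    unfolding raise_sum_Cons_Suc by simp
qed

text \<open>In a monomial occurring in the product of \<open>h\<^sub>s\<close> with the given one, a zero exponent can only sit at
one of the \<open>k\<close> positions where the given exponent is zero, and these are interchangeable. Counting the
pairs of such a monomial and a zero exponent in it in two ways gives the equation.\<close>

lemma raise_sum_count_zeros:
  fixes \<psi> :: "nat list \<Rightarrow> 'b::field"
  assumes "\<And>b c. mset b = mset c \<Longrightarrow> \<psi> b = \<psi> c" and "0 \<notin> set as"
  shows "raise_sum (\<lambda>b. of_nat (count_list b 0) * \<psi> b) (replicate k 0 @ as) s =
    of_nat k * raise_sum (\<lambda>b. \<psi> (0 # b)) (replicate (k - 1) 0 @ as) s"
  using assms(1)
proof (induction k arbitrary: \<psi> s)
  case 0
  have "of_nat (count_list b 0) * \<psi> b = 0"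
    if "length b = length as" "\<And>i. i < length as \<Longrightarrow> as ! i \<le> b ! i" for b
  proof -
    have "0 \<notin> set b"
      using that assms(2) by (metis in_set_conv_nth le_zero_eq)
    then show ?thesis by (simp add: count_list_0_iff)
  qed
  then have "raise_sum (\<lambda>b. of_nat (count_list b 0) * \<psi> b) as s = raise_sum (\<lambda>_. 0) as s"
    by (rule raise_sum_cong)
  then show ?case by simp
next
  case (Suc k)
  have split: "raise_sum (\<lambda>b. of_nat (count_list (c # b) 0) * \<psi> (c # b)) bs t =
      (if c = 0 then raise_sum (\<lambda>b. \<psi> (0 # b)) bs t else 0) +
      raise_sum (\<lambda>b. of_nat (count_list b 0) * \<psi> (c # b)) bs t" for c bs t
    by (auto simp: distrib_right raise_sum_add)
  have IH: "raise_sum (\<lambda>b. of_nat (count_list b 0) * \<psi> (c # b)) (replicate k 0 @ as) t =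
      of_nat k * raise_sum (\<lambda>b. \<psi> (c # 0 # b)) (replicate (k - 1) 0 @ as) t" for c t
    using Suc.prems by (intro Suc.IH) simp
  have swap: "\<psi> (c # 0 # b) = \<psi> (0 # c # b)" for c b
    by (rule Suc.prems) simp
  have tail: "of_nat k * (\<Sum>c\<le>s. raise_sum (\<lambda>b. \<psi> (0 # c # b)) (replicate (k - 1) 0 @ as) (s - c)) =
      of_nat k * raise_sum (\<lambda>b. \<psi> (0 # b)) (replicate k 0 @ as) s"
    by (cases k) auto
  have "raise_sum (\<lambda>b. of_nat (count_list b 0) * \<psi> b) (replicate (Suc k) 0 @ as) s =
      (\<Sum>c\<le>s. (if c = 0 then raise_sum (\<lambda>b. \<psi> (0 # b)) (replicate k 0 @ as) (s - c) else 0)) +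
      (\<Sum>c\<le>s. raise_sum (\<lambda>b. of_nat (count_list b 0) * \<psi> (c # b)) (replicate k 0 @ as) (s - c))"
    by (simp only: replicate_Suc append_Cons raise_sum.simps add_0 split sum.distrib)
  also have "\<dots> = raise_sum (\<lambda>b. \<psi> (0 # b)) (replicate k 0 @ as) s +
      of_nat k * raise_sum (\<lambda>b. \<psi> (0 # b)) (replicate k 0 @ as) s"
    unfolding IH swap sum_distrib_left[symmetric] tail by simp
  finally show ?case by (simp add: algebra_simps)
qed

text \<open>Dually: modulo the ideal generated by the \<open>h\<^sub>s\<close> with \<open>s \<ge> n\<close>, the symmetric polynomials in \<open>j\<close>
variables are spanned by those with all exponents below \<open>n\<close>. The induction follows Pascal's rule for
the number of such monomials. Those divisible by \<open>z\<^sub>1 \<cdots> z\<^sub>j\<close> are treated with \<open>n - 1\<close> in place of \<open>n\<close>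
after dividing; the relation that is new for \<open>n - 1\<close> is \<open>raise_sum_shifted_vanish\<close>. Once \<open>\<phi>\<close> vanishes
on them, it lives on monomials with a zero exponent, and dropping a zero reduces \<open>j\<close>.\<close>

theorem symmetric_function_box:
  fixes \<phi> :: "nat list \<Rightarrow> 'b::field_char_0"
  assumes "\<And>b c. mset b = mset c \<Longrightarrow> \<phi> b = \<phi> c"
    and "\<And>b. length b = j \<Longrightarrow> \<forall>a\<in>set b. a < n \<Longrightarrow> \<phi> b = 0"
    and "\<And>as s. length as = j \<Longrightarrow> s \<ge> n \<Longrightarrow> raise_sum \<phi> as s = 0"
    and "length b = j"
  shows "\<phi> b = 0"
  using assms
proof (induction "j + n" arbitrary: j n \<phi> b rule: less_induct)
  case less
  note sym = less.prems(1) and box = less.prems(2) and rel = less.prems(3)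
  show ?case
  proof (cases "j = 0 \<or> n = 0")
    case True
    then show ?thesis
      using box[of b] rel[of b 0] less.prems(4) by (auto simp: raise_sum_0)
  next
    case False
    then obtain i m where j: "j = Suc i" and n: "n = Suc m"
      by (metis not0_implies_Suc)
    have pos: "\<phi> b = 0" if "length b = j" "0 \<notin> set b" for b
    proof -
      have shifted: "\<phi> (map Suc d) = 0" if "length d = j" for d
      proof (rule less.hyps[of j m "\<lambda>d. \<phi> (map Suc d)"])
        show "raise_sum (\<lambda>d. \<phi> (map Suc d)) as s = 0" if "length as = j" "s \<ge> m" for as s
        proof (cases "s = m")
          case True
          then show ?thesis
            using raise_sum_shifted_vanish[of j m \<phi> "[]" as] rel that
            by (simp add: raise_sum_map_Suc n j)
        qed (use that rel n in \<open>simp add: raise_sum_map_Suc\<close>)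
        show "\<phi> (map Suc b) = \<phi> (map Suc c)" if "mset b = mset c" for b c
          using that by (intro sym) simp
        show "\<phi> (map Suc b) = 0" if "length b = j" "\<forall>a\<in>set b. a < m" for b
          using that by (intro box) (simp_all add: n)
      qed (simp_all add: n that)
      have "map Suc (map (\<lambda>a. a - 1) b) = b"
        using that(2) by (auto intro!: map_idI) (metis One_nat_def Suc_pred gr0I)
      with shifted[of "map (\<lambda>a. a - 1) b"] that(1) show ?thesis by simp
    qed
    have zero: "\<phi> (0 # d) = 0" if "length d = i" for d
    proof -
      \<comment> \<open>A list of length \<open>j\<close> with \<open>t\<close> zeros has \<open>j / t\<close> times as many rearrangements as the list with one
        zero removed; the constant \<open>j\<close> is left out. Without zeros \<open>\<phi>\<close> vanishes, in accordance with
        division by zero.\<close>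
      define \<psi> where "\<psi> b = \<phi> b / of_nat (count_list b 0)" for b
      have \<psi>_sym: "\<psi> b = \<psi> c" if "mset b = mset c" for b c
        using sym[OF that] that by (metis \<psi>_def count_mset)
      have "\<psi> (0 # d) = 0"
      proof (rule less.hyps[of i n "\<lambda>d. \<psi> (0 # d)"])
        show "raise_sum (\<lambda>d. \<psi> (0 # d)) as s = 0" if as: "length as = i" and s: "s \<ge> n" for as s
        proof -
          define k where "k = count_list as 0"
          define as' where "as' = filter (\<lambda>a. a \<noteq> 0) as"
          have mset: "mset as = mset (replicate k 0 @ as')"
            unfolding k_def as'_def
            by (induction as) auto
          have "length (replicate (Suc k) 0 @ as') = j"
            using mset_eq_length[OF mset] as j by simp
          then have "0 = raise_sum \<phi> (replicate (Suc k) 0 @ as') s"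
            using rel s by (simp only:)
          also have "\<dots> = raise_sum (\<lambda>b. of_nat (count_list b 0) * \<psi> b) (replicate (Suc k) 0 @ as') s"
          proof (rule raise_sum_cong)
            fix b :: "nat list" assume "length b = length (replicate (Suc k) 0 @ as')"
            with \<open>length (replicate (Suc k) 0 @ as') = j\<close> have "length b = j" by simp
            then show "\<phi> b = of_nat (count_list b 0) * \<psi> b"
              using pos[of b] by (cases "0 \<in> set b") (auto simp: \<psi>_def count_list_0_iff)
          qed
          also have "\<dots> = of_nat (Suc k) * raise_sum (\<lambda>b. \<psi> (0 # b)) (replicate (Suc k - 1) 0 @ as') s"
            by (rule raise_sum_count_zeros, erule \<psi>_sym) (simp add: as'_def)
          also have "raise_sum (\<lambda>b. \<psi> (0 # b)) (replicate (Suc k - 1) 0 @ as') s = raise_sum (\<lambda>b. \<psi> (0 # b)) as s"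
            by (rule raise_sum_mset, rule \<psi>_sym) (simp_all add: mset)
          finally show ?thesis by (metis mult_eq_0_iff of_nat_eq_0_iff nat.distinct(1))
        qed
        show "\<psi> (0 # b) = \<psi> (0 # c)" if "mset b = mset c" for b c
          using that by (intro \<psi>_sym) simp
        show "\<psi> (0 # b) = 0" if "length b = i" "\<forall>a\<in>set b. a < n" for b
          using that box[of "0 # b"] j n by (simp add: \<psi>_def)
      qed (simp_all add: j that)
      moreover have "of_nat (count_list (0 # d) 0) \<noteq> (0 :: 'b)"
        by (simp only: of_nat_eq_0_iff) simp
      ultimately show ?thesis by (simp add: \<psi>_def)
    qed
    show ?thesis
    proof (cases "0 \<in> set b")
      case True
      then obtain xs ys where b: "b = xs @ 0 # ys" by (meson split_list)
      have "\<phi> b = \<phi> (0 # xs @ ys)" by (rule sym) (simp add: b)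
      then show ?thesis using zero[of "xs @ ys"] less.prems(4) by (simp add: b j)
    qed (use pos less.prems(4) in simp)
  qed
qed

section \<open>Linear algebra in enveloping algebras\<close>

lemma env_const_central: "env_const c * u = u * env_const c"
proof (transfer)
  fix c :: complex and f :: "'a free_alg"
  have "free_const c * f = f * free_const c"
    by (induction f rule: poly_mapping_add_single_induct)
      (simp_all add: distrib_left distrib_right free_const_def mult_single plus_list_def mult.commute)
  then show "free_const c * f - f * free_const c \<in> env_ideal"
    by (simp add: env_idealD(1))
qed

interpretation env: vector_space "\<lambda>c (u :: 'a::lie_superalgebra env). env_const c * u"
  by unfold_locales (simp_all add: distrib_left distrib_right env_const_add env_const_mult env_const_one mult.assoc)

lemma env_const_of_nat: "env_const (of_nat k) = of_nat k"
  by (induction k) (simp_all add: env_const_zero env_const_add env_const_one)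

lemma subspace_left_ideal: "is_left_ideal J \<Longrightarrow> env.subspace J"
  by (auto simp: env.subspace_def is_left_ideal_def)

lemma mult_span_subset:
  assumes "env.subspace S" and "\<And>a. a \<in> A \<Longrightarrow> r * a \<in> S" and "u \<in> env.span A"
  shows "r * u \<in> S"
  using assms(3)
proof (induction rule: env.span_induct)
  case base
  have "r * (env_const c * u) = env_const c * (r * u)" for c u
    by (metis env_const_central mult.assoc)
  with assms(1) show ?case
    by (auto simp: env.subspace_def distrib_left)
qed (rule assms(2))

lemma subspace_of_nat: "env.subspace S \<Longrightarrow> u \<in> S \<Longrightarrow> of_nat k * u \<in> S"
  by (metis env.subspace_scale env_const_of_nat)

lemma subspace_of_nat_cancel:
  assumes "env.subspace S" "of_nat k * u \<in> S" "k > 0"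
  shows "u \<in> S"
proof -
  have "env_const (inverse (of_nat k)) * (of_nat k * u) \<in> S"
    using assms by (intro env.subspace_scale)
  moreover have "env_const (inverse (of_nat k)) * (of_nat k * u) = u"
    using assms(3) by (simp add: env_const_one flip: mult.assoc env_const_of_nat env_const_mult)
  ultimately show ?thesis by simp
qed

text \<open>Functionals separate points from subspaces, so that membership in a span can be decided by
functions with numerical values, such as those in \<open>symmetric_function_box\<close>.\<close>

lemma separating_functional:
  fixes S :: "'a::lie_superalgebra env set"
  assumes "env.subspace S" "u \<notin> S"
  obtains f :: "'a env \<Rightarrow> complex"
  where "\<And>x y. f (x + y) = f x + f y" "\<And>x. x \<in> S \<Longrightarrow> f x = 0" "f u \<noteq> 0"
proof -
  interpret complex: vector_space "(*) :: complex \<Rightarrow> complex \<Rightarrow> complex"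
    by unfold_locales (simp_all add: algebra_simps)
  interpret pair: vector_space_pair "\<lambda>c (u :: 'a env). env_const c * u" "(*) :: complex \<Rightarrow> complex \<Rightarrow> complex"
    by unfold_locales
  obtain B where B: "B \<subseteq> S" "env.independent B" "env.span B = S"
    by (metis assms(1) env.basis_exists env.span_subspace)
  then have "env.independent (insert u B)"
    using assms(2) by (simp add: env.independent_insert)
  then obtain g where g: "Vector_Spaces.linear (\<lambda>c (u :: 'a env). env_const c * u) (*) g"
      "\<forall>x\<in>insert u B. g x = (if x = u then 1 else 0)"
    using pair.linear_independent_extend[of "insert u B" "\<lambda>x. if x = u then 1 else 0"] by blast
  interpret g: Vector_Spaces.linear "\<lambda>c (u :: 'a env). env_const c * u" "(*) :: complex \<Rightarrow> complex \<Rightarrow> complex" g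
    by (rule g(1))
  show thesis
  proof
    show "g (x + y) = g x + g y" for x y by (rule g.add)
    show "g u \<noteq> 0" using g(2) by simp
    show "g x = 0" if "x \<in> S" for x
      using that unfolding B(3)[symmetric]
    proof (induction rule: env.span_induct)
      case base
      show ?case by (auto simp: env.subspace_def g.add g.scale)
    next
      case (step x)
      then have "x \<noteq> u" using B(1) assms(2) by auto
      with step g(2) show ?case by simp
    qed
  qed
qed

section \<open>Powers of the lowering series of \<open>\<s>\<l>\<^sub>2[t]\<close>\<close>

lemma of_nat_left_commute: "u * (of_nat k * w) = of_nat k * (u * w)" for u w :: "'b::ring_1"
  by (metis mult.assoc mult_of_nat_commute)

locale current_sl2 =
  fixes x h y :: "nat \<Rightarrow> 'a::lie_superalgebra env"
  assumes x_y: "x a * y b = y b * x a + h (a + b)"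
    and h_y: "h a * y b = y b * h a - 2 * y (a + b)"
    and y_y: "y a * y b = y b * y a"
begin

abbreviation ymon :: "nat list \<Rightarrow> 'a env" where
  "ymon as \<equiv> prod_list (map y as)"

text \<open>The \<open>y(a)\<close> commute, so the coefficient of \<open>u\<^sup>s\<close> in a product of \<open>j\<close> such series is the product
with \<open>h\<^sub>s\<close>, in the sense of \<open>raise_sum\<close>, of the monomial given by their indices.\<close>

definition yser :: "nat \<Rightarrow> 'a env fps" where
  "yser a = Abs_fps (\<lambda>c. y (a + c))"

abbreviation yprod :: "nat list \<Rightarrow> 'a env fps" where
  "yprod as \<equiv> prod_list (map yser as)"

text \<open>The shift of the index is the one in \<open>[x(1), y(c)] = h(c + 1)\<close>.\<close>

definition hser :: "'a env fps" where
  "hser = Abs_fps (\<lambda>c. h (Suc c))"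

lemma ymon_y: "ymon as * y b = y b * ymon as"
  by (induction as) (simp_all add: y_y mult.assoc, simp add: y_y flip: mult.assoc)

lemma ymon_mset:
  assumes "mset as = mset bs"
  shows "ymon as = ymon bs"
  using assms
proof (induction as arbitrary: bs)
  case (Cons a as)
  then have "a \<in> set bs" by (metis list.set_intros(1) set_mset_mset)
  then obtain us vs where bs: "bs = us @ a # vs" by (meson split_list)
  have "ymon as = ymon (us @ vs)"
    using Cons.prems by (intro Cons.IH) (simp add: bs)
  then show ?case
    by (simp add: bs ymon_y flip: mult.assoc)
qed simp

lemma yser_commute: "yser a * yser b = yser b * yser a"
proof (rule fps_ext)
  fix n
  have "fps_nth (yser a * yser b) n = (\<Sum>i=0..n. y (a + (n - i)) * y (b + i))"
    by (subst sum.atLeastAtMost_rev) (simp add: fps_mult_nth yser_def)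
  then show "fps_nth (yser a * yser b) n = fps_nth (yser b * yser a) n"
    by (simp add: fps_mult_nth yser_def y_y)
qed

lemma yser_deriv_commute: "fps_deriv (yser 0) * yser 0 = yser 0 * fps_deriv (yser 0)"
proof (rule fps_ext)
  fix n
  have "fps_nth (yser 0 * fps_deriv (yser 0)) n = (\<Sum>i=0..n. y (n - i) * (of_nat (i + 1) * y (i + 1)))"
    by (subst sum.atLeastAtMost_rev) (simp add: fps_mult_nth yser_def)
  also have "\<dots> = (\<Sum>i=0..n. of_nat (i + 1) * y (i + 1) * y (n - i))"
    by (intro sum.cong refl) (metis mult.assoc mult_of_nat_commute y_y)
  finally show "fps_nth (fps_deriv (yser 0) * yser 0) n = fps_nth (yser 0 * fps_deriv (yser 0)) n"
    by (simp add: fps_mult_nth yser_def)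
qed

lemma fps_nth_two_mult: "fps_nth (2 * f) n = 2 * fps_nth f n" for f :: "'a env fps"
  by (simp add: mult_2)

lemma fps_nth_of_nat_mult: "fps_nth (of_nat k * f) n = of_nat k * fps_nth f n" for f :: "'a env fps"
  by (induction k) (simp_all add: distrib_right)

text \<open>All \<open>N + 1\<close> commutators \<open>[h(a + 1), y(b)]\<close> with \<open>a + b = N\<close> are equal to \<open>-2 y(N + 1)\<close>, whence
the derivative.\<close>

lemma hser_yser: "hser * yser 0 = yser 0 * hser - 2 * fps_deriv (yser 0)"
proof (rule fps_ext)
  fix n
  have "fps_nth (yser 0 * hser) n = (\<Sum>i=0..n. y (n - i) * h (Suc i))"
    by (subst sum.atLeastAtMost_rev) (simp add: fps_mult_nth yser_def hser_def)
  then show "fps_nth (hser * yser 0) n = fps_nth (yser 0 * hser - 2 * fps_deriv (yser 0)) n"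
    by (simp add: fps_mult_nth yser_def hser_def h_y sum_subtractf mult_2 algebra_simps sum.distrib)
qed

lemma x_yser: "fps_const (x 1) * yser 0 = yser 0 * fps_const (x 1) + hser"
  by (rule fps_ext) (simp add: yser_def hser_def x_y)

lemma h_yser: "fps_const (h r) * yser a = yser a * fps_const (h r) - 2 * yser (a + r)"
  by (rule fps_ext) (simp add: yser_def h_y fps_nth_two_mult add_ac)

lemma fps_nth_mult_hser: "fps_nth (f * hser) n = (\<Sum>i\<le>n. fps_nth f i * h (Suc (n - i)))"
  by (simp add: fps_mult_nth hser_def atMost_atLeast0)

lemma hser_power: "hser * yser 0 ^ N = yser 0 ^ N * hser - 2 * fps_deriv (yser 0 ^ N)"
proof (induction N)
  case (Suc N)
  have arith: "Y * (P - 2 * D) - 2 * D' * Q = Y * P - 2 * (Y * D + D' * Q)" for Y P D D' Q :: "'a env fps"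
    by (simp add: mult_2 algebra_simps)
  have "hser * yser 0 ^ Suc N = (yser 0 * hser - 2 * fps_deriv (yser 0)) * yser 0 ^ N"
    by (simp add: hser_yser flip: mult.assoc)
  also have "\<dots> = yser 0 * (hser * yser 0 ^ N) - 2 * fps_deriv (yser 0) * yser 0 ^ N"
    by (simp add: left_diff_distrib mult.assoc)
  finally show ?case
    unfolding Suc.IH arith by (simp add: mult.assoc)
qed simp

lemma yser_power_deriv: "fps_deriv (yser 0 ^ Suc N) = of_nat (Suc N) * (yser 0 ^ N * fps_deriv (yser 0))"
proof (induction N)
  case (Suc N)
  have "fps_deriv (yser 0) * yser 0 ^ Suc N = yser 0 ^ Suc N * fps_deriv (yser 0)"
    by (rule power_commuting_commutes[symmetric]) (rule yser_deriv_commute[symmetric])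
  moreover have "yser 0 * (of_nat (Suc N) * (yser 0 ^ N * fps_deriv (yser 0))) =
      of_nat (Suc N) * (yser 0 ^ Suc N * fps_deriv (yser 0))"
    by (simp only: of_nat_left_commute power_Suc mult.assoc)
  moreover have "fps_deriv (yser 0 ^ Suc (Suc N)) =
      yser 0 * fps_deriv (yser 0 ^ Suc N) + fps_deriv (yser 0) * yser 0 ^ Suc N"
    by (subst power_Suc) (rule fps_deriv_mult)
  ultimately show ?case
    unfolding Suc.IH by (simp only: of_nat_Suc[of "Suc N"] distrib_right mult_1 add.commute)
qed simp

text \<open>Comparing coefficients, this relates products of \<open>N + 1\<close> factors \<open>y\<close> to products of \<open>N\<close> factors
whose degree is larger by one. It contains the relations of Garland in the form in which they are used.\<close>

lemma x_yser_power:
  "fps_const (x 1) * yser 0 ^ Suc N = yser 0 ^ Suc N * fps_const (x 1) +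
    of_nat (Suc N) * (yser 0 ^ N * hser - fps_deriv (yser 0 ^ N))"
proof (induction N)
  case 0
  show ?case using x_yser by simp
next
  case (Suc N)
  let ?Y = "yser 0"
  have arith: "A + of_nat (Suc N) * B - of_nat N * D + (B - 2 * D) = A + of_nat (Suc (Suc N)) * (B - D)"
    for A B D :: "'a env fps"
    by (simp add: mult_2 algebra_simps)
  have deriv: "of_nat (Suc N) * (?Y * fps_deriv (?Y ^ N)) = of_nat N * fps_deriv (?Y ^ Suc N)"
  proof (cases N)
    case (Suc M)
    have "?Y * fps_deriv (?Y ^ N) = of_nat N * (?Y ^ N * fps_deriv ?Y)"
      unfolding Suc yser_power_deriv by (simp only: of_nat_left_commute power_Suc mult.assoc)
    then show ?thesis
      by (simp only: yser_power_deriv of_nat_left_commute[of "of_nat (Suc N)" N])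
  qed simp
  have "fps_const (x 1) * ?Y ^ Suc (Suc N) = (?Y * fps_const (x 1) + hser) * ?Y ^ Suc N"
    by (simp only: power_Suc[of _ "Suc N"] x_yser mult.assoc[symmetric])
  also have "\<dots> = ?Y * (fps_const (x 1) * ?Y ^ Suc N) + hser * ?Y ^ Suc N"
    by (simp only: distrib_right mult.assoc)
  also have "?Y * (fps_const (x 1) * ?Y ^ Suc N) = ?Y ^ Suc (Suc N) * fps_const (x 1) +
      of_nat (Suc N) * (?Y ^ Suc N * hser) - of_nat (Suc N) * (?Y * fps_deriv (?Y ^ N))"
    unfolding Suc.IH
    by (simp only: distrib_left right_diff_distrib power_Suc mult.assoc of_nat_left_commute add_diff_eq)
  finally show ?case
    unfolding hser_power deriv arith .
qed


lemma x0_power: "x 0 * y 0 ^ Suc s = y 0 ^ Suc s * x 0 + of_nat (Suc s) * (y 0 ^ s * (h 0 - of_nat s))"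
proof (induction s)
  case 0
  show ?case by (simp add: x_y)
next
  case (Suc s)
  have h: "h 0 * y 0 ^ t = y 0 ^ t * (h 0 - 2 * of_nat t)" for t
  proof (induction t)
    case (Suc t)
    have "h 0 * y 0 ^ Suc t = (y 0 * h 0 - 2 * y 0) * y 0 ^ t"
      by (simp add: h_y flip: mult.assoc)
    also have "\<dots> = y 0 * (h 0 * y 0 ^ t) - 2 * (y 0 * y 0 ^ t)"
      by (simp add: left_diff_distrib mult.assoc)
    finally show ?case
      unfolding Suc.IH by (simp add: mult_2 mult_2_right algebra_simps)
  qed simp
  have "x 0 * y 0 ^ Suc (Suc s) = (y 0 * x 0 + h 0) * y 0 ^ Suc s"
    by (simp add: x_y flip: mult.assoc)
  also have "\<dots> = y 0 * (x 0 * y 0 ^ Suc s) + h 0 * y 0 ^ Suc s"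
    by (simp only: distrib_right mult.assoc)
  also have "y 0 * (x 0 * y 0 ^ Suc s) = y 0 ^ Suc (Suc s) * x 0 +
      of_nat (Suc s) * (y 0 ^ Suc s * (h 0 - of_nat s))"
    unfolding Suc.IH by (simp only: distrib_left power_Suc mult.assoc of_nat_left_commute)
  also have "y 0 ^ Suc (Suc s) * x 0 + of_nat (Suc s) * (y 0 ^ Suc s * (h 0 - of_nat s)) + h 0 * y 0 ^ Suc s =
      y 0 ^ Suc (Suc s) * x 0 + of_nat (Suc (Suc s)) * (y 0 ^ Suc s * (h 0 - of_nat (Suc s)))"
  proof -
    define Y where "Y = y 0 ^ Suc s"
    have "of_nat (Suc s) * (Y * (h 0 - of_nat s)) + Y * (h 0 - 2 * of_nat (Suc s)) =
        of_nat (Suc (Suc s)) * (Y * (h 0 - of_nat (Suc s)))"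
      by (simp add: mult_2 mult_2_right algebra_simps mult_of_nat_commute[of s Y, symmetric])
    then show ?thesis
      unfolding h Y_def by (simp only: add.assoc)
  qed
  finally show ?case .
qed

text \<open>Each application of \<open>x(1)\<close> trades a factor \<open>y\<close> for a power of \<open>u\<close>, by \<open>x_yser_power\<close>, with nonzero
coefficients. So the coefficient of \<open>u\<^sup>s\<close> in the \<open>j\<close>-th power of the series is reached from
\<open>y(0)\<^sup>j\<^sup>+\<^sup>s v\<close>. The subspaces \<open>L j s\<close> absorb the terms in which some \<open>h(r)\<close> with \<open>r > 0\<close> has reached \<open>v\<close>;
they are arbitrary here because for the generator of the Weyl module there are no such terms.\<close>

lemma power_relation:
  assumes sub: "\<And>j s. env.subspace (L j s)"
    and base: "\<And>j. j \<ge> N \<Longrightarrow> y 0 ^ j * v \<in> L j 0"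
    and x_L: "\<And>j s u. u \<in> L (Suc j) s \<Longrightarrow> x 1 * u \<in> L j (Suc s)"
    and x_v: "\<And>j s. fps_nth (yser 0 ^ Suc j) s * (x 1 * v) \<in> L j (Suc s)"
    and h_v: "\<And>j s i. i \<le> s \<Longrightarrow> fps_nth (yser 0 ^ j) i * (h (Suc (s - i)) * v) \<in> L j (Suc s)"
    and "j + s \<ge> N"
  shows "fps_nth (yser 0 ^ j) s * v \<in> L j s"
  using assms(6)
proof (induction s arbitrary: j)
  case 0
  have "fps_nth (yser 0 ^ j) 0 = y 0 ^ j"
    by (induction j) (simp_all add: yser_def)
  with 0 base show ?case by simp
next
  case (Suc s)
  let ?L = "L j (Suc s)"
  let ?c = "\<lambda>i. fps_nth (yser 0 ^ j) i"
  have "x 1 * (fps_nth (yser 0 ^ Suc j) s * v) \<in> ?L"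
    using Suc by (intro x_L Suc.IH) simp
  then have "x 1 * fps_nth (yser 0 ^ Suc j) s * v \<in> ?L"
    by (simp only: mult.assoc)
  moreover have "x 1 * fps_nth (yser 0 ^ Suc j) s = fps_nth (yser 0 ^ Suc j) s * x 1 +
      of_nat (Suc j) * ((\<Sum>i\<le>s. ?c i * h (Suc (s - i))) - of_nat (Suc s) * ?c (Suc s))"
    using arg_cong[OF x_yser_power[of j], of "\<lambda>f. fps_nth f s"]
    by (simp only: fps_mult_left_const_nth fps_mult_right_const_nth fps_add_nth fps_sub_nth
        fps_nth_of_nat_mult fps_nth_mult_hser fps_deriv_nth Suc_eq_plus1)
  ultimately have "fps_nth (yser 0 ^ Suc j) s * (x 1 * v) + of_nat (Suc j) *
      ((\<Sum>i\<le>s. ?c i * (h (Suc (s - i)) * v)) - of_nat (Suc s) * (?c (Suc s) * v)) \<in> ?L"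
    by (simp only: distrib_right left_diff_distrib sum_distrib_right mult.assoc)
  from env.subspace_diff[OF sub this x_v[of j s]] have "of_nat (Suc j) *
      ((\<Sum>i\<le>s. ?c i * (h (Suc (s - i)) * v)) - of_nat (Suc s) * (?c (Suc s) * v)) \<in> ?L"
    by (simp only: add_diff_cancel_left')
  then have diff: "(\<Sum>i\<le>s. ?c i * (h (Suc (s - i)) * v)) - of_nat (Suc s) * (?c (Suc s) * v) \<in> ?L"
    by (rule subspace_of_nat_cancel[OF sub]) simp
  have "(\<Sum>i\<le>s. ?c i * (h (Suc (s - i)) * v)) \<in> ?L"
    by (rule env.subspace_sum[OF sub h_v]) simp
  from env.subspace_diff[OF sub this diff] have "of_nat (Suc s) * (?c (Suc s) * v) \<in> ?L"
    by (simp only: diff_diff_eq2 add_diff_cancel_left')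
  then show ?case
    by (rule subspace_of_nat_cancel[OF sub]) simp
qed

end

section \<open>Highest weight vectors of \<open>\<s>\<l>\<^sub>2[t]\<close>\<close>

lemma subspace_two: "env.subspace S \<Longrightarrow> u \<in> S \<Longrightarrow> 2 * u \<in> S"
  by (simp add: mult_2 env.subspace_add)

lemma subspace_two_cancel: "env.subspace S \<Longrightarrow> 2 * u \<in> S \<Longrightarrow> u \<in> S"
  using subspace_of_nat_cancel[of S 2 u] by simp

context current_sl2
begin

lemma yser_nth: "fps_nth (yser a) c = y (a + c)"
  by (simp add: yser_def)

lemma yprod_coeff_mem:
  assumes F: "env.subspace F" and F_y: "\<And>r u. u \<in> F \<Longrightarrow> y r * u \<in> F" and "u \<in> F"
  shows "fps_nth (yprod as) s * u \<in> F"
proof (induction as arbitrary: s)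
  case Nil
  show ?case using assms(3) env.subspace_0[OF F] by (simp add: fps_one_nth)
next
  case (Cons a as)
  show ?case
    by (simp add: fps_mult_nth sum_distrib_right mult.assoc yser_nth)
      (intro env.subspace_sum[OF F] F_y Cons)
qed

lemma yprod_coeff_span:
  "fps_nth (yprod as) s * v \<in> env.span {ymon bs * v | bs. length bs = length as \<and> sum_list bs = sum_list as + s}"
proof (induction as arbitrary: s)
  case Nil
  show ?case by (auto simp: fps_one_nth intro: env.span_base env.span_zero)
next
  case (Cons a as)
  have "y (a + i) * (fps_nth (yprod as) (s - i) * v) \<in> env.span {ymon bs * v | bs.
      length bs = length (a # as) \<and> sum_list bs = sum_list (a # as) + s}" if "i \<le> s" for i
  proof (rule mult_span_subset[OF _ _ Cons.IH])
    fix u assume "u \<in> {ymon bs * v | bs. length bs = length as \<and> sum_list bs = sum_list as + (s - i)}"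
    then obtain bs where "u = ymon bs * v" "length bs = length as" "sum_list bs = sum_list as + (s - i)"
      by blast
    then show "y (a + i) * u \<in> env.span {ymon bs * v | bs.
        length bs = length (a # as) \<and> sum_list bs = sum_list (a # as) + s}"
      using that by (intro env.span_base CollectI exI[of _ "(a + i) # bs"]) (simp add: mult.assoc)
  qed simp
  then show ?case
    by (simp add: fps_mult_nth sum_distrib_right mult.assoc yser_nth)
      (rule env.span_sum, simp)
qed

lemma h_yprod:
  "fps_const (h r) * yprod as = yprod as * fps_const (h r) - 2 * (\<Sum>i<length as. yprod (as[i := as ! i + r]))"
proof (induction as)
  case (Cons a as)
  have "fps_const (h r) * yprod (a # as) = (yser a * fps_const (h r) - 2 * yser (a + r)) * yprod as"
    by (simp add: h_yser flip: mult.assoc)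
  also have "\<dots> = yser a * (fps_const (h r) * yprod as) - 2 * (yser (a + r) * yprod as)"
    by (simp only: left_diff_distrib mult.assoc)
  also have "\<dots> = yprod (a # as) * fps_const (h r) -
      2 * (yser (a + r) * yprod as + yser a * (\<Sum>i<length as. yprod (as[i := as ! i + r])))"
    unfolding Cons.IH by (simp add: mult_2 algebra_simps)
  finally show ?case
    by (simp add: sum.lessThan_Suc_shift sum_distrib_left del: sum.lessThan_Suc)
qed simp

lemma h_yser_power:
  "fps_const (h r) * yser 0 ^ Suc k = yser 0 ^ Suc k * fps_const (h r) - 2 * (of_nat (Suc k) * (yser r * yser 0 ^ k))"
proof (induction k)
  case 0
  show ?case using h_yser[of r 0] by simp
next
  case (Suc k)
  have arith: "A - 2 * (of_nat (Suc k) * B) - 2 * B = A - 2 * (of_nat (Suc (Suc k)) * B)" for A B :: "'a env fps"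
    by (simp add: mult_2 algebra_simps)
  have "fps_const (h r) * yser 0 ^ Suc (Suc k) = (yser 0 * fps_const (h r) - 2 * yser r) * yser 0 ^ Suc k"
    by (simp only: power_Suc[of _ "Suc k"] mult.assoc[symmetric] h_yser add_0)
  also have "\<dots> = yser 0 * (fps_const (h r) * yser 0 ^ Suc k) - 2 * (yser r * yser 0 ^ Suc k)"
    by (simp only: left_diff_distrib mult.assoc)
  also have "yser 0 * (fps_const (h r) * yser 0 ^ Suc k) =
      yser 0 ^ Suc (Suc k) * fps_const (h r) - 2 * (of_nat (Suc k) * (yser 0 * (yser r * yser 0 ^ k)))"
    unfolding Suc.IH right_diff_distrib by (simp only: of_nat_left_commute mult_2 distrib_left power_Suc mult.assoc)
  also have "yser 0 * (yser r * yser 0 ^ k) = yser r * yser 0 ^ Suc k"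
    by (simp only: power_Suc mult.assoc[symmetric] yser_commute)
  finally show ?case unfolding arith .
qed

text \<open>The link between series in \<open>y\<close> and symmetric polynomials.\<close>

lemma raise_sum_ymon:
  assumes "\<And>u w. f (u + w) = f u + (f w :: complex)"
  shows "raise_sum (\<lambda>b. f (ymon b * v)) as s = f (fps_nth (yprod as) s * v)"
  using assms
proof (induction as arbitrary: f s)
  case Nil
  have "f 0 = 0" using Nil[of 0 0] by simp
  then show ?case by (simp add: fps_one_nth)
next
  case (Cons a as)
  have f0: "f 0 = 0" using Cons.prems[of 0 0] by simp
  have f_sum: "f (sum g S) = (\<Sum>i\<in>S. f (g i))" if "finite S" for g and S :: "nat set"
    using that by induction (simp_all add: f0 Cons.prems)
  have "raise_sum (\<lambda>b. f (y (a + c) * (ymon b * v))) as t = f (y (a + c) * (fps_nth (yprod as) t * v))" for c t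
    by (rule Cons.IH) (simp add: distrib_left Cons.prems)
  then show ?case
    by (simp add: mult.assoc fps_mult_nth sum_distrib_right yser_nth f_sum atMost_atLeast0)
qed

end

text \<open>The subspace \<open>F\<close> is to be thought of as zero. Modulo \<open>F\<close>, the set \<open>V\<close> consists of vectors of weight
\<open>q\<close> killed by the \<open>x(r)\<close>. Unlike the generator of a Weyl module, the vectors of \<open>V\<close> need not be killed by the \<open>h(r)\<close>
with \<open>r > 0\<close>.\<close>

locale current_sl2_lowering = current_sl2 +
  fixes F V :: "'a env set" and q N :: nat
  assumes F: "env.subspace F"
    and F_x: "u \<in> F \<Longrightarrow> x r * u \<in> F"
    and F_h: "u \<in> F \<Longrightarrow> h r * u \<in> F"
    and F_y: "u \<in> F \<Longrightarrow> y r * u \<in> F"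
    and V_x: "v \<in> V \<Longrightarrow> x r * v \<in> F"
    and V_h: "v \<in> V \<Longrightarrow> h r * v \<in> V"
    and V_weight: "v \<in> V \<Longrightarrow> (h 0 - of_nat q) * v \<in> F"
    and V_nilpotent: "v \<in> V \<Longrightarrow> y 0 ^ N * v \<in> F"
begin

lemma F_y_power: "u \<in> F \<Longrightarrow> y 0 ^ k * u \<in> F"
  by (induction k) (simp_all add: mult.assoc F_y)

text \<open>Modulo \<open>F\<close> one has \<open>x(0) y(0)\<^sup>s\<^sup>+\<^sup>1 v = (s + 1) (q - s) y(0)\<^sup>s v\<close>, and the factor is not zero for
\<open>s > q\<close>. So the exponent \<open>N\<close> of nilpotency can be lowered step by step to \<open>q + 1\<close>.\<close>

lemma y_power_vanish:
  assumes v: "v \<in> V" and "j > q"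
  shows "y 0 ^ j * v \<in> F"
proof -
  have large: "y 0 ^ j * v \<in> F" if "j \<ge> N" for j
  proof -
    have "y 0 ^ j * v = y 0 ^ (j - N) * (y 0 ^ N * v)"
      using that by (simp flip: mult.assoc power_add)
    then show ?thesis by (simp add: F_y_power V_nilpotent v)
  qed
  have step: "y 0 ^ s * v \<in> F" if "y 0 ^ Suc s * v \<in> F" "s > q" for s
  proof -
    have eq: "x 0 * (y 0 ^ Suc s * v) = y 0 ^ Suc s * (x 0 * v) + of_nat (Suc s) * (y 0 ^ s * ((h 0 - of_nat s) * v))"
      by (simp only: mult.assoc[symmetric] x0_power distrib_right)
    have "x 0 * (y 0 ^ Suc s * v) - y 0 ^ Suc s * (x 0 * v) \<in> F"
      by (intro env.subspace_diff[OF F] F_x that(1) F_y_power V_x v)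
    then have "of_nat (Suc s) * (y 0 ^ s * ((h 0 - of_nat s) * v)) \<in> F"
      by (simp only: eq add_diff_cancel_left')
    then have "y 0 ^ s * ((h 0 - of_nat s) * v) \<in> F"
      by (rule subspace_of_nat_cancel[OF F]) simp
    moreover have "y 0 ^ s * ((h 0 - of_nat q) * v) \<in> F"
      by (intro F_y_power V_weight v)
    ultimately have "y 0 ^ s * ((h 0 - of_nat q) * v) - y 0 ^ s * ((h 0 - of_nat s) * v) \<in> F"
      by (intro env.subspace_diff[OF F])
    moreover have "y 0 ^ s * ((h 0 - of_nat q) * v) - y 0 ^ s * ((h 0 - of_nat s) * v) =
        of_nat (s - q) * (y 0 ^ s * v)"
      using that(2) by (simp add: of_nat_diff left_diff_distrib right_diff_distrib of_nat_left_commute)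
    ultimately show ?thesis
      using subspace_of_nat_cancel[OF F, of "s - q"] that(2) by simp
  qed
  show ?thesis
  proof (cases "j \<ge> N")
    case False
    then have "j \<le> N" by simp
    from this assms(2) show ?thesis
      by (induction rule: inc_induct) (auto intro: large step)
  qed (rule large)
qed

text \<open>Since \<open>h(r)\<close> with \<open>r > 0\<close> need not kill \<open>V\<close>, the relations between products of \<open>j\<close> factors hold only up
to products of lower degree, which are collected here.\<close>

definition low :: "nat \<Rightarrow> nat \<Rightarrow> 'a env set" where
  "low j d = env.span ({ymon as * v | as v. length as = j \<and> sum_list as < d \<and> v \<in> V} \<union> F)"

lemma low_subspace: "env.subspace (low j d)"
  unfolding low_def by simp

lemma F_low: "F \<subseteq> low j d"
  unfolding low_def by (auto intro: env.span_base)

lemma ymon_low: "length as = j \<Longrightarrow> sum_list as < d \<Longrightarrow> v \<in> V \<Longrightarrow> ymon as * v \<in> low j d"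
  unfolding low_def by (intro env.span_base) blast

lemma low_mono: "d \<le> e \<Longrightarrow> low j d \<subseteq> low j e"
  unfolding low_def by (intro env.span_mono) force

lemma h_ymon:
  "v \<in> V \<Longrightarrow> h r * (ymon as * v) \<in> low (length as) (Suc (sum_list as + r))"
proof (induction as arbitrary: r)
  case Nil
  then show ?case using ymon_low[of "[]" 0 "Suc r" "h r * v"] by (simp add: V_h)
next
  case (Cons a as)
  let ?L = "low (length (a # as)) (Suc (sum_list (a # as) + r))"
  have "h r * (ymon (a # as) * v) = (y a * h r - 2 * y (r + a)) * (ymon as * v)"
    by (simp add: h_y flip: mult.assoc)
  then have eq: "h r * (ymon (a # as) * v) = y a * (h r * (ymon as * v)) - 2 * (ymon ((r + a) # as) * v)"
    by (simp add: left_diff_distrib mult.assoc)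
  have "y a * (h r * (ymon as * v)) \<in> ?L"
  proof (rule mult_span_subset[OF low_subspace _ Cons.IH[OF Cons.prems, unfolded low_def]])
    fix u assume "u \<in> {ymon bs * v | bs v. length bs = length as \<and> sum_list bs < Suc (sum_list as + r) \<and> v \<in> V} \<union> F"
    then consider bs w where "u = ymon bs * w" "length bs = length as" "sum_list bs < Suc (sum_list as + r)" "w \<in> V"
      | "u \<in> F" by blast
    then show "y a * u \<in> ?L"
    proof cases
      case 1
      then show ?thesis using ymon_low[of "a # bs" "length (a # as)" "Suc (sum_list (a # as) + r)" w]
        by (simp add: mult.assoc)
    qed (use F_low F_y in blast)
  qed
  moreover have "ymon ((r + a) # as) * v \<in> ?L"
    by (rule ymon_low) (use Cons.prems in simp_all)
  ultimately show ?case
    unfolding eq by (intro env.subspace_diff subspace_two low_subspace)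
qed

lemma h_low:
  assumes "u \<in> low j d"
  shows "h r * u \<in> low j (d + r)"
proof (rule mult_span_subset[OF low_subspace _ assms[unfolded low_def]])
  fix a
  assume "a \<in> {ymon as * v | as v. length as = j \<and> sum_list as < d \<and> v \<in> V} \<union> F"
  then consider as v where "a = ymon as * v" "length as = j" "sum_list as < d" "v \<in> V" | "a \<in> F"
    by blast
  then show "h r * a \<in> low j (d + r)"
  proof cases
    case (1 as v)
    then show ?thesis
      using h_ymon[of v r as] low_mono[of "Suc (sum_list as + r)" "d + r" j] by auto
  qed (use F_low F_h in blast)
qed

text \<open>If \<open>x(r)\<close> meets \<open>y(a)\<close>, the resulting \<open>h(r + a)\<close> is absorbed by another factor or by \<open>V\<close>; in both
cases one factor is lost and the degree grows by at most \<open>r\<close>.\<close>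

lemma x_ymon:
  "v \<in> V \<Longrightarrow> x r * (ymon as * v) \<in> low (length as - 1) (sum_list as + r + 1)"
proof (induction as)
  case Nil
  then show ?case by (auto intro!: subsetD[OF F_low] V_x)
next
  case (Cons a as)
  let ?L = "low (length as) (Suc (sum_list (a # as) + r))"
  have "x r * (ymon (a # as) * v) = (y a * x r + h (r + a)) * (ymon as * v)"
    by (simp add: x_y flip: mult.assoc)
  then have eq: "x r * (ymon (a # as) * v) = y a * (x r * (ymon as * v)) + h (r + a) * (ymon as * v)"
    by (simp add: distrib_right mult.assoc)
  have "y a * (x r * (ymon as * v)) \<in> ?L"
  proof (cases as)
    case Nil
    then show ?thesis using Cons.prems by (auto intro!: subsetD[OF F_low] F_y V_x)
  next
    case as: (Cons b bs)
    show ?thesis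
    proof (rule mult_span_subset[OF low_subspace _ Cons.IH[OF Cons.prems, unfolded low_def]])
      fix u assume "u \<in> {ymon cs * v | cs v. length cs = length as - 1 \<and>
        sum_list cs < sum_list as + r + 1 \<and> v \<in> V} \<union> F"
      then consider cs w where "u = ymon cs * w" "length cs = length as - 1"
          "sum_list cs < sum_list as + r + 1" "w \<in> V"
        | "u \<in> F" by blast
      then show "y a * u \<in> ?L"
      proof cases
        case 1
        then show ?thesis
          using ymon_low[of "a # cs" "length as" "Suc (sum_list (a # as) + r)" w] as
          by (simp add: mult.assoc)
      qed (use F_low F_y in blast)
    qed
  qed
  moreover have "h (r + a) * (ymon as * v) \<in> ?L"
    using h_ymon[OF Cons.prems, of "r + a" as] by (simp add: ac_simps)
  ultimately show ?case
    unfolding eq using env.subspace_add[OF low_subspace] by simp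
qed

lemma x_low:
  assumes "u \<in> low (Suc j) d"
  shows "x r * u \<in> low j (d + r)"
proof (rule mult_span_subset[OF low_subspace _ assms[unfolded low_def]])
  fix a
  assume "a \<in> {ymon as * v | as v. length as = Suc j \<and> sum_list as < d \<and> v \<in> V} \<union> F"
  then consider as v where "a = ymon as * v" "length as = Suc j" "sum_list as < d" "v \<in> V" | "a \<in> F"
    by blast
  then show "x r * a \<in> low j (d + r)"
  proof cases
    case (1 as v)
    then show ?thesis
      using x_ymon[of v r as] low_mono[of "sum_list as + r + 1" "d + r" j] by auto
  qed (use F_low F_x in blast)
qed

lemma yprod_coeff_low:
  assumes "v \<in> V" "length as = j" "sum_list as + s < d"
  shows "fps_nth (yprod as) s * v \<in> low j d"
proof -
  have "{ymon bs * v | bs. length bs = length as \<and> sum_list bs = sum_list as + s} \<subseteq> low j d"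
    using assms by (auto intro: ymon_low)
  from env.span_minimal[OF this low_subspace] show ?thesis
    using yprod_coeff_span by blast
qed

lemma yser_power_eq_yprod: "yser 0 ^ k = yprod (replicate k 0)"
  by (induction k) simp_all

lemma yser_power_low:
  assumes "v \<in> V" "j + s > q"
  shows "fps_nth (yser 0 ^ j) s * v \<in> low j s"
proof (rule power_relation[where N = "Suc q"])
  show "env.subspace (low j s)" for j s by (rule low_subspace)
  show "y 0 ^ j * v \<in> low j 0" if "j \<ge> Suc q" for j
    using y_power_vanish[OF assms(1), of j] that F_low by auto
  show "x 1 * u \<in> low j (Suc s)" if "u \<in> low (Suc j) s" for j s u
    using x_low[OF that, of 1] by simp
  show "fps_nth (yser 0 ^ Suc j) s * (x 1 * v) \<in> low j (Suc s)" for j s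
    unfolding yser_power_eq_yprod using yprod_coeff_mem[OF F F_y V_x[OF assms(1)]] F_low by blast
  show "fps_nth (yser 0 ^ j) i * (h (Suc (s - i)) * v) \<in> low j (Suc s)" if "i \<le> s" for j s i
    unfolding yser_power_eq_yprod by (rule yprod_coeff_low) (use V_h assms(1) that in \<open>simp_all add: sum_list_replicate\<close>)
qed (use assms in simp)

text \<open>Commutation with \<open>h(r)\<close> multiplies a symmetric polynomial by the power sum \<open>p\<^sub>r\<close>. For the product of
\<open>h\<^sub>s\<close> with the monomial \<open>cs\<close> this gives the terms in which \<open>r\<close> is added to an exponent in \<open>cs\<close>, and
\<open>k + 1\<close> equal terms in which one more variable gets the exponent \<open>r\<close>. The latter are
therefore known if the former are, so the number of variables with prescribed exponent can be raised.\<close>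

lemma yprod_power_low:
  assumes "v \<in> V" "length bs + k + s > q"
  shows "fps_nth (yprod bs * yser 0 ^ k) s * v \<in> low (length bs + k) (sum_list bs + s)"
  using assms
proof (induction "length bs" arbitrary: bs k v)
  case 0
  then show ?case using yser_power_low by simp
next
  case (Suc l)
  then obtain cs r where bs: "bs = cs @ [r]" by (metis length_0_conv nat.distinct(1) rev_exhaust)
  with Suc have l: "l = length cs" by simp
  let ?L = "low (length bs + k) (sum_list bs + s)"
  let ?P = "yprod cs * yser 0 ^ Suc k"
  have IH: "fps_nth (yprod ds * yser 0 ^ Suc k) s * w \<in> low (length bs + k) (sum_list ds + s)"
    if "length ds = length cs" "w \<in> V" for ds w
    using Suc.hyps(1)[of ds w "Suc k"] Suc.prems that by (simp add: l bs)
  let ?S = "\<Sum>i<length cs. yprod (cs[i := cs ! i + r]) * yser 0 ^ Suc k"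
  \<comment> \<open>The commutator of \<open>h(r)\<close> with the product of the series for \<open>cs\<close> and \<open>k + 1\<close> further ones is computed
    and solved for the terms with exponents \<open>bs\<close>.\<close>
  have "fps_const (h r) * ?P = (yprod cs * fps_const (h r)) * yser 0 ^ Suc k - 2 * ?S"
    by (simp only: mult.assoc[symmetric] h_yprod left_diff_distrib) (simp only: mult.assoc sum_distrib_right)
  also have "(yprod cs * fps_const (h r)) * yser 0 ^ Suc k =
      ?P * fps_const (h r) - 2 * (of_nat (Suc k) * (yprod bs * yser 0 ^ k))"
    by (simp only: mult.assoc h_yser_power right_diff_distrib)
      (simp only: mult_2 distrib_left of_nat_left_commute bs map_append prod_list.append mult.assoc list.map
        prod_list.Cons prod_list.Nil mult_1_right mult_1)
  finally have "2 * (of_nat (Suc k) * (yprod bs * yser 0 ^ k)) =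
      ?P * fps_const (h r) - fps_const (h r) * ?P - 2 * ?S"
    by simp
  from arg_cong[OF this, of "\<lambda>f. fps_nth f s * v"]
  have eq: "2 * (of_nat (Suc k) * (fps_nth (yprod bs * yser 0 ^ k) s * v)) =
      fps_nth ?P s * (h r * v) - h r * (fps_nth ?P s * v) -
      2 * (\<Sum>i<length cs. fps_nth (yprod (cs[i := cs ! i + r]) * yser 0 ^ Suc k) s * v)"
    by (simp only: fps_nth_two_mult fps_nth_of_nat_mult fps_sub_nth fps_mult_left_const_nth
        fps_mult_right_const_nth fps_sum_nth left_diff_distrib) (simp only: mult.assoc sum_distrib_right)
  have sum_update: "sum_list (cs[i := cs ! i + r]) = sum_list bs" if "i < length cs" for i
    using that by (simp add: sum_list_update bs)
  have "fps_nth ?P s * (h r * v) \<in> ?L"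
    using IH[of cs "h r * v"] low_mono[of "sum_list cs + s" "sum_list bs + s"] Suc.prems V_h
    by (auto simp: bs)
  moreover have "h r * (fps_nth ?P s * v) \<in> ?L"
    using h_low[OF IH[of cs v], of r] Suc.prems by (simp add: bs ac_simps)
  moreover have "(\<Sum>i<length cs. fps_nth (yprod (cs[i := cs ! i + r]) * yser 0 ^ Suc k) s * v) \<in> ?L"
  proof (intro env.subspace_sum low_subspace)
    fix i assume "i \<in> {..<length cs}"
    then show "fps_nth (yprod (cs[i := cs ! i + r]) * yser 0 ^ Suc k) s * v \<in> ?L"
      using IH[of "cs[i := cs ! i + r]" v] Suc.prems(1) sum_update[of i] by (simp del: power_Suc)
  qed
  ultimately have "2 * (of_nat (Suc k) * (fps_nth (yprod bs * yser 0 ^ k) s * v)) \<in> ?L"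
    unfolding eq by (intro env.subspace_diff subspace_two low_subspace)
  from subspace_two_cancel[OF low_subspace this] show ?case
    by (rule subspace_of_nat_cancel[OF low_subspace]) simp
qed

text \<open>In the least degree \<open>d\<close> where the claim fails, some functional vanishes on the asserted span but not
on the given product. Products of degree below \<open>d\<close> lie in the span, so for this functional the relations
\<open>yprod_power_low\<close> hold without error terms, and \<open>symmetric_function_box\<close> gives a contradiction.\<close>

theorem ymon_box:
  assumes "v \<in> V"
  shows "ymon b * v \<in> env.span ({ymon as * v | as v. length as = length b \<and>
    (\<forall>a\<in>set as. a < Suc q - length b) \<and> v \<in> V} \<union> F)"
  using assms
proof (induction "sum_list b" arbitrary: b v rule: less_induct)
  case less
  let ?j = "length b"
  let ?B = "env.span ({ymon as * v | as v. length as = ?j \<and> (\<forall>a\<in>set as. a < Suc q - ?j) \<and> v \<in> V} \<union> F)"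
  show ?case
  proof (rule ccontr)
    assume "ymon b * v \<notin> ?B"
    then obtain f :: "'a env \<Rightarrow> complex" where f: "\<And>u w. f (u + w) = f u + f w"
        "\<And>u. u \<in> ?B \<Longrightarrow> f u = 0" "f (ymon b * v) \<noteq> 0"
      by (rule separating_functional[OF env.subspace_span]) blast
    have "low ?j (sum_list b) \<subseteq> ?B"
      unfolding low_def
    proof (rule env.span_minimal)
      show "{ymon as * v | as v. length as = ?j \<and> sum_list as < sum_list b \<and> v \<in> V} \<union> F \<subseteq> ?B"
      proof
        fix u assume "u \<in> {ymon as * v | as v. length as = ?j \<and> sum_list as < sum_list b \<and> v \<in> V} \<union> F"
        then consider as w where "u = ymon as * w" "length as = ?j" "sum_list as < sum_list b" "w \<in> V"
          | "u \<in> F" by blast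
        then show "u \<in> ?B"
        proof cases
          case (1 as w)
          then show ?thesis using less.hyps[of as w] by simp
        qed (simp add: env.span_base)
      qed
    qed simp
    \<comment> \<open>The cutoff makes all relations of other degrees trivial.\<close>
    define \<phi> where "\<phi> c = (if sum_list c = sum_list b then f (ymon c * v) else 0)" for c
    have "\<phi> b = 0"
    proof (rule symmetric_function_box[of \<phi> ?j "Suc q - ?j"])
      show "\<phi> c = \<phi> d" if "mset c = mset d" for c d
        unfolding \<phi>_def ymon_mset[OF that] by (metis sum_mset_sum_list that)
      show "\<phi> c = 0" if "length c = ?j" "\<forall>a\<in>set c. a < Suc q - ?j" for c
        unfolding \<phi>_def using that less.prems by (auto intro!: f(2) env.span_base)
      show "raise_sum \<phi> as s = 0" if as: "length as = ?j" "s \<ge> Suc q - ?j" for as s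
      proof (cases "sum_list as + s = sum_list b")
        case True
        have "raise_sum \<phi> as s = raise_sum (\<lambda>c. f (ymon c * v)) as s"
          by (rule raise_sum_cong) (simp add: \<phi>_def True)
        also have "\<dots> = f (fps_nth (yprod as) s * v)"
          by (rule raise_sum_ymon) (rule f(1))
        also have "fps_nth (yprod as) s * v \<in> low ?j (sum_list b)"
          using yprod_power_low[OF less.prems, of as 0 s] as by (simp flip: True)
        then have "f (fps_nth (yprod as) s * v) = 0"
          using f(2) \<open>low ?j (sum_list b) \<subseteq> ?B\<close> by blast
        finally show ?thesis .
      next
        case False
        then have "raise_sum \<phi> as s = raise_sum (\<lambda>_. 0) as s"
          by (intro raise_sum_cong) (simp add: \<phi>_def)
        then show ?thesis by simp
      qed
    qed simp
    with f(3) show False by (simp add: \<phi>_def)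
  qed
qed

end

section \<open>Products of anticommuting elements\<close>

locale anticommuting =
  fixes e :: "nat \<Rightarrow> 'a::lie_superalgebra env"
  assumes anticommute: "e a * e b = - (e b * e a)"
begin

abbreviation wedge :: "nat list \<Rightarrow> 'a env" where
  "wedge as \<equiv> prod_list (map e as)"

lemma square_zero: "e a * e a = 0"
proof -
  have "2 * (e a * e a) \<in> env.span {}"
    using anticommute[of a a] by (simp add: mult_2 eq_neg_iff_add_eq_0)
  then have "e a * e a \<in> env.span {}"
    by (rule subspace_two_cancel[OF env.subspace_span])
  then show ?thesis by simp
qed

text \<open>A repeated factor gives zero by \<open>square_zero\<close>; otherwise sorting only changes signs.\<close>

lemma wedge_insert:
  assumes "sorted_wrt (<) cs"
  shows "e a * (wedge cs * w) \<in> env.span {wedge ds * w | ds. length ds = Suc (length cs) \<and>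
    sorted_wrt (<) ds \<and> set ds \<subseteq> insert a (set cs)}"
  using assms
proof (induction cs)
  case Nil
  show ?case by (rule env.span_base) (auto intro!: exI[of _ "[a]"])
next
  case (Cons c cs)
  let ?S = "env.span {wedge ds * w | ds. length ds = Suc (length (c # cs)) \<and>
    sorted_wrt (<) ds \<and> set ds \<subseteq> insert a (set (c # cs))}"
  consider "a < c" | "a = c" | "a > c" by linarith
  then show ?case
  proof cases
    case 1
    show ?thesis
    proof (rule env.span_base)
      show "e a * (wedge (c # cs) * w) \<in> {wedge ds * w | ds. length ds = Suc (length (c # cs)) \<and>
          sorted_wrt (<) ds \<and> set ds \<subseteq> insert a (set (c # cs))}"
        using 1 Cons.prems by (intro CollectI exI[of _ "a # c # cs"]) (auto simp: mult.assoc)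
    qed
  next
    case 2
    then have "e a * (wedge (c # cs) * w) = (e c * e c) * (wedge cs * w)"
      by (simp add: mult.assoc)
    then show ?thesis by (simp add: square_zero env.span_zero)
  next
    case 3
    have "e a * (wedge (c # cs) * w) = (e a * e c) * (wedge cs * w)"
      by (simp add: mult.assoc)
    also have "\<dots> = - (e c * (e a * (wedge cs * w)))"
      by (simp add: anticommute[of a c] mult.assoc)
    also have "\<dots> \<in> ?S"
    proof (intro env.span_neg mult_span_subset[OF env.subspace_span _ Cons.IH])
      fix u assume "u \<in> {wedge ds * w | ds. length ds = Suc (length cs) \<and> sorted_wrt (<) ds \<and>
        set ds \<subseteq> insert a (set cs)}"
      then obtain ds where ds: "u = wedge ds * w" "length ds = Suc (length cs)" "sorted_wrt (<) ds"
          "set ds \<subseteq> insert a (set cs)" by blast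
      then show "e c * u \<in> ?S"
        using 3 Cons.prems
        by (intro env.span_base CollectI exI[of _ "c # ds"]) (auto simp: mult.assoc)
    qed (use Cons.prems in simp)
    finally show ?thesis .
  qed
qed

lemma wedge_move: "e b * wedge cs = (- 1) ^ length cs * (wedge cs * e b)"
proof (induction cs)
  case (Cons c cs)
  have "e b * wedge (c # cs) = - (e c * (e b * wedge cs))"
    by (simp add: anticommute[of b c] flip: mult.assoc)
  also have "\<dots> = - (e c * ((- 1) ^ length cs * (wedge cs * e b)))"
    by (simp only: Cons.IH)
  also have "\<dots> = (- 1) ^ length (c # cs) * (wedge (c # cs) * e b)"
    by (cases "even (length cs)") (simp_all add: mult.assoc)
  finally show ?case .
qed simp

text \<open>A factor that reaches \<open>V\<close> is replaced by factors with index below \<open>p\<close>; these are moved to the front,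
where \<open>wedge_insert\<close> sorts them in.\<close>

lemma wedge_straighten:
  assumes F: "env.subspace F" and F_e: "\<And>b u. u \<in> F \<Longrightarrow> e b * u \<in> F"
    and reduce: "\<And>v s. v \<in> V \<Longrightarrow> e s * v \<in> env.span ({e a * w | a w. a < p \<and> w \<in> V} \<union> F)"
    and "v \<in> V"
  shows "wedge bs * v \<in> env.span ({wedge cs * w | cs w. length cs = length bs \<and> sorted_wrt (<) cs \<and>
    (\<forall>c\<in>set cs. c < p) \<and> w \<in> V} \<union> F)"
proof -
  define S where "S k = env.span ({wedge cs * w | cs w. length cs = k \<and> sorted_wrt (<) cs \<and>
    (\<forall>c\<in>set cs. c < p) \<and> w \<in> V} \<union> F)" for k
  have sub: "env.subspace (S k)" for k by (simp add: S_def)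
  have F_S: "F \<subseteq> S k" for k by (auto simp: S_def intro: env.span_base)
  have F_wedge: "wedge cs * u \<in> F" if "u \<in> F" for cs u
    using that by (induction cs) (auto simp: mult.assoc F_e)
  have small: "e a * (wedge cs * w) \<in> S (Suc (length cs))"
    if "a < p" "sorted_wrt (<) cs" "\<forall>c\<in>set cs. c < p" "w \<in> V" for a cs w
  proof -
    have "{wedge ds * w | ds. length ds = Suc (length cs) \<and> sorted_wrt (<) ds \<and> set ds \<subseteq> insert a (set cs)}
        \<subseteq> S (Suc (length cs))"
    proof
      fix u assume "u \<in> {wedge ds * w | ds. length ds = Suc (length cs) \<and> sorted_wrt (<) ds \<and>
        set ds \<subseteq> insert a (set cs)}"
      then obtain ds where ds: "u = wedge ds * w" "length ds = Suc (length cs)" "sorted_wrt (<) ds"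
          "set ds \<subseteq> insert a (set cs)" by blast
      then have "\<forall>c\<in>set ds. c < p" using that(1,3) by auto
      with ds that(4) show "u \<in> S (Suc (length cs))"
        unfolding S_def by (intro env.span_base) blast
    qed
    from env.span_minimal[OF this sub] wedge_insert[OF that(2)] show ?thesis by blast
  qed
  have sign: "(- 1) ^ k * u \<in> S j" if "u \<in> S j" for k j :: nat and u
    using that by (cases "even k") (auto intro: env.subspace_neg[OF sub])
  have step: "e b * u \<in> S (Suc k)" if "u \<in> S k" for b u k
  proof (rule mult_span_subset[OF sub _ that[unfolded S_def]])
    fix u
    assume "u \<in> {wedge cs * w | cs w. length cs = k \<and> sorted_wrt (<) cs \<and> (\<forall>c\<in>set cs. c < p) \<and> w \<in> V} \<union> F"
    then consider cs w where "u = wedge cs * w" "length cs = k" "sorted_wrt (<) cs" "\<forall>c\<in>set cs. c < p" "w \<in> V"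
      | "u \<in> F" by blast
    then show "e b * u \<in> S (Suc k)"
    proof cases
      case (1 cs w)
      have "wedge cs * (e b * w) \<in> S (Suc k)"
      proof (rule mult_span_subset[OF sub _ reduce[OF 1(5)]])
        fix x assume "x \<in> {e a * w | a w. a < p \<and> w \<in> V} \<union> F"
        then consider a w' where "x = e a * w'" "a < p" "w' \<in> V" | "x \<in> F" by blast
        then show "wedge cs * x \<in> S (Suc k)"
        proof cases
          case (1 a w')
          have "wedge cs * e a = (- 1) ^ length cs * (e a * wedge cs)"
            unfolding wedge_move by (cases "even (length cs)") simp_all
          from arg_cong[OF this, of "\<lambda>z. z * w'"] have "wedge cs * x = (- 1) ^ length cs * (e a * (wedge cs * w'))"
            by (simp only: 1(1) mult.assoc)
          with small[OF 1(2) \<open>sorted_wrt (<) cs\<close> \<open>\<forall>c\<in>set cs. c < p\<close> 1(3)] \<open>length cs = k\<close>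
          show ?thesis by (simp add: sign)
        qed (use F_S F_wedge in blast)
      qed
      moreover have "e b * u = (- 1) ^ length cs * (wedge cs * (e b * w))"
        using arg_cong[OF wedge_move[of b cs], of "\<lambda>z. z * w"] by (simp only: 1(1) mult.assoc)
      ultimately show ?thesis by (simp add: sign)
    qed (use F_S F_e in blast)
  qed
  have "wedge bs * v \<in> S (length bs)"
  proof (induction bs)
    case Nil
    show ?case
      unfolding S_def using assms(4)
      by (intro env.span_base UnI1 CollectI exI[of _ "[]"] exI[of _ v]) simp
  next
    case (Cons b bs)
    then show ?case using step by (simp add: mult.assoc)
  qed
  then show ?thesis by (simp only: S_def)
qed

end

section \<open>The relations of \<open>\<s>\<l>(1|2)[t]\<close>\<close>

lemma env_induct [case_names const gen add mult]:
  fixes u :: "'a::lie_superalgebra env"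
  assumes const: "\<And>c. P (env_const c)" and gen: "\<And>x. P (env_gen x)"
    and add: "\<And>u v. P u \<Longrightarrow> P v \<Longrightarrow> P (u + v)" and mult: "\<And>u v. P u \<Longrightarrow> P v \<Longrightarrow> P (u * v)"
  shows "P u"
proof (induction u rule: env.abs_induct)
  case (1 f)
  have word: "P (abs_env (Poly_Mapping.single w c))" for w c
  proof (induction w)
    case Nil
    show ?case using const[of c] by (simp add: env_const.abs_eq free_const_def)
  next
    case (Cons x w)
    have "abs_env (Poly_Mapping.single (x # w) c) = env_gen x * abs_env (Poly_Mapping.single w c)"
      by (simp add: env_gen.abs_eq times_env.abs_eq free_gen_def mult_single plus_list_def)
    with Cons gen mult show ?case by simp
  qed
  show ?case
  proof (induction f rule: poly_mapping_add_single_induct)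
    case 1
    show ?case using word[of "[]" 0] by simp
  next
    case (2 f k v)
    then show ?case using add word by (simp flip: plus_env.abs_eq)
  qed
qed

lemma env_const_uminus_one: "env_const (- 1) = - 1"
  using env_const_add[of 1 "- 1"] by (simp add: env_const_zero env_const_one eq_neg_iff_add_eq_0 add.commute)

lemma at_t_add: "at_t (x + y) m = at_t x m + at_t y m"
  by (simp add: at_t_def single_add env_gen_add)

lemma at_t_cscale: "at_t (cscale c x) m = env_const c * at_t x m"
  by (simp add: at_t_def env_gen_cscale flip: cscale_single)

lemma at_t_zero: "at_t 0 m = 0"
  using at_t_add[of 0 0 m] by simp

lemma at_t_uminus: "at_t (- x) m = - at_t x m"
  using at_t_add[of "- x" x m] by (simp add: at_t_zero eq_neg_iff_add_eq_0)

lemma at_t_diff: "at_t (x - y) m = at_t x m - at_t y m"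
  using at_t_add[of x "- y" m] by (simp add: at_t_uminus)

lemma at_t_mult:
  assumes "x \<in> homog p" "y \<in> homog q"
  shows "at_t x m * at_t y n = env_const (koszul_sign p q) * (at_t y n * at_t x m) + at_t (sbracket x y) (m + n)"
proof -
  have "Poly_Mapping.single k z \<in> homog r" if "z \<in> homog r" for k :: nat and z :: sl12 and r
    using that by (simp add: homog_poly_mapping_def lookup_single when_def homog_zero)
  from env_gen_sbracket[OF this[OF assms(1)] this[OF assms(2)], of m n] show ?thesis
    by (simp add: at_t_def sbracket_single algebra_simps)
qed

lemma at_t_commute:
  assumes "x \<in> homog p" "y \<in> homog q" "p = 0 \<or> q = 0"
  shows "at_t x m * at_t y n = at_t y n * at_t x m + at_t (sbracket x y) (m + n)"
  using at_t_mult[OF assms(1,2), of m n] assms(3) by (auto simp: koszul_sign_def env_const_one)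

lemma at_t_anticommute:
  assumes "x \<in> homog 1" "y \<in> homog 1"
  shows "at_t x m * at_t y n = - (at_t y n * at_t x m) + at_t (sbracket x y) (m + n)"
  using at_t_mult[OF assms, of m n] by (simp add: koszul_sign_def env_const_uminus_one)

abbreviation (input) "X1 \<equiv> at_t sl_x1"
abbreviation (input) "X2 \<equiv> at_t sl_x2"
abbreviation (input) "X3 \<equiv> at_t sl_x3"
abbreviation (input) "Y1 \<equiv> at_t sl_y1"
abbreviation (input) "Y2 \<equiv> at_t sl_y2"
abbreviation (input) "Y3 \<equiv> at_t sl_y3"
abbreviation (input) "H1 \<equiv> at_t sl_h1"
abbreviation (input) "H2 \<equiv> at_t sl_h2"

lemma sl12_homog:
  "sl_x1 \<in> homog 1" "sl_x3 \<in> homog 1" "sl_y1 \<in> homog 1" "sl_y3 \<in> homog 1"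
  "sl_x2 \<in> homog 0" "sl_y2 \<in> homog 0" "sl_h1 \<in> homog 0" "sl_h2 \<in> homog 0"
  unfolding homog_sl12_def mem_Collect_eq
  by (transfer; simp add: mat3_simps matrix_unit_def transpose_def)+

lemma Rep_sbracket:
  assumes "x \<in> homog p" "y \<in> homog q"
  shows "Rep_sl12 (sbracket x y) =
    Rep_sl12 x ** Rep_sl12 y - mat_scale (koszul_sign p q) (Rep_sl12 y ** Rep_sl12 x)"
  using assms unfolding homog_sl12_def mem_Collect_eq by transfer (rule supercommutator_homog)

lemmas sl12_rep_eqs = sl_x1.rep_eq sl_x2.rep_eq sl_x3.rep_eq sl_y1.rep_eq sl_y2.rep_eq sl_y3.rep_eq
  sl_h1.rep_eq sl_h2.rep_eq zero_sl12.rep_eq plus_sl12.rep_eq minus_sl12.rep_eq uminus_sl12.rep_eq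

lemma sl12_brackets:
  "sbracket sl_x2 sl_y2 = sl_h2" "sbracket sl_h2 sl_y2 = - (sl_y2 + sl_y2)" "sbracket sl_h1 sl_y2 = - sl_y2"
  "sbracket sl_y2 sl_y2 = 0" "sbracket sl_h1 sl_x1 = 0" "sbracket sl_h2 sl_x1 = - sl_x1"
  "sbracket sl_h1 sl_y3 = - sl_y3" "sbracket sl_h2 sl_y3 = - sl_y3"
  "sbracket sl_x1 sl_y2 = 0" "sbracket sl_y3 sl_y2 = 0"
  "sbracket sl_x1 sl_x1 = 0" "sbracket sl_y3 sl_y3 = 0" "sbracket sl_y3 sl_x1 = sl_y2"
  "sbracket sl_x3 sl_y2 = sl_x1" "sbracket sl_x3 sl_x1 = 0" "sbracket sl_x3 sl_y3 = sl_h1 - sl_h2"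
  "sbracket sl_x2 sl_x1 = - sl_x3" "sbracket sl_x2 sl_y3 = sl_y1"
  "sbracket sl_y1 sl_y2 = - sl_y3" "sbracket sl_y1 sl_x1 = sl_h1" "sbracket sl_y1 sl_y3 = 0"
  by (rule Rep_sl12_inject[THEN iffD1], subst Rep_sbracket, (rule sl12_homog)+,
      simp add: sl12_rep_eqs matrix_matrix_mult_def mat_scale_def matrix_unit_def transpose_def
        koszul_sign_def vec_eq_iff forall_3 sum_3)+

lemma sl12_span: "x \<in> cspan {sl_x1, sl_x2, sl_x3, sl_y1, sl_y2, sl_y3, sl_h1, sl_h2}"
proof -
  define a where "a = Rep_sl12 x"
  have "x = cscale (a $ 1 $ 2) sl_x1 + cscale (a $ 2 $ 3) sl_x2 + cscale (a $ 1 $ 3) sl_x3 +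
      cscale (a $ 2 $ 1) sl_y1 + cscale (a $ 3 $ 2) sl_y2 + cscale (a $ 3 $ 1) sl_y3 +
      cscale (a $ 1 $ 1) sl_h1 + cscale (- (a $ 3 $ 3)) sl_h2"
    unfolding a_def by transfer (simp add: mat3_simps matrix_unit_def transpose_def algebra_simps)
  then show ?thesis
    by (rule ssubst) (intro lie.span_add lie.span_scale lie.span_base; simp)
qed

text \<open>The elements \<open>x\<^sub>1\<close>, \<open>y\<^sub>2\<close>, \<open>y\<^sub>3\<close> are root vectors.\<close>

lemma at_t_even_commute_scalar:
  assumes "h \<in> {sl_h1, sl_h2}" "e \<in> {sl_x1, sl_y2, sl_y3}"
  shows "\<exists>c. \<forall>r a. at_t h r * at_t e a = at_t e a * at_t h r + env_const c * at_t e (r + a)"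
proof -
  have h: "h \<in> homog 0" using assms(1) sl12_homog by auto
  obtain p where e: "e \<in> homog p" using assms(2) sl12_homog by blast
  have "\<exists>c. sbracket h e = cscale c e"
  proof -
    have scalars: "cscale (- 1) u = - u" "cscale (- 1 - 1) u = - (u + u)" "cscale 0 u = 0" for u :: sl12
      by (simp_all only: lie.scale_minus_left lie.scale_left_diff_distrib cscale_one) simp_all
    show ?thesis
      using assms by (elim insertE emptyE) (simp_all only: sl12_brackets, (rule exI, rule scalars[symmetric])+)
  qed
  then obtain c where "sbracket h e = cscale c e" by blast
  then show ?thesis
    using at_t_commute[OF h e] by (intro exI[of _ c]) (simp add: at_t_cscale)
qed

lemma Y2_Y2: "Y2 a * Y2 b = Y2 b * Y2 a"
  using at_t_commute[OF sl12_homog(6,6), of a b] by (simp add: sl12_brackets at_t_zero)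

lemma X1_Y2: "X1 a * Y2 b = Y2 b * X1 a"
  using at_t_commute[OF sl12_homog(1,6), of a b] by (simp add: sl12_brackets at_t_zero)

lemma Y3_Y2: "Y3 a * Y2 b = Y2 b * Y3 a"
  using at_t_commute[OF sl12_homog(4,6), of a b] by (simp add: sl12_brackets at_t_zero)

lemma X2_Y2: "X2 a * Y2 b = Y2 b * X2 a + H2 (a + b)"
  using at_t_commute[OF sl12_homog(5,6), of a b] by (simp add: sl12_brackets)

lemma X3_Y2: "X3 a * Y2 b = Y2 b * X3 a + X1 (a + b)"
  using at_t_commute[OF sl12_homog(2,6), of a b] by (simp add: sl12_brackets)

lemma Y1_Y2: "Y1 a * Y2 b = Y2 b * Y1 a - Y3 (a + b)"
  using at_t_commute[OF sl12_homog(3,6), of a b] by (simp add: sl12_brackets at_t_uminus)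

lemma H2_Y2: "H2 a * Y2 b = Y2 b * H2 a - 2 * Y2 (a + b)"
  using at_t_commute[OF sl12_homog(8,6), of a b] by (simp add: sl12_brackets at_t_uminus at_t_diff mult_2)

lemma X2_X1: "X2 a * X1 b = X1 b * X2 a - X3 (a + b)"
  using at_t_commute[OF sl12_homog(5,1), of a b] by (simp add: sl12_brackets at_t_uminus)

lemma H2_X1: "H2 a * X1 b = X1 b * H2 a - X1 (a + b)"
  using at_t_commute[OF sl12_homog(8,1), of a b] by (simp add: sl12_brackets at_t_uminus)

lemma X1_X1: "X1 a * X1 b = - (X1 b * X1 a)"
  using at_t_anticommute[OF sl12_homog(1,1), of a b] by (simp add: sl12_brackets at_t_zero)

lemma X3_X1: "X3 a * X1 b = - (X1 b * X3 a)"
  using at_t_anticommute[OF sl12_homog(2,1), of a b] by (simp add: sl12_brackets at_t_zero)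

lemma Y3_X1: "Y3 a * X1 b = - (X1 b * Y3 a) + Y2 (a + b)"
  using at_t_anticommute[OF sl12_homog(4,1), of a b] by (simp add: sl12_brackets)

lemma Y1_X1: "Y1 a * X1 b = - (X1 b * Y1 a) + H1 (a + b)"
  using at_t_anticommute[OF sl12_homog(3,1), of a b] by (simp add: sl12_brackets)

lemma Y3_Y3: "Y3 a * Y3 b = - (Y3 b * Y3 a)"
  using at_t_anticommute[OF sl12_homog(4,4), of a b] by (simp add: sl12_brackets at_t_zero)

lemma Y1_Y3: "Y1 a * Y3 b = - (Y3 b * Y1 a)"
  using at_t_anticommute[OF sl12_homog(3,4), of a b] by (simp add: sl12_brackets at_t_zero)

lemma X3_Y3: "X3 a * Y3 b = - (Y3 b * X3 a) + H1 (a + b) - H2 (a + b)"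
  using at_t_anticommute[OF sl12_homog(2,4), of a b] by (simp add: sl12_brackets at_t_diff)

lemma X2_Y3: "X2 a * Y3 b = Y3 b * X2 a + Y1 (a + b)"
  using at_t_commute[OF sl12_homog(5,4), of a b] by (simp add: sl12_brackets)

lemma H2_Y3: "H2 a * Y3 b = Y3 b * H2 a - Y3 (a + b)"
  using at_t_commute[OF sl12_homog(8,4), of a b] by (simp add: sl12_brackets at_t_uminus)

interpretation sl2: current_sl2 X2 H2 Y2
  by unfold_locales (rule X2_Y2 H2_Y2 Y2_Y2)+

interpretation X1: anticommuting X1 by unfold_locales (rule X1_X1)
interpretation Y3: anticommuting Y3 by unfold_locales (rule Y3_Y3)

section \<open>The filtration of the local Weyl module by the number of factors \<open>y\<^sub>3\<close>\<close>

abbreviation (input) Ymon where "Ymon as \<equiv> prod_list (map Y2 as)"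
abbreviation (input) Xmon where "Xmon bs \<equiv> prod_list (map X1 bs)"
abbreviation (input) Zmon where "Zmon cs \<equiv> prod_list (map Y3 cs)"

lemma Y2_Xmon: "Xmon bs * Y2 a = Y2 a * Xmon bs"
  by (induction bs) (simp_all add: mult.assoc, simp add: X1_Y2 flip: mult.assoc)

lemma Y2_Zmon: "Zmon cs * Y2 a = Y2 a * Zmon cs"
  by (induction cs) (simp_all add: mult.assoc, simp add: Y3_Y2 flip: mult.assoc)

lemma X1_Ymon: "X1 b * Ymon as = Ymon as * X1 b"
  by (induction as) (simp_all add: X1_Y2 flip: mult.assoc, simp add: mult.assoc)

locale local_weyl =
  fixes \<Lambda> :: weight
  assumes P_plus: "\<Lambda> \<in> P_plus"
begin

abbreviation J :: "sl12 current env set" where "J \<equiv> weyl_ideal \<Lambda>"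
abbreviation n :: nat where "n \<equiv> weight2 \<Lambda>"

lemma J_subspace: "env.subspace J"
  by (rule subspace_left_ideal[OF is_left_ideal_weyl_ideal])

lemma J_left: "u \<in> J \<Longrightarrow> r * u \<in> J"
  by (rule weyl_idealD(3))

lemma relations_J: "weyl_relations \<Lambda> \<subseteq> J"
  unfolding weyl_ideal_def by (rule hull_subset)

lemma raising_J:
  assumes "x \<in> {sl_y1, sl_x2, sl_x3}"
  shows "at_t x r \<in> J"
proof -
  have "Poly_Mapping.lookup (Poly_Mapping.single r x) m \<in> n_plus" for m
    unfolding n_plus_def using assms by (auto simp: lookup_single when_def intro: lie.span_base lie.span_zero)
  then have "at_t x r \<in> weyl_relations \<Lambda>"
    unfolding weyl_relations_def at_t_def by blast
  then show ?thesis using relations_J by blast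
qed

lemma cartan_J: "at_t (cscale a sl_h1 + cscale b sl_h2) r
    - (if r = 0 then env_const (a * fst \<Lambda> + b * snd \<Lambda>) else 0) \<in> J"
  by (rule subsetD[OF relations_J]) (unfold weyl_relations_def, blast)

lemma H2_J: "H2 r - (if r = 0 then of_nat n else 0) \<in> J"
proof -
  have "env_const (snd \<Lambda>) = (of_nat n :: sl12 current env)"
    by (simp only: of_nat_weight2[OF P_plus, symmetric] env_const_of_nat)
  then show ?thesis
    using cartan_J[of 0 1 r] by (simp add: cscale_one cong: if_cong)
qed

lemma H1_J: "H1 r - (if r = 0 then env_const (fst \<Lambda>) else 0) \<in> J"
  using cartan_J[of 1 0 r] by (simp add: cscale_one cong: if_cong)

lemma Y2_power_J: "Y2 0 ^ Suc n \<in> J"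
  using relations_J by (auto simp: weyl_relations_def)

text \<open>Here \<open>power_relation\<close> applies without error terms, since \<open>h\<^sub>2(r)\<close> kills the generator for \<open>r > 0\<close>.\<close>

lemma Y2_J:
  assumes "s \<ge> n"
  shows "Y2 s \<in> J"
proof -
  have "fps_nth (sl2.yser 0 ^ 1) s * 1 \<in> J"
  proof (rule sl2.power_relation[where L = "\<lambda>_ _. J" and N = "Suc n"])
    show "Y2 0 ^ j * 1 \<in> J" if "j \<ge> Suc n" for j
      using J_left[OF Y2_power_J, of "Y2 0 ^ (j - Suc n)"] that
      by (simp only: power_add[symmetric] le_add_diff_inverse2 mult_1_right)
    show "fps_nth (sl2.yser 0 ^ j) i * (H2 (Suc (s - i)) * 1) \<in> J" for j s i
      using J_left[OF H2_J[of "Suc (s - i)"]] by simp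
    show "fps_nth (sl2.yser 0 ^ Suc j) s * (X2 1 * 1) \<in> J" for j s
      using J_left[OF raising_J[of sl_x2 1]] by simp
  qed (use assms J_subspace J_left in auto)
  then show ?thesis by (simp add: sl2.yser_def)
qed

lemma Y3_J:
  assumes "s \<ge> n"
  shows "Y3 s \<in> J"
proof -
  have "Y3 s = Y2 s * Y1 0 - Y1 0 * Y2 s"
    by (simp add: Y1_Y2)
  then show ?thesis
    using J_left[OF Y2_J[OF assms]] J_left[OF raising_J[of sl_y1 0]] env.subspace_diff[OF J_subspace]
    by simp
qed

text \<open>The ideal is included so that membership in \<open>Lam l\<close> means membership of the class in the Weyl
module. It is the image of the \<open>l\<close>-th exterior power of the span of the \<open>y\<^sub>3(c)\<close>.\<close>

definition Lam :: "nat \<Rightarrow> sl12 current env set" where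
  "Lam l = env.span ({Zmon cs | cs. length cs = l} \<union> J)"

text \<open>The inequality is strict so that \<open>Fil 0\<close> is the ideal itself, that is, zero in the Weyl module.\<close>

definition Fil :: "nat \<Rightarrow> sl12 current env set" where
  "Fil l = env.span ({Ymon as * (Xmon bs * Zmon cs) | as bs cs. length cs < l} \<union> J)"

lemma Lam_subspace: "env.subspace (Lam l)" and Fil_subspace: "env.subspace (Fil l)"
  by (simp_all add: Lam_def Fil_def)

lemma J_Lam: "J \<subseteq> Lam l" and J_Fil: "J \<subseteq> Fil l"
  by (auto simp: Lam_def Fil_def intro: env.span_base)

lemma Zmon_Lam: "length cs = l \<Longrightarrow> Zmon cs \<in> Lam l"
  unfolding Lam_def by (rule env.span_base) blast

lemma monomial_Fil: "length cs < l \<Longrightarrow> Ymon as * (Xmon bs * Zmon cs) \<in> Fil l"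
  unfolding Fil_def by (rule env.span_base) blast

lemma Fil_mono: "l \<le> m \<Longrightarrow> Fil l \<subseteq> Fil m"
  unfolding Fil_def by (intro env.span_mono) force

lemma Fil_0: "Fil 0 = J"
  unfolding Fil_def using J_subspace by (simp add: env.span_eq_iff)

lemma mult_span_J:
  assumes "u \<in> env.span (A \<union> J)" "env.subspace S" "J \<subseteq> S" "\<And>a. a \<in> A \<Longrightarrow> r * a \<in> S"
  shows "r * u \<in> S"
  using assms J_left by (intro mult_span_subset[OF assms(2) _ assms(1)]) blast

lemma Lam_mult:
  assumes "u \<in> Lam l" "env.subspace S" "J \<subseteq> S" "\<And>cs. length cs = l \<Longrightarrow> r * Zmon cs \<in> S"
  shows "r * u \<in> S"
  using assms by (intro mult_span_J[OF assms(1)[unfolded Lam_def]]) auto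

lemma Fil_mult:
  assumes "u \<in> Fil l" "env.subspace S" "J \<subseteq> S"
    "\<And>as bs cs. length cs < l \<Longrightarrow> r * (Ymon as * (Xmon bs * Zmon cs)) \<in> S"
  shows "r * u \<in> S"
  using assms by (intro mult_span_J[OF assms(1)[unfolded Fil_def]]) auto

lemma Lam_Fil:
  assumes "k < l"
  shows "Lam k \<subseteq> Fil l"
  unfolding Lam_def
proof (rule env.span_minimal)
  show "{Zmon cs | cs. length cs = k} \<union> J \<subseteq> Fil l"
    using assms J_Fil monomial_Fil[of _ l "[]" "[]"] by auto
qed (rule Fil_subspace)

lemma Y3_Lam: "u \<in> Lam l \<Longrightarrow> Y3 c * u \<in> Lam (Suc l)"
  by (erule Lam_mult[OF _ Lam_subspace J_Lam]) (use Zmon_Lam[of "c # cs" "Suc l" for cs] in simp)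

lemma cartan_Zmon:
  assumes h: "h \<in> {sl_h1, sl_h2}"
  shows "at_t h r * Zmon cs \<in> Lam (length cs)"
proof (induction cs arbitrary: r)
  case Nil
  have "\<exists>c. at_t h r - env_const c \<in> J"
  proof (cases "h = sl_h1")
    case True
    then show ?thesis
      using H1_J[of r] by (intro exI[of _ "if r = 0 then fst \<Lambda> else 0"]) (simp add: env_const_zero split: if_splits)
  next
    case False
    with h have "h = sl_h2" by simp
    then show ?thesis
      using H2_J[of r]
      by (intro exI[of _ "if r = 0 then of_nat n else 0"]) (simp add: env_const_zero env_const_of_nat split: if_splits)
  qed
  then obtain c where "at_t h r - env_const c \<in> J" by blast
  moreover have "env_const c * 1 \<in> Lam 0"
    using Zmon_Lam[of "[]"] by (intro env.subspace_scale[OF Lam_subspace]) simp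
  ultimately have "(at_t h r - env_const c) + env_const c \<in> Lam 0"
    using J_Lam by (intro env.subspace_add[OF Lam_subspace]) auto
  then show ?case by simp
next
  case (Cons c cs)
  obtain d where "at_t h r * Y3 c = Y3 c * at_t h r + env_const d * Y3 (r + c)"
    using at_t_even_commute_scalar[OF h, of sl_y3] by auto
  then have "at_t h r * Zmon (c # cs) = Y3 c * (at_t h r * Zmon cs) + env_const d * Zmon ((r + c) # cs)"
    by (simp add: distrib_right mult.assoc flip: mult.assoc[of "at_t h r"])
  moreover have "Y3 c * (at_t h r * Zmon cs) \<in> Lam (length (c # cs))"
    using Y3_Lam[OF Cons.IH] by simp
  moreover have "env_const d * Zmon ((r + c) # cs) \<in> Lam (length (c # cs))"
    by (intro env.subspace_scale[OF Lam_subspace] Zmon_Lam) simp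
  ultimately show ?case by (simp only: env.subspace_add[OF Lam_subspace])
qed

lemma cartan_Lam: "h \<in> {sl_h1, sl_h2} \<Longrightarrow> u \<in> Lam l \<Longrightarrow> at_t h r * u \<in> Lam l"
  by (erule Lam_mult[OF _ Lam_subspace J_Lam]) (use cartan_Zmon in blast)

lemma Y1_Zmon: "Y1 r * Zmon cs \<in> J"
proof (induction cs)
  case Nil
  show ?case using raising_J[of sl_y1 r] by simp
next
  case (Cons c cs)
  have "Y1 r * Zmon (c # cs) = - (Y3 c * (Y1 r * Zmon cs))"
    by (simp add: Y1_Y3 flip: mult.assoc)
  with J_left[OF Cons.IH] show ?case
    by (simp add: env.subspace_neg[OF J_subspace])
qed

text \<open>As \<open>[x\<^sub>2, y\<^sub>3] = y\<^sub>1\<close>, this follows from the vanishing of the \<open>y\<^sub>1(r)\<close> on products of \<open>y\<^sub>3\<close>.\<close>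

lemma X2_Zmon: "X2 r * Zmon cs \<in> J"
proof (induction cs arbitrary: r)
  case Nil
  show ?case using raising_J[of sl_x2 r] by simp
next
  case (Cons c cs)
  have "X2 r * Zmon (c # cs) = Y3 c * (X2 r * Zmon cs) + Y1 (r + c) * Zmon cs"
    by (simp add: X2_Y3 distrib_right flip: mult.assoc)
  with J_left[OF Cons.IH] Y1_Zmon show ?case
    by (simp add: env.subspace_add[OF J_subspace])
qed

lemma X2_Lam: "u \<in> Lam l \<Longrightarrow> X2 r * u \<in> J"
  by (erule Lam_mult[OF _ J_subspace order.refl]) (rule X2_Zmon)

text \<open>The bracket \<open>[x\<^sub>3, y\<^sub>3]\<close> lies in the Cartan subalgebra, so one factor is lost.\<close>

lemma X3_Zmon: "length cs = Suc l \<Longrightarrow> X3 r * Zmon cs \<in> Lam l"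
proof (induction l arbitrary: cs r)
  case 0
  then obtain c where cs: "cs = [c]" by (auto simp: length_Suc_conv)
  have "X3 r * Zmon cs = - (Y3 c * X3 r) + (H1 (r + c) * Zmon [] - H2 (r + c) * Zmon [])"
    by (simp add: cs X3_Y3)
  moreover have "- (Y3 c * X3 r) \<in> Lam 0"
    using J_Lam J_left[OF raising_J[of sl_x3 r]] env.subspace_neg[OF J_subspace] by blast
  moreover have "H1 (r + c) * Zmon [] - H2 (r + c) * Zmon [] \<in> Lam 0"
    using cartan_Zmon[of _ _ "[]"] by (intro env.subspace_diff[OF Lam_subspace]) auto
  ultimately show ?case by (simp only: env.subspace_add[OF Lam_subspace])
next
  case (Suc l)
  then obtain c ds where cs: "cs = c # ds" "length ds = Suc l" by (auto simp: length_Suc_conv)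
  have "X3 r * Zmon cs = - (Y3 c * (X3 r * Zmon ds)) + (H1 (r + c) * Zmon ds - H2 (r + c) * Zmon ds)"
    by (simp add: cs X3_Y3 left_diff_distrib distrib_right flip: mult.assoc)
  moreover have "- (Y3 c * (X3 r * Zmon ds)) \<in> Lam (Suc l)"
    using Suc.IH[OF cs(2)] by (intro env.subspace_neg[OF Lam_subspace] Y3_Lam)
  moreover have "H1 (r + c) * Zmon ds - H2 (r + c) * Zmon ds \<in> Lam (Suc l)"
    using cartan_Zmon[of _ _ ds] cs(2) by (intro env.subspace_diff[OF Lam_subspace]) auto
  ultimately show ?case by (simp only: env.subspace_add[OF Lam_subspace])
qed

lemma X3_Lam_Suc: "u \<in> Lam (Suc l) \<Longrightarrow> X3 r * u \<in> Lam l"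
  by (erule Lam_mult[OF _ Lam_subspace J_Lam]) (rule X3_Zmon)

lemma X3_Lam: "u \<in> Lam l \<Longrightarrow> X3 r * u \<in> Fil l"
proof (cases l)
  case 0
  then show "u \<in> Lam l \<Longrightarrow> X3 r * u \<in> Fil l"
    using raising_J[of sl_x3 r] J_Fil by (elim Lam_mult[OF _ Fil_subspace J_Fil]) auto
next
  case (Suc k)
  then show "u \<in> Lam l \<Longrightarrow> X3 r * u \<in> Fil l"
    using X3_Lam_Suc Lam_Fil[of k l] by auto
qed

lemma weight_Zmon: "(H2 0 + of_nat (length cs) - of_nat n) * Zmon cs \<in> J"
proof (induction cs)
  case Nil
  show ?case using H2_J[of 0] by simp
next
  case (Cons c cs)
  have H: "H2 0 * (Y3 c * Zmon cs) = Y3 c * (H2 0 * Zmon cs) - Y3 c * Zmon cs"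
    using H2_Y3[of 0 c] by (simp add: left_diff_distrib flip: mult.assoc)
  have "(H2 0 + of_nat (length (c # cs)) - of_nat n) * Zmon (c # cs) =
      Y3 c * ((H2 0 + of_nat (length cs) - of_nat n) * Zmon cs)"
    by (simp add: left_diff_distrib right_diff_distrib distrib_left distrib_right mult.assoc H of_nat_left_commute)
  then show ?case using J_left[OF Cons.IH] by simp
qed

lemma weight_Lam: "u \<in> Lam l \<Longrightarrow> (H2 0 + of_nat l - of_nat n) * u \<in> J"
  by (erule Lam_mult[OF _ J_subspace order.refl]) (use weight_Zmon in blast)

lemma Y2_power_commute:
  assumes "\<And>a. u * Y2 a = Y2 a * u"
  shows "Y2 0 ^ k * u = u * Y2 0 ^ k"
  using power_commuting_commutes[of "Y2 0" u k] assms[of 0] by simp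

lemma nilpotent_Lam: "u \<in> Lam l \<Longrightarrow> Y2 0 ^ Suc n * u \<in> J"
  by (erule Lam_mult[OF _ J_subspace order.refl])
    (simp only: Y2_power_commute[OF Y2_Zmon] J_left[OF Y2_power_J])


lemma Y2_Fil: "u \<in> Fil l \<Longrightarrow> Y2 a * u \<in> Fil l"
  by (erule Fil_mult[OF _ Fil_subspace J_Fil])
    (use monomial_Fil[of _ l "a # as" bs for as bs] in \<open>simp add: mult.assoc\<close>)

lemma X1_Fil: "u \<in> Fil l \<Longrightarrow> X1 b * u \<in> Fil l"
proof (erule Fil_mult[OF _ Fil_subspace J_Fil])
  fix as bs cs :: "nat list"
  assume "length cs < l"
  then show "X1 b * (Ymon as * (Xmon bs * Zmon cs)) \<in> Fil l"
    using monomial_Fil[of cs l as "b # bs"] X1_Ymon[of b as] by (simp flip: mult.assoc)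
qed

text \<open>To see where an element of the current algebra sends \<open>Fil l\<close>, it is enough to move it past a single
factor at a time.\<close>

lemma Fil_closed:
  assumes u: "u \<in> Fil l" and S: "env.subspace S" "J \<subseteq> S"
    and Z: "\<And>r cs. length cs < l \<Longrightarrow> at_t x r * Zmon cs \<in> S"
    and X: "\<And>r b u. u \<in> Fil l \<Longrightarrow> (\<And>r. at_t x r * u \<in> S) \<Longrightarrow> at_t x r * (X1 b * u) \<in> S"
    and Y: "\<And>r a u. u \<in> Fil l \<Longrightarrow> (\<And>r. at_t x r * u \<in> S) \<Longrightarrow> at_t x r * (Y2 a * u) \<in> S"
  shows "at_t x r * u \<in> S"
proof (rule Fil_mult[OF u S])
  fix as bs cs :: "nat list"
  assume l: "length cs < l"
  have XZ: "Xmon bs * Zmon cs \<in> Fil l \<and> (\<forall>r. at_t x r * (Xmon bs * Zmon cs) \<in> S)"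
  proof (induction bs)
    case Nil
    show ?case using Z[OF l] Lam_Fil[OF l] Zmon_Lam[of cs] by auto
  next
    case (Cons b bs)
    then show ?case using X by (simp add: mult.assoc X1_Fil)
  qed
  have "Ymon as * (Xmon bs * Zmon cs) \<in> Fil l \<and> (\<forall>r. at_t x r * (Ymon as * (Xmon bs * Zmon cs)) \<in> S)"
  proof (induction as)
    case Nil
    show ?case using XZ by simp
  next
    case (Cons a as)
    then show ?case using Y by (simp add: mult.assoc Y2_Fil)
  qed
  then show "at_t x r * (Ymon as * (Xmon bs * Zmon cs)) \<in> S" by blast
qed

lemma cartan_Fil:
  assumes h: "h \<in> {sl_h1, sl_h2}" and "u \<in> Fil l"
  shows "at_t h r * u \<in> Fil l"
proof (rule Fil_closed[OF assms(2) Fil_subspace J_Fil])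
  have step: "at_t h r * (at_t e a * u) \<in> Fil l"
    if e: "e \<in> {sl_x1, sl_y2}" and u: "at_t e a * (at_t h r * u) \<in> Fil l" "\<And>b. at_t e b * u \<in> Fil l" for e r a u
  proof -
    obtain c where "at_t h r * at_t e a = at_t e a * at_t h r + env_const c * at_t e (r + a)"
      using at_t_even_commute_scalar[OF h, of e] e by auto
    from arg_cong[OF this, of "\<lambda>z. z * u"]
    have "at_t h r * (at_t e a * u) = at_t e a * (at_t h r * u) + env_const c * (at_t e (r + a) * u)"
      by (simp only: distrib_right mult.assoc)
    then show ?thesis
      using u by (simp only: env.subspace_add[OF Fil_subspace] env.subspace_scale[OF Fil_subspace])
  qed
  show "at_t h r * Zmon cs \<in> Fil l" if "length cs < l" for r cs
    using cartan_Zmon[OF h] Lam_Fil[OF that] by blast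
  show "at_t h r * (X1 b * u) \<in> Fil l" if "u \<in> Fil l" "\<And>r. at_t h r * u \<in> Fil l" for r b u
    using that by (intro step) (auto intro: X1_Fil)
  show "at_t h r * (Y2 a * u) \<in> Fil l" if "u \<in> Fil l" "\<And>r. at_t h r * u \<in> Fil l" for r a u
    using that by (intro step) (auto intro: Y2_Fil)
qed

lemma X3_Fil:
  assumes "u \<in> Fil l"
  shows "X3 r * u \<in> Fil l"
proof (rule Fil_closed[OF assms Fil_subspace J_Fil])
  show "X3 r * Zmon cs \<in> Fil l" if "length cs < l" for r cs
    using X3_Lam[OF Zmon_Lam[OF refl]] Fil_mono[of "length cs" l] that by auto
  show "X3 r * (X1 b * u) \<in> Fil l" if "\<And>r. X3 r * u \<in> Fil l" for r b u
  proof -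
    have "X3 r * (X1 b * u) = - (X1 b * (X3 r * u))"
      by (simp add: X3_X1 flip: mult.assoc)
    then show ?thesis using that by (simp only: env.subspace_neg[OF Fil_subspace] X1_Fil)
  qed
  show "X3 r * (Y2 a * u) \<in> Fil l" if "u \<in> Fil l" "\<And>r. X3 r * u \<in> Fil l" for r a u
  proof -
    have "X3 r * (Y2 a * u) = Y2 a * (X3 r * u) + X1 (r + a) * u"
      by (simp add: X3_Y2 distrib_right flip: mult.assoc)
    then show ?thesis using that by (simp only: env.subspace_add[OF Fil_subspace] X1_Fil Y2_Fil)
  qed
qed

lemma X2_Fil:
  assumes "u \<in> Fil l"
  shows "X2 r * u \<in> Fil l"
proof (rule Fil_closed[OF assms Fil_subspace J_Fil])
  show "X2 r * Zmon cs \<in> Fil l" for r cs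
    using X2_Zmon J_Fil by blast
  show "X2 r * (X1 b * u) \<in> Fil l" if "u \<in> Fil l" "\<And>r. X2 r * u \<in> Fil l" for r b u
  proof -
    have "X2 r * (X1 b * u) = X1 b * (X2 r * u) - X3 (r + b) * u"
      by (simp add: X2_X1 left_diff_distrib flip: mult.assoc)
    then show ?thesis using that by (simp only: env.subspace_diff[OF Fil_subspace] X1_Fil X3_Fil)
  qed
  show "X2 r * (Y2 a * u) \<in> Fil l" if "u \<in> Fil l" "\<And>r. X2 r * u \<in> Fil l" for r a u
  proof -
    have "X2 r * (Y2 a * u) = Y2 a * (X2 r * u) + H2 (r + a) * u"
      by (simp add: X2_Y2 distrib_right flip: mult.assoc)
    then show ?thesis
      using that cartan_Fil[of sl_h2 u] by (simp add: env.subspace_add[OF Fil_subspace] Y2_Fil)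
  qed
qed

lemma Y3_Fil:
  assumes "u \<in> Fil l"
  shows "Y3 r * u \<in> Fil (Suc l)"
proof (rule Fil_closed[OF assms Fil_subspace J_Fil])
  note mono = subsetD[OF Fil_mono[of l "Suc l", simplified]]
  show "Y3 r * Zmon cs \<in> Fil (Suc l)" if "length cs < l" for r cs
    using monomial_Fil[of "r # cs" "Suc l" "[]" "[]"] that by simp
  show "Y3 r * (X1 b * u) \<in> Fil (Suc l)" if "u \<in> Fil l" "\<And>r. Y3 r * u \<in> Fil (Suc l)" for r b u
  proof -
    have "Y3 r * (X1 b * u) = - (X1 b * (Y3 r * u)) + Y2 (r + b) * u"
      by (simp add: Y3_X1 left_diff_distrib flip: mult.assoc)
    then show ?thesis
      using that by (simp only: env.subspace_add[OF Fil_subspace] env.subspace_neg[OF Fil_subspace] X1_Fil Y2_Fil mono)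
  qed
  show "Y3 r * (Y2 a * u) \<in> Fil (Suc l)" if "\<And>r. Y3 r * u \<in> Fil (Suc l)" for r a u
  proof -
    have "Y3 r * (Y2 a * u) = Y2 a * (Y3 r * u)"
      by (simp add: Y3_Y2 flip: mult.assoc)
    then show ?thesis using that by (simp only: Y2_Fil)
  qed
qed

lemma Y1_Fil:
  assumes "u \<in> Fil l"
  shows "Y1 r * u \<in> Fil (Suc l)"
proof (rule Fil_closed[OF assms Fil_subspace J_Fil])
  note mono = subsetD[OF Fil_mono[of l "Suc l", simplified]]
  show "Y1 r * Zmon cs \<in> Fil (Suc l)" for r cs
    using Y1_Zmon J_Fil by blast
  show "Y1 r * (X1 b * u) \<in> Fil (Suc l)" if "u \<in> Fil l" "\<And>r. Y1 r * u \<in> Fil (Suc l)" for r b u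
  proof -
    have "Y1 r * (X1 b * u) = - (X1 b * (Y1 r * u)) + H1 (r + b) * u"
      by (simp add: Y1_X1 left_diff_distrib flip: mult.assoc)
    moreover have "H1 (r + b) * u \<in> Fil (Suc l)"
      by (intro mono cartan_Fil that) simp
    ultimately show ?thesis
      using that by (simp only: env.subspace_add[OF Fil_subspace] env.subspace_neg[OF Fil_subspace] X1_Fil)
  qed
  show "Y1 r * (Y2 a * u) \<in> Fil (Suc l)" if "u \<in> Fil l" "\<And>r. Y1 r * u \<in> Fil (Suc l)" for r a u
  proof -
    have "Y1 r * (Y2 a * u) = Y2 a * (Y1 r * u) - Y3 (r + a) * u"
      by (simp add: Y1_Y2 left_diff_distrib flip: mult.assoc)
    then show ?thesis using that by (simp only: env.subspace_diff[OF Fil_subspace] Y2_Fil Y3_Fil)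
  qed
qed

lemma at_t_Fil:
  assumes "u \<in> Fil l"
  shows "at_t x r * u \<in> Fil (Suc l)"
proof -
  have mono: "v \<in> Fil (Suc l)" if "v \<in> Fil l" for v
    using that Fil_mono[of l "Suc l"] by auto
  from sl12_span[of x] show ?thesis
  proof (induction rule: lie.span_induct)
    case base
    show ?case
      using env.subspace_0[OF Fil_subspace] env.subspace_add[OF Fil_subspace] env.subspace_scale[OF Fil_subspace]
      by (auto simp: lie.subspace_def at_t_add at_t_zero at_t_cscale distrib_right mult.assoc)
  next
    case (step x)
    then show ?case
      using assms X1_Fil X2_Fil X3_Fil Y1_Fil Y2_Fil Y3_Fil cartan_Fil mono by auto
  qed
qed

text \<open>This replaces the easy half of the theorem of Poincare, Birkhoff and Witt: the union of the \<open>Fil l\<close>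
contains \<open>1\<close> and is stable under multiplication by generators.\<close>

lemma Fil_exhaust: "\<exists>l. u \<in> Fil l"
proof -
  have "\<exists>m. \<forall>v\<in>Fil l. u * v \<in> Fil m" for l
  proof (induction u arbitrary: l rule: env_induct)
    case (const c)
    then show ?case using env.subspace_scale[OF Fil_subspace] by blast
  next
    case (gen f)
    have "env_gen f * v \<in> Fil (Suc l)" if v: "v \<in> Fil l" for v
    proof (induction f rule: poly_mapping_add_single_induct)
      case 1
      have "env_gen 0 = (0 :: sl12 current env)" using env_gen_add[of 0 "0 :: sl12 current"] by simp
      then show ?case by (simp add: env.subspace_0[OF Fil_subspace])
    next
      case (2 f k x)
      then show ?case
        using at_t_Fil[OF v] by (simp add: env_gen_add distrib_right env.subspace_add[OF Fil_subspace] flip: at_t_def)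
    qed
    then show ?case by blast
  next
    case (add u w)
    then obtain m k where "\<forall>v\<in>Fil l. u * v \<in> Fil m" "\<forall>v\<in>Fil l. w * v \<in> Fil k" by meson
    then have "\<forall>v\<in>Fil l. (u + w) * v \<in> Fil (max m k)"
      using Fil_mono[of m "max m k"] Fil_mono[of k "max m k"]
      by (auto simp: distrib_right intro!: env.subspace_add[OF Fil_subspace])
    then show ?case by blast
  next
    case (mult u w)
    then obtain k where k: "\<forall>v\<in>Fil l. w * v \<in> Fil k" by meson
    from mult obtain m where "\<forall>v\<in>Fil k. u * v \<in> Fil m" by meson
    with k have "\<forall>v\<in>Fil l. u * w * v \<in> Fil m" by (simp add: mult.assoc)
    then show ?case by blast
  qed
  from this[of 1] obtain m where "\<forall>v\<in>Fil 1. u * v \<in> Fil m" by blast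
  moreover have "1 \<in> Fil 1" using monomial_Fil[of "[]" 1 "[]" "[]"] by simp
  ultimately show ?thesis by force
qed

end

section \<open>Straightening\<close>

context local_weyl begin

lemma span_J: "env.span J = J" and span_Fil: "env.span (Fil l) = Fil l"
  using J_subspace Fil_subspace by (simp_all add: env.span_eq_iff)

lemma Zmon_straighten:
  "Zmon cs \<in> env.span ({Zmon ds | ds. length ds = length cs \<and> sorted_wrt (<) ds \<and> (\<forall>c\<in>set ds. c < n)} \<union> J)"
proof -
  have "Zmon cs * 1 \<in> env.span ({Zmon ds * w | ds w. length ds = length cs \<and> sorted_wrt (<) ds \<and>
      (\<forall>c\<in>set ds. c < n) \<and> w \<in> {1}} \<union> J)"
  proof (rule Y3.wedge_straighten[OF J_subspace J_left])
    show "Y3 s * v \<in> env.span ({Y3 a * w | a w. a < n \<and> w \<in> {1}} \<union> J)" if "v \<in> {1}" for v s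
      using that Y3_J[of s] by (cases "s < n") (auto intro: env.span_base)
  qed simp_all
  then show ?thesis by simp
qed

text \<open>A strictly increasing list of numbers below \<open>n\<close> has length at most \<open>n\<close>.\<close>

lemma Lam_vanish:
  assumes "l > n"
  shows "Lam l \<subseteq> J"
  unfolding Lam_def
proof (rule env.span_minimal[OF _ J_subspace])
  have "Zmon cs \<in> J" if "length cs = l" for cs
  proof -
    have "\<not> (length ds = length cs \<and> sorted_wrt (<) ds \<and> (\<forall>c\<in>set ds. c < n))" for ds
    proof
      assume ds: "length ds = length cs \<and> sorted_wrt (<) ds \<and> (\<forall>c\<in>set ds. c < n)"
      then have "length ds = card (set ds)"
        by (simp add: distinct_card strict_sorted_iff)
      also have "\<dots> \<le> card {..<n}"
        using ds by (intro card_mono) auto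
      finally show False using ds that assms by simp
    qed
    then have "{Zmon ds | ds. length ds = length cs \<and> sorted_wrt (<) ds \<and> (\<forall>c\<in>set ds. c < n)} = {}"
      by blast
    with Zmon_straighten[of cs] have "Zmon cs \<in> env.span ({} \<union> J)"
      by (simp only:)
    then show ?thesis by (simp add: span_J)
  qed
  then show "{Zmon cs | cs. length cs = l} \<union> J \<subseteq> J" by blast
qed

text \<open>Since \<open>x\<^sub>1(s) = [x\<^sub>3(0), y\<^sub>2(s)]\<close>, this comes from \<open>ymon_box\<close> for a single factor \<open>y\<^sub>2(s)\<close>. The other
half of each commutator lies in \<open>Fil l\<close>, because \<open>x\<^sub>3(0)\<close> removes a factor \<open>y\<^sub>3\<close>.\<close>

lemma X1_reduce:
  assumes v: "v \<in> Lam l"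
  shows "X1 s * v \<in> env.span ({X1 a * w | a w. a < n - l \<and> w \<in> Lam l} \<union> Fil l)"
proof (cases "l > n")
  case True
  then have "X1 s * v \<in> Fil l"
    using v Lam_vanish J_left J_Fil by blast
  then show ?thesis by (simp add: env.span_base)
next
  case False
  let ?S = "env.span ({X1 a * w | a w. a < n - l \<and> w \<in> Lam l} \<union> Fil l)"
  have Fil_S: "Fil l \<subseteq> ?S" by (auto intro: env.span_base)
  interpret low: current_sl2_lowering X2 H2 Y2 J "Lam l" "n - l" "Suc n"
  proof unfold_locales
    show "(H2 0 - of_nat (n - l)) * u \<in> J" if "u \<in> Lam l" for u
      using weight_Lam[OF that] False by (simp add: of_nat_diff diff_diff_eq2)
  qed (use J_subspace Lam_subspace J_Lam J_left X2_Lam cartan_Lam[of sl_h2] nilpotent_Lam in auto)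
  have X1_eq: "X1 t * u = X3 0 * (Y2 t * u) - Y2 t * (X3 0 * u)" for t u
    by (simp add: X3_Y2 distrib_right flip: mult.assoc)
  have swap: "X3 0 * (Y2 t * w) \<in> ?S" if "t < n - l" "w \<in> Lam l" for t w
  proof -
    have "X1 t * w \<in> ?S" using that by (intro env.span_base) blast
    moreover have "Y2 t * (X3 0 * w) \<in> ?S"
      using that Fil_S Y2_Fil X3_Lam by blast
    ultimately have "X1 t * w + Y2 t * (X3 0 * w) \<in> ?S" by (rule env.span_add)
    then show ?thesis by (simp add: X1_eq)
  qed
  have "Y2 s * v \<in> env.span ({Y2 a * w | a w. a < n - l \<and> w \<in> Lam l} \<union> J)"
  proof -
    have "{sl2.ymon as * w | as w. length as = length [s] \<and> (\<forall>a\<in>set as. a < Suc (n - l) - length [s]) \<and> w \<in> Lam l}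
        \<subseteq> {Y2 a * w | a w. a < n - l \<and> w \<in> Lam l}"
    proof
      fix u assume "u \<in> {sl2.ymon as * w | as w. length as = length [s] \<and>
        (\<forall>a\<in>set as. a < Suc (n - l) - length [s]) \<and> w \<in> Lam l}"
      then obtain as w where u: "u = sl2.ymon as * w" "length as = Suc 0" "\<forall>a\<in>set as. a < n - l" "w \<in> Lam l"
        by auto
      then obtain a where "as = [a]" by (auto simp: length_Suc_conv)
      with u show "u \<in> {Y2 a * w | a w. a < n - l \<and> w \<in> Lam l}" by auto
    qed
    from env.span_mono[OF Un_mono[OF this order.refl]] low.ymon_box[OF v, of "[s]"]
    have "sl2.ymon [s] * v \<in> env.span ({Y2 a * w | a w. a < n - l \<and> w \<in> Lam l} \<union> J)"
      by (rule subsetD)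
    then show ?thesis by simp
  qed
  then have "X3 0 * (Y2 s * v) \<in> ?S"
  proof (rule mult_span_J)
    show "J \<subseteq> ?S" using J_Fil Fil_S by (rule subset_trans)
    show "X3 0 * u \<in> ?S" if "u \<in> {Y2 a * w | a w. a < n - l \<and> w \<in> Lam l}" for u
      using that swap by blast
  qed simp
  moreover have "Y2 s * (X3 0 * v) \<in> ?S"
    using v Fil_S Y2_Fil X3_Lam by blast
  ultimately show ?thesis unfolding X1_eq by (rule env.span_diff)
qed

lemma Xmon_straighten:
  assumes "v \<in> Lam l"
  shows "Xmon bs * v \<in> env.span ({Xmon ds * w | ds w. length ds = length bs \<and> sorted_wrt (<) ds \<and>
    (\<forall>b\<in>set ds. b < n - l) \<and> w \<in> Lam l} \<union> Fil l)"
  by (rule X1.wedge_straighten[OF Fil_subspace X1_Fil X1_reduce assms])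

lemma X3_Xmon_Lam: "v \<in> Lam l \<Longrightarrow> X3 r * (Xmon bs * v) \<in> Fil l"
proof (induction bs)
  case (Cons b bs)
  have "X3 r * (Xmon (b # bs) * v) = - (X1 b * (X3 r * (Xmon bs * v)))"
    by (simp add: X3_X1 flip: mult.assoc)
  with Cons show ?case by (simp only: env.subspace_neg[OF Fil_subspace] X1_Fil)
qed (simp add: X3_Lam)

lemma X2_Xmon_Lam: "v \<in> Lam l \<Longrightarrow> X2 r * (Xmon bs * v) \<in> Fil l"
proof (induction bs)
  case Nil
  then show ?case by (simp add: subsetD[OF J_Fil] X2_Lam)
next
  case (Cons b bs)
  have "X2 r * (Xmon (b # bs) * v) = X1 b * (X2 r * (Xmon bs * v)) - X3 (r + b) * (Xmon bs * v)"
    by (simp add: X2_X1 left_diff_distrib flip: mult.assoc)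
  with Cons show ?case by (simp only: env.subspace_diff[OF Fil_subspace] X1_Fil X3_Xmon_Lam)
qed

text \<open>Modulo \<open>Fil l\<close>, these are vectors of weight \<open>n - l - k\<close> for \<open>h\<^sub>2\<close> that are killed by the \<open>x\<^sub>2(r)\<close>.\<close>

definition XLam :: "nat \<Rightarrow> nat \<Rightarrow> sl12 current env set" where
  "XLam k l = env.span ({Xmon bs * v | bs v. length bs = k \<and> v \<in> Lam l} \<union> Fil l)"

lemma XLam_subspace: "env.subspace (XLam k l)" and Fil_XLam: "Fil l \<subseteq> XLam k l"
  by (auto simp: XLam_def intro: env.span_base)

lemma Xmon_XLam: "length bs = k \<Longrightarrow> v \<in> Lam l \<Longrightarrow> Xmon bs * v \<in> XLam k l"
  unfolding XLam_def by (rule env.span_base) blast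

lemma XLam_mult:
  assumes "u \<in> XLam k l" "env.subspace S" "\<And>v. v \<in> Fil l \<Longrightarrow> r * v \<in> S"
    "\<And>bs v. length bs = k \<Longrightarrow> v \<in> Lam l \<Longrightarrow> r * (Xmon bs * v) \<in> S"
  shows "r * u \<in> S"
  using assms by (intro mult_span_subset[OF assms(2) _ assms(1)[unfolded XLam_def]]) auto

lemma H2_Xmon_Lam: "v \<in> Lam l \<Longrightarrow> H2 r * (Xmon bs * v) \<in> XLam (length bs) l"
proof (induction bs arbitrary: r)
  case Nil
  then show ?case using Xmon_XLam[of "[]" 0 "H2 r * v" l] cartan_Lam[of sl_h2 v l r] by simp
next
  case (Cons b bs)
  have X1_XLam: "X1 b * u \<in> XLam (Suc k) l" if "u \<in> XLam k l" for u k
    using that XLam_subspace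
  proof (rule XLam_mult)
    show "X1 b * v \<in> XLam (Suc k) l" if "v \<in> Fil l" for v
      using X1_Fil[OF that] Fil_XLam by blast
    show "X1 b * (Xmon bs * v) \<in> XLam (Suc k) l" if "length bs = k" "v \<in> Lam l" for bs v
      using Xmon_XLam[of "b # bs" "Suc k" v l] that by (simp add: mult.assoc)
  qed
  have "H2 r * (Xmon (b # bs) * v) = X1 b * (H2 r * (Xmon bs * v)) - Xmon ((r + b) # bs) * v"
    by (simp add: H2_X1 left_diff_distrib flip: mult.assoc)
  moreover have "X1 b * (H2 r * (Xmon bs * v)) \<in> XLam (length (b # bs)) l"
    using X1_XLam[OF Cons.IH[OF Cons.prems]] by simp
  moreover have "Xmon ((r + b) # bs) * v \<in> XLam (length (b # bs)) l"
    by (rule Xmon_XLam) (use Cons.prems in simp_all)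
  ultimately show ?case by (simp only: env.subspace_diff[OF XLam_subspace])
qed

lemma weight_Xmon_Lam: "v \<in> Lam l \<Longrightarrow> (H2 0 + of_nat (l + length bs) - of_nat n) * (Xmon bs * v) \<in> Fil l"
proof (induction bs)
  case Nil
  then show ?case using weight_Lam J_Fil by auto
next
  case (Cons b bs)
  have H: "H2 0 * (X1 b * u) = X1 b * (H2 0 * u) - X1 b * u" for u
    using H2_X1[of 0 b] by (simp add: left_diff_distrib flip: mult.assoc)
  have "(H2 0 + of_nat (l + length (b # bs)) - of_nat n) * (Xmon (b # bs) * v) =
      X1 b * ((H2 0 + of_nat (l + length bs) - of_nat n) * (Xmon bs * v))"
    by (simp add: left_diff_distrib right_diff_distrib distrib_left distrib_right mult.assoc H of_nat_left_commute)
  then show ?case using X1_Fil[OF Cons.IH[OF Cons.prems]] by simp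
qed

lemma Ymon_Fil: "u \<in> Fil l \<Longrightarrow> Ymon as * u \<in> Fil l"
  by (induction as) (simp_all add: mult.assoc Y2_Fil)

lemma Ymon_box:
  assumes "k + l \<le> n" "u \<in> XLam k l"
  shows "Ymon as * u \<in> env.span ({Ymon ds * v | ds v. length ds = length as \<and>
    (\<forall>a\<in>set ds. a < Suc (n - l - k) - length as) \<and> v \<in> XLam k l} \<union> Fil l)"
proof -
  interpret low: current_sl2_lowering X2 H2 Y2 "Fil l" "XLam k l" "n - l - k" "Suc n"
  proof unfold_locales
    show "X2 r * v \<in> Fil l" if "v \<in> XLam k l" for v r
      using that Fil_subspace by (rule XLam_mult) (use X2_Fil X2_Xmon_Lam in auto)
    show "H2 r * v \<in> XLam k l" if "v \<in> XLam k l" for v r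
      using that XLam_subspace
    proof (rule XLam_mult)
      show "H2 r * v \<in> XLam k l" if "v \<in> Fil l" for v
        using cartan_Fil[of sl_h2 v l r] that Fil_XLam by blast
    qed (use H2_Xmon_Lam in auto)
    show "(H2 0 - of_nat (n - l - k)) * v \<in> Fil l" if "v \<in> XLam k l" for v
      using that Fil_subspace
    proof (rule XLam_mult)
      show "(H2 0 - of_nat (n - l - k)) * v \<in> Fil l" if "v \<in> Fil l" for v
        using cartan_Fil[of sl_h2 v l 0] that subspace_of_nat[OF Fil_subspace that]
        by (simp add: left_diff_distrib env.subspace_diff[OF Fil_subspace])
      show "(H2 0 - of_nat (n - l - k)) * (Xmon bs * v) \<in> Fil l" if "length bs = k" "v \<in> Lam l" for bs v
        using weight_Xmon_Lam[OF that(2), of bs] that(1) assms(1) by (simp add: of_nat_diff algebra_simps)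
    qed
    show "Y2 0 ^ Suc n * v \<in> Fil l" if "v \<in> XLam k l" for v
      using that Fil_subspace
    proof (rule XLam_mult)
      show "Y2 0 ^ Suc n * v \<in> Fil l" if "v \<in> Fil l" for v
        using Ymon_Fil[OF that, of "replicate (Suc n) 0"] by (simp add: mult.assoc flip: prod_list_replicate)
      show "Y2 0 ^ Suc n * (Xmon bs * v) \<in> Fil l" if "v \<in> Lam l" for bs v
      proof -
        have "Y2 0 ^ Suc n * (Xmon bs * v) = Xmon bs * (Y2 0 ^ Suc n * v)"
          by (simp only: mult.assoc[symmetric] Y2_power_commute[OF Y2_Xmon])
        then show ?thesis using J_left[OF nilpotent_Lam[OF that]] J_Fil by auto
      qed
    qed
  qed (use Fil_subspace XLam_subspace Fil_XLam X2_Fil Y2_Fil cartan_Fil[of sl_h2] in auto)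
  show ?thesis by (rule low.ymon_box[OF assms(2)])
qed

definition index_lists :: "(nat list \<times> nat list \<times> nat list) set" where
  "index_lists = {(as, bs, cs). sorted_wrt (<) cs \<and> (\<forall>c\<in>set cs. int c \<le> int n - 1) \<and>
    sorted_wrt (<) bs \<and> (\<forall>b\<in>set bs. int b \<le> int n - int (length cs) - 1) \<and>
    sorted_wrt (\<le>) as \<and> (\<forall>a\<in>set as. int a \<le> int n - int (length cs) - int (length bs) - int (length as))}"

definition normal_monomials :: "sl12 current env set" where
  "normal_monomials = (\<lambda>(as, bs, cs). Ymon as * (Xmon bs * Zmon cs)) ` index_lists"

text \<open>By induction only products with exactly \<open>l\<close> factors \<open>y\<^sub>3\<close> matter. The factors \<open>y\<^sub>2\<close> are straightened
first, then the \<open>x\<^sub>1\<close>, then the \<open>y\<^sub>3\<close>: each step changes only what stands to the right of the factors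
already treated.\<close>

lemma Fil_normal: "Fil l \<subseteq> env.span (normal_monomials \<union> J)"
proof (induction l)
  case 0
  show ?case using Fil_0 by (auto intro: env.span_base)
next
  case (Suc l)
  let ?T = "env.span (normal_monomials \<union> J)"
  have J_T: "J \<subseteq> ?T" by (auto intro: env.span_base)
  have "Ymon as * (Xmon bs * Zmon cs) \<in> ?T" if cs: "length cs < Suc l" for as bs cs
  proof -
    define k where "k = length bs"
    have Z: "Zmon cs \<in> Lam l" if "length cs = l" using Zmon_Lam[OF that] .
    consider "length cs < l" | "length cs = l" "l > n" | "length cs = l" "l \<le> n" "k > n - l"
      | "length cs = l" "l \<le> n" "k \<le> n - l"
      using cs by (cases "length cs < l"; cases "l > n"; cases "k > n - l") auto
    then show ?thesis
    proof cases
      case 1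
      then show ?thesis using Suc monomial_Fil by blast
    next
      case 2
      then show ?thesis using Z Lam_vanish J_left J_T by blast
    next
      case 3
      have "\<not> (length ds = k \<and> sorted_wrt (<) ds \<and> (\<forall>b\<in>set ds. b < n - l))" for ds
      proof
        assume ds: "length ds = k \<and> sorted_wrt (<) ds \<and> (\<forall>b\<in>set ds. b < n - l)"
        then have "length ds = card (set ds)"
          by (simp add: distinct_card strict_sorted_iff)
        also have "\<dots> \<le> card {..<n - l}"
          using ds by (intro card_mono) auto
        finally show False using ds 3 by simp
      qed
      then have "{Xmon ds * w | ds w. length ds = length bs \<and> sorted_wrt (<) ds \<and>
          (\<forall>b\<in>set ds. b < n - l) \<and> w \<in> Lam l} = {}"
        unfolding k_def by blast
      with Xmon_straighten[OF Z[OF 3(1)], of bs] have "Xmon bs * Zmon cs \<in> env.span ({} \<union> Fil l)"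
        by (simp only:)
      then have "Xmon bs * Zmon cs \<in> Fil l"
        by (simp add: span_Fil)
      then show ?thesis using Ymon_Fil Suc by blast
    next
      case 4
      have "Xmon bs * Zmon cs \<in> XLam k l"
        using Xmon_XLam[OF _ Z[OF 4(1)]] k_def by simp
      then have box: "Ymon as * (Xmon bs * Zmon cs) \<in> env.span ({Ymon ds * v | ds v. length ds = length as \<and>
          (\<forall>a\<in>set ds. a < Suc (n - l - k) - length as) \<and> v \<in> XLam k l} \<union> Fil l)"
        using 4 by (intro Ymon_box) auto
      have "Ymon ds * v \<in> ?T" if ds: "length ds = length as" "\<forall>a\<in>set ds. a < Suc (n - l - k) - length as"
          and v: "v \<in> XLam k l" for ds v
        using v env.subspace_span
      proof (rule XLam_mult)
        show "Ymon ds * v \<in> ?T" if "v \<in> Fil l" for v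
          using Ymon_Fil[OF that] Suc by blast
        show "Ymon ds * (Xmon bs' * v) \<in> ?T" if bs': "length bs' = k" and v: "v \<in> Lam l" for bs' v
        proof (rule mult_span_subset[OF env.subspace_span _ Xmon_straighten[OF v]])
          fix u assume "u \<in> {Xmon es * w | es w. length es = length bs' \<and> sorted_wrt (<) es \<and>
              (\<forall>b\<in>set es. b < n - l) \<and> w \<in> Lam l} \<union> Fil l"
          then consider es w where "u = Xmon es * w" "length es = length bs'" "sorted_wrt (<) es"
              "\<forall>b\<in>set es. b < n - l" "w \<in> Lam l" | "u \<in> Fil l" by blast
          then show "Ymon ds * u \<in> ?T"
          proof cases
            case (1 es w)
            have "(Ymon ds * Xmon es) * w \<in> ?T"
              using 1(5) env.subspace_span J_T
            proof (rule Lam_mult)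
              fix gs :: "nat list"
              assume gs: "length gs = l"
              show "(Ymon ds * Xmon es) * Zmon gs \<in> ?T"
              proof (rule mult_span_J[OF Zmon_straighten env.subspace_span J_T])
                fix z assume "z \<in> {Zmon fs | fs. length fs = length gs \<and> sorted_wrt (<) fs \<and> (\<forall>c\<in>set fs. c < n)}"
                then obtain fs where fs: "z = Zmon fs" "length fs = l" "sorted_wrt (<) fs" "\<forall>c\<in>set fs. c < n"
                  using gs by auto
                have eq: "Ymon ds = Ymon (sort ds)" by (rule sl2.ymon_mset) simp
                have "int a \<le> int n - int l - int k - int (length ds)" if "a \<in> set ds" for a
                proof -
                  have "a < Suc (n - l - k) - length ds" using ds that by simp
                  then show ?thesis using 4 by linarith
                qed
                moreover have "int b \<le> int n - int l - 1" if "b \<in> set es" for b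
                proof -
                  have "b < n - l" using 1(4) that by simp
                  then show ?thesis by linarith
                qed
                moreover have "int c \<le> int n - 1" if "c \<in> set fs" for c
                  using fs(4) that by force
                ultimately have "(sort ds, es, fs) \<in> index_lists"
                  unfolding index_lists_def using 1(2,3) fs(2,3) bs' by simp
                then have "(Ymon ds * Xmon es) * z \<in> normal_monomials"
                  unfolding normal_monomials_def fs(1) eq mult.assoc by (rule rev_image_eqI) simp
                then show "(Ymon ds * Xmon es) * z \<in> ?T" by (simp add: env.span_base)
              qed
            qed
            then show ?thesis unfolding 1(1) by (simp only: mult.assoc)
          qed (use Ymon_Fil Suc in blast)
        qed
      qed
      then have "{Ymon ds * v | ds v. length ds = length as \<and>
          (\<forall>a\<in>set ds. a < Suc (n - l - k) - length as) \<and> v \<in> XLam k l} \<union> Fil l \<subseteq> ?T"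
        using Suc by blast
      from env.span_minimal[OF this env.subspace_span] box show ?thesis by blast
    qed
  qed
  then show ?case
    unfolding Fil_def[of "Suc l"] using J_T by (intro env.span_minimal) auto
qed

end

section \<open>Counting and conclusion\<close>

lemma weyl_foldr: "foldr (weyl_act \<Lambda>) us (weyl_coset \<Lambda> v) = weyl_coset \<Lambda> (prod_list us * v)"
  by (induction us) (simp_all add: weyl_act_coset mult.assoc)

lemma weyl_monomial_coset: "weyl_monomial \<Lambda> as bs cs = weyl_coset \<Lambda> (Ymon as * (Xmon bs * Zmon cs))"
  by (simp add: weyl_monomial_def weyl_gen_def weyl_foldr mult.assoc)

lemma sum_Pow_power:
  fixes x :: nat
  shows "(\<Sum>A\<in>Pow {..<N}. x ^ (N - card A)) = (1 + x) ^ N"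
proof -
  have "(1 + x) ^ N = (\<Prod>i<N. 1 + x)" by simp
  also have "\<dots> = (\<Sum>A\<in>Pow {..<N}. (\<Prod>i\<in>A. 1) * (\<Prod>i\<in>{..<N} - A. x))"
    by (rule prod_add) simp
  also have "\<dots> = (\<Sum>A\<in>Pow {..<N}. x ^ (N - card A))"
    by (intro sum.cong refl) (simp add: card_Diff_subset finite_subset[of _ "{..<N}"])
  finally show ?thesis ..
qed

text \<open>Adding its position to each entry turns a weakly increasing list of length \<open>j\<close> with entries at most
\<open>q - j\<close> into a strictly increasing list with entries below \<open>q\<close>.\<close>

definition staircase :: "nat list \<Rightarrow> nat list" where
  "staircase as = map (\<lambda>i. as ! i + i) [0..<length as]"

lemma staircase_strict: "sorted_wrt (\<le>) as \<Longrightarrow> sorted_wrt (<) (staircase as)"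
  unfolding staircase_def by (auto simp: sorted_wrt_iff_nth_less intro: add_le_less_mono)

lemma staircase_inject:
  assumes "staircase as = staircase bs"
  shows "as = bs"
proof (rule nth_equalityI)
  show len: "length as = length bs"
    using arg_cong[OF assms, of length] by (simp add: staircase_def)
  show "as ! i = bs ! i" if "i < length as" for i
    using arg_cong[OF assms, of "\<lambda>xs. xs ! i"] that len by (simp add: staircase_def)
qed

lemma strict_sorted_set_inject:
  fixes as bs :: "nat list"
  assumes "sorted_wrt (<) as" "sorted_wrt (<) bs" "set as = set bs"
  shows "as = bs"
  using assms by (metis sorted_list_of_set.idem_if_sorted_distinct strict_sorted_iff)

context local_weyl begin

text \<open>The lists are encoded by the sets of their entries, those of \<open>as\<close> after \<open>staircase\<close>.\<close>

lemma card_index_lists: "finite index_lists \<and> card index_lists \<le> 4 ^ n"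
proof -
  define S where "S = (SIGMA C:Pow {..<n}. SIGMA B:Pow {..<n - card C}. Pow {..<n - card C - card B})"
  define f :: "nat list \<times> nat list \<times> nat list \<Rightarrow> nat set \<times> nat set \<times> nat set"
    where "f = (\<lambda>(as, bs, cs). (set cs, set bs, set (staircase as)))"
  have fin: "finite S" unfolding S_def by auto
  have "card S = (\<Sum>C\<in>Pow {..<n}. \<Sum>B\<in>Pow {..<n - card C}. 2 ^ (n - card C - card B))"
    unfolding S_def by (simp add: card_SigmaI card_Pow)
  also have "\<dots> = (1 + (1 + 2)) ^ n"
    by (simp only: sum_Pow_power)
  also have "\<dots> = 4 ^ n" by (simp add: eval_nat_numeral)
  finally have card: "card S = 4 ^ n" .
  have inj: "inj_on f index_lists"
  proof (rule inj_onI)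
    fix p q assume "p \<in> index_lists" "q \<in> index_lists" "f p = f q"
    moreover obtain as bs cs where p: "p = (as, bs, cs)" by (cases p)
    moreover obtain as' bs' cs' where q: "q = (as', bs', cs')" by (cases q)
    ultimately have sorted: "sorted_wrt (<) cs" "sorted_wrt (<) cs'" "sorted_wrt (<) bs" "sorted_wrt (<) bs'"
        "sorted_wrt (\<le>) as" "sorted_wrt (\<le>) as'"
      and sets: "set cs = set cs'" "set bs = set bs'" "set (staircase as) = set (staircase as')"
      by (simp_all add: index_lists_def f_def)
    have "cs = cs'" and "bs = bs'"
      by (fact strict_sorted_set_inject[OF sorted(1,2) sets(1)] strict_sorted_set_inject[OF sorted(3,4) sets(2)])+
    moreover have "as = as'"
      by (rule staircase_inject[OF strict_sorted_set_inject[OF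
        staircase_strict[OF sorted(5)] staircase_strict[OF sorted(6)] sets(3)]])
    ultimately show "p = q" by (simp add: p q)
  qed
  have "f ` index_lists \<subseteq> S"
  proof
    fix p assume "p \<in> f ` index_lists"
    then obtain as bs cs where p: "p = (set cs, set bs, set (staircase as))" and
      index: "(as, bs, cs) \<in> index_lists" unfolding f_def by auto
    have cs: "card (set cs) = length cs" and bs: "card (set bs) = length bs"
      using index by (auto simp: index_lists_def distinct_card strict_sorted_iff)
    have "as ! i + i < n - length cs - length bs" if "i < length as" for i
    proof -
      have "int (as ! i) \<le> int n - int (length cs) - int (length bs) - int (length as)"
        using index that by (auto simp: index_lists_def)
      with that show ?thesis by linarith
    qed
    moreover have "c < n" if "c \<in> set cs" for c
      using index that by (force simp: index_lists_def)
    moreover have "b < n - length cs" if "b \<in> set bs" for b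
      using index that by (force simp: index_lists_def)
    ultimately show "p \<in> S"
      unfolding p S_def by (auto simp: cs bs staircase_def)
  qed
  with inj fin card show ?thesis
    by (metis card_inj_on_le inj_on_finite)
qed

theorem normal_monomials_span:
  "LinearCombinations.module.span complex_field (weyl_module \<Lambda>)
    ((\<lambda>(as, bs, cs). weyl_monomial \<Lambda> as bs cs) ` index_lists) = carrier (weyl_module \<Lambda>)"
proof -
  interpret W: vectorspace complex_field "weyl_module \<Lambda>"
    by (rule vectorspace_weyl_module)
  let ?M = "(\<lambda>(as, bs, cs). weyl_monomial \<Lambda> as bs cs) ` index_lists"
  have M: "?M \<subseteq> carrier (weyl_module \<Lambda>)"
    by (auto simp: weyl_monomial_coset carrier_weyl_module)
  interpret sub: submodule complex_field "W.span ?M" "weyl_module \<Lambda>"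
    by (rule W.span_is_submodule[OF M])
  define U where "U = {u. weyl_coset \<Lambda> u \<in> W.span ?M}"
  have "env.subspace U"
  proof (rule env.subspaceI)
    show "0 \<in> U"
      using sub.zero_closed by (simp add: U_def zero_weyl_module)
    show "u + v \<in> U" if "u \<in> U" "v \<in> U" for u v
      using sub.m_closed[of "weyl_coset \<Lambda> u" "weyl_coset \<Lambda> v"] that by (simp add: U_def weyl_add_coset)
    show "env_const c * u \<in> U" if "u \<in> U" for c u
      using sub.smult_closed[of c "weyl_coset \<Lambda> u"] that by (simp add: U_def weyl_smult_coset complex_field_def)
  qed
  moreover have "normal_monomials \<union> J \<subseteq> U"
  proof
    fix u assume "u \<in> normal_monomials \<union> J"
    then show "u \<in> U"
    proof
      assume "u \<in> normal_monomials"
      then have "weyl_coset \<Lambda> u \<in> ?M"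
        unfolding normal_monomials_def by (force simp: weyl_monomial_coset)
      then show "u \<in> U" using W.in_own_span[OF M] by (auto simp: U_def)
    next
      assume "u \<in> J"
      then have "weyl_coset \<Lambda> u = weyl_coset \<Lambda> 0" by (simp add: weyl_coset_eq_iff)
      then show "u \<in> U" using sub.zero_closed by (simp add: U_def zero_weyl_module)
    qed
  qed
  ultimately have "env.span (normal_monomials \<union> J) \<subseteq> U"
    by (intro env.span_minimal)
  then have "U = UNIV"
    using Fil_exhaust Fil_normal by blast
  then have "carrier (weyl_module \<Lambda>) \<subseteq> W.span ?M"
    by (auto simp: U_def carrier_weyl_module)
  then show ?thesis
    using W.span_is_subset2[OF M] by blast
qed

end

theorem proposition3p3:
  fixes \<Lambda> :: weight
  assumes "\<Lambda> \<in> P_plus"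
  shows "LinearCombinations.module.span complex_field (weyl_module \<Lambda>)
      {weyl_monomial \<Lambda> as bs cs | as bs cs.
         sorted_wrt (<) cs \<and> (\<forall>c\<in>set cs. int c \<le> int (weight2 \<Lambda>) - 1) \<and>
         sorted_wrt (<) bs \<and>
           (\<forall>b\<in>set bs. int b \<le> int (weight2 \<Lambda>) - int (length cs) - 1) \<and>
         sorted_wrt (\<le>) as \<and>
           (\<forall>a\<in>set as. int a \<le>
              int (weight2 \<Lambda>) - int (length cs) - int (length bs) - int (length as))}
      = carrier (weyl_module \<Lambda>)
    \<and> vectorspace.fin_dim complex_field (weyl_module \<Lambda>)
    \<and> vectorspace.dim complex_field (weyl_module \<Lambda>) \<le> 4 ^ weight2 \<Lambda>"
proof -
  interpret local_weyl \<Lambda> by unfold_locales (rule assms)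
  interpret W: vectorspace complex_field "weyl_module \<Lambda>"
    by (rule vectorspace_weyl_module)
  let ?M = "(\<lambda>(as, bs, cs). weyl_monomial \<Lambda> as bs cs) ` index_lists"
  have M: "?M \<subseteq> carrier (weyl_module \<Lambda>)"
    by (auto simp: weyl_monomial_coset carrier_weyl_module)
  have fin: "finite ?M" and card: "card ?M \<le> 4 ^ weight2 \<Lambda>"
    using card_index_lists card_image_le[of index_lists] by (auto intro: order.trans)
  have "W.fin_dim"
    unfolding W.fin_dim_def using fin M normal_monomials_span by blast
  moreover have "W.dim \<le> 4 ^ weight2 \<Lambda>"
    using W.gen_ge_dim[OF fin M normal_monomials_span] card by (rule order.trans)
  moreover have "{weyl_monomial \<Lambda> as bs cs | as bs cs.
         sorted_wrt (<) cs \<and> (\<forall>c\<in>set cs. int c \<le> int (weight2 \<Lambda>) - 1) \<and>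
         sorted_wrt (<) bs \<and>
           (\<forall>b\<in>set bs. int b \<le> int (weight2 \<Lambda>) - int (length cs) - 1) \<and>
         sorted_wrt (\<le>) as \<and>
           (\<forall>a\<in>set as. int a \<le>
              int (weight2 \<Lambda>) - int (length cs) - int (length bs) - int (length as))} = ?M"
    (is "?M' = _")
  proof (intro subset_antisym subsetI)
    fix X assume "X \<in> ?M'"
    then obtain as bs cs where "X = weyl_monomial \<Lambda> as bs cs" "(as, bs, cs) \<in> index_lists"
      unfolding index_lists_def by blast
    then show "X \<in> ?M"
      using imageI[of "(as, bs, cs)" index_lists "\<lambda>(as, bs, cs). weyl_monomial \<Lambda> as bs cs"] by simp
  next
    fix X assume "X \<in> ?M"
    then obtain as bs cs where "X = weyl_monomial \<Lambda> as bs cs" "(as, bs, cs) \<in> index_lists"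
      by auto
    then show "X \<in> ?M'"
      unfolding index_lists_def by blast
  qed
  ultimately show ?thesis
    by (simp only: normal_monomials_span simp_thms)
qed

end
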